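(* Let $I$ be an index set, $n\geq 1$, and let $M_{A_1},\dots,M_{A_n}$ be unital completely positive Schur multipliers on $B(\ell^2_I)$ associated with matrices $A_1,\dots,A_n$ (indexed by $I\times I$) with real entries. Then there exist a hyperfinite von Neumann algebra $\mathcal{M}$ equipped with a semifinite normal faithful trace, a commuting tuple $(U_1,\dots,U_n)$ of unital trace preserving $*$-automorphisms of $\mathcal{M}$, and a unital trace preserving one-to-one normal $*$-homomorphism $J\colon B(\ell^2_I)\to\mathcal{M}$ such that $$M_{A_1}^{k_1}\cdots M_{A_n}^{k_n}=E\,U_1^{k_1}\cdots U_n^{k_n}J$$ for all integers $k_1,\dots,k_n\geq 0$, where $E\colon\mathcal{M}\to B(\ell^2_I)$ is the canonical normal faithful trace preserving conditional expectation associated with $J$.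
   Context: $B(\ell^2_I)$ carries its usual trace $\mathrm{Tr}$, and its elements are identified with matrices indexed by $I\times I$. A matrix $A=(a_{ij})_{i,j\in I}$ is a Schur multiplier on $B(\ell^2_I)$ if the map $M_A\colon (b_{ij})_{i,j\in I}\mapsto (a_{ij}b_{ij})_{i,j\in I}$ defines a bounded operator from $B(\ell^2_I)$ to $B(\ell^2_I)$; $M_A$ is called the Schur multiplier associated with $A$. Given a trace preserving unital injective normal $*$-homomorphism $J\colon \mathcal{N}\to\mathcal{M}$ between von Neumann algebras with normal semifinite faithful traces $\tau_{\mathcal N},\tau_{\mathcal M}$, the canonical conditional expectation associated with $J$ is the normal faithful positive map $E\colon\mathcal{M}\to\mathcal{N}$ determined by $\tau_{\mathcal N}(E(y)x)=\tau_{\mathcal M}(yJ(x))$ for $y\in\mathcal{M}$, $x\in \mathcal{N}\cap L^1(\mathcal{N})$; it satisfies $EJ=\mathrm{Id}_{\mathcal N}$. *)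

theory Defs
  imports "HOL-Analysis.Analysis" "HOL-Library.FSet"
begin

section \<open>The Hilbert space of square-summable families\<close>

typedef 'a ell2 = "{x :: 'a \<Rightarrow> complex. (\<lambda>i. (cmod (x i))\<^sup>2) summable_on UNIV}"
  morphisms coord Abs_ell2
  by (rule exI[of _ "\<lambda>_. 0"]) simp

setup_lifting type_definition_ell2

lemma sq_summable_add:
  fixes x y :: "'a \<Rightarrow> complex"
  assumes "(\<lambda>i. (cmod (x i))\<^sup>2) summable_on UNIV" "(\<lambda>i. (cmod (y i))\<^sup>2) summable_on UNIV"
  shows "(\<lambda>i. (cmod (x i + y i))\<^sup>2) summable_on UNIV"
proof -
  have le: "(cmod (a + b))\<^sup>2 \<le> 2 * (cmod a)\<^sup>2 + 2 * (cmod b)\<^sup>2" for a b :: complex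
  proof -
    have "(cmod (a + b))\<^sup>2 \<le> (cmod a + cmod b)\<^sup>2"
      by (intro power_mono norm_triangle_ineq) simp
    also have "\<dots> \<le> 2 * (cmod a)\<^sup>2 + 2 * (cmod b)\<^sup>2"
      using sum_squares_bound[of "cmod a" "cmod b"] by (simp add: power2_sum)
    finally show ?thesis .
  qed
  have "(\<lambda>i. 2 * (cmod (x i))\<^sup>2 + 2 * (cmod (y i))\<^sup>2) summable_on UNIV"
    by (intro summable_on_add summable_on_cmult_right assms)
  then show ?thesis
    by (rule summable_on_comparison_test) (simp_all add: le)
qed

lemma sq_summable_scale:
  fixes x :: "'a \<Rightarrow> complex"
  assumes "(\<lambda>i. (cmod (x i))\<^sup>2) summable_on UNIV"
  shows "(\<lambda>i. (cmod (c * x i))\<^sup>2) summable_on UNIV"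
  using summable_on_cmult_right[OF assms, of "(cmod c)\<^sup>2"] by (simp add: norm_mult power_mult_distrib)

lemma summable_prod_cnj:
  fixes x y :: "'a \<Rightarrow> complex"
  assumes "(\<lambda>i. (cmod (x i))\<^sup>2) summable_on UNIV" "(\<lambda>i. (cmod (y i))\<^sup>2) summable_on UNIV"
  shows "(\<lambda>i. x i * cnj (y i)) summable_on UNIV"
proof -
  have s: "(\<lambda>i. (cmod (x i))\<^sup>2 + (cmod (y i))\<^sup>2) summable_on UNIV"
    by (intro summable_on_add assms)
  have "cmod a * cmod b \<le> (cmod a)\<^sup>2 + (cmod b)\<^sup>2" for a b :: complex
    using sum_squares_bound[of "cmod a" "cmod b"]
      mult_nonneg_nonneg[OF norm_ge_zero[of a] norm_ge_zero[of b]] by linarith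
  then have "(\<lambda>i. norm (x i * cnj (y i))) summable_on UNIV"
    by (intro summable_on_comparison_test[OF s]) (simp_all add: norm_mult)
  then show ?thesis
    by (rule abs_summable_summable)
qed

lemma coord_sq_summable: "(\<lambda>i. (cmod (coord x i))\<^sup>2) summable_on UNIV"
  using coord[of x] by simp

lift_definition ell2_scale :: "complex \<Rightarrow> 'a ell2 \<Rightarrow> 'a ell2" is "\<lambda>c x i. c * x i"
  by (rule sq_summable_scale)

text \<open>Linear in the first argument.\<close>

lift_definition cinner :: "'a ell2 \<Rightarrow> 'a ell2 \<Rightarrow> complex" is
  "\<lambda>x y. \<Sum>\<^sub>\<infinity>i. x i * cnj (y i)" .

lift_definition ket :: "'a \<Rightarrow> 'a ell2" is "\<lambda>i j. if j = i then 1 else 0"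
proof -
  fix i :: 'a
  have "(\<lambda>j. (cmod (if j = i then 1 else 0))\<^sup>2) summable_on {i}" by simp
  then show "(\<lambda>j. (cmod (if j = i then 1 else 0))\<^sup>2) summable_on UNIV"
    by (rule summable_on_cong_neutral[THEN iffD1, rotated -1]) auto
qed

instantiation ell2 :: (type) real_vector
begin
lift_definition zero_ell2 :: "'a ell2" is "\<lambda>_. 0" by simp
lift_definition plus_ell2 :: "'a ell2 \<Rightarrow> 'a ell2 \<Rightarrow> 'a ell2" is "\<lambda>x y i. x i + y i"
  by (rule sq_summable_add)
lift_definition uminus_ell2 :: "'a ell2 \<Rightarrow> 'a ell2" is "\<lambda>x i. - x i" by simp
lift_definition minus_ell2 :: "'a ell2 \<Rightarrow> 'a ell2 \<Rightarrow> 'a ell2" is "\<lambda>x y i. x i - y i"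
proof -
  fix x y :: "'a \<Rightarrow> complex"
  assume a: "(\<lambda>i. (cmod (x i))\<^sup>2) summable_on UNIV" "(\<lambda>i. (cmod (y i))\<^sup>2) summable_on UNIV"
  show "(\<lambda>i. (cmod (x i - y i))\<^sup>2) summable_on UNIV"
    using sq_summable_add[of x "\<lambda>i. - y i"] a by simp
qed
lift_definition scaleR_ell2 :: "real \<Rightarrow> 'a ell2 \<Rightarrow> 'a ell2" is "\<lambda>r x i. of_real r * x i"
  by (rule sq_summable_scale)
instance
  by standard (transfer; simp add: algebra_simps)+
end

lemma cinner_add_left: "cinner (x + y) z = cinner x z + cinner y z"
  by transfer (simp add: distrib_right infsum_add summable_prod_cnj)

lemma cinner_scale_left: "cinner (ell2_scale c x) z = c * cinner x z"
  by transfer (simp add: mult.assoc infsum_cmult_right')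

lemma scaleR_eq_ell2_scale: "r *\<^sub>R x = ell2_scale (of_real r) x"
  by transfer simp

lemma cinner_commute: "cinner y x = cnj (cinner x y)"
  by transfer (simp add: mult.commute flip: infsum_cnj)

lemma cinner_self: "cinner x x = of_real (\<Sum>\<^sub>\<infinity>i. (cmod (coord x i))\<^sup>2)"
proof -
  have "cinner x x = (\<Sum>\<^sub>\<infinity>i. of_real ((cmod (coord x i))\<^sup>2))"
    by (simp add: cinner.rep_eq flip: complex_norm_square)
  also have "\<dots> = of_real (\<Sum>\<^sub>\<infinity>i. (cmod (coord x i))\<^sup>2)"
    by (intro infsumI has_sum_of_real has_sum_infsum coord_sq_summable)
  finally show ?thesis .
qed

instantiation ell2 :: (type) real_inner
begin
definition inner_ell2 :: "'a ell2 \<Rightarrow> 'a ell2 \<Rightarrow> real" where "inner_ell2 x y = Re (cinner x y)"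
definition norm_ell2 :: "'a ell2 \<Rightarrow> real" where
  "norm_ell2 x = sqrt (\<Sum>\<^sub>\<infinity>i. (cmod (coord x i))\<^sup>2)"
definition sgn_ell2 :: "'a ell2 \<Rightarrow> 'a ell2" where "sgn_ell2 x = x /\<^sub>R norm x"
definition dist_ell2 :: "'a ell2 \<Rightarrow> 'a ell2 \<Rightarrow> real" where "dist_ell2 x y = norm (x - y)"
definition uniformity_ell2 :: "('a ell2 \<times> 'a ell2) filter" where
  "uniformity_ell2 = (INF e\<in>{0 <..}. principal {(x, y). dist x y < e})"
definition open_ell2 :: "'a ell2 set \<Rightarrow> bool" where
  "open_ell2 S = (\<forall>x\<in>S. \<forall>\<^sub>F (x', y) in uniformity. x' = x \<longrightarrow> y \<in> S)"
instance
proof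
  fix x y z :: "'a ell2" and r :: real
  show "inner x y = inner y x"
    by (simp add: inner_ell2_def cinner_commute[of x y])
  show "inner (x + y) z = inner x z + inner y z"
    by (simp add: inner_ell2_def cinner_add_left)
  show "inner (r *\<^sub>R x) y = r * inner x y"
    by (simp add: inner_ell2_def scaleR_eq_ell2_scale cinner_scale_left)
  show "0 \<le> inner x x"
    by (simp add: inner_ell2_def cinner_self infsum_nonneg)
  show "(inner x x = 0) = (x = 0)"
  proof
    assume "inner x x = 0"
    then have z: "(\<Sum>\<^sub>\<infinity>i. (cmod (coord x i))\<^sup>2) = 0"
      by (simp add: inner_ell2_def cinner_self)
    have "(cmod (coord x i))\<^sup>2 = 0" for i
      by (rule nonneg_infsum_le_0D[OF eq_refl[OF z] coord_sq_summable]) auto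
    then show "x = 0"
      by transfer auto
  next
    assume "x = 0"
    then show "inner x x = 0"
      unfolding inner_ell2_def by transfer simp
  qed
  show "norm x = sqrt (inner x x)"
    by (simp add: inner_ell2_def norm_ell2_def cinner_self)
qed (rule sgn_ell2_def dist_ell2_def uniformity_ell2_def open_ell2_def)+
end

lemma sum_coord_le_norm: "finite F \<Longrightarrow> (\<Sum>i\<in>F. (cmod (coord x i))\<^sup>2) \<le> (norm x)\<^sup>2"
  by (simp add: norm_ell2_def infsum_nonneg finite_sum_le_infsum coord_sq_summable)

lemma coord_le_norm: "cmod (coord x i) \<le> norm x"
  using sum_coord_le_norm[of "{i}" x] by (simp add: power2_le_iff_abs_le)

lemma norm_ell2_scale: "norm (ell2_scale c x) = cmod c * norm x"
  by (simp add: norm_ell2_def ell2_scale.rep_eq norm_mult power_mult_distrib infsum_cmult_right'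
      real_sqrt_mult)

instance ell2 :: (type) banach
proof
  fix X :: "nat \<Rightarrow> 'a ell2"
  assume X: "Cauchy X"
  have "Cauchy (\<lambda>n. coord (X n) i)" for i
  proof (rule metric_CauchyI)
    fix e :: real assume "0 < e"
    then obtain M where "\<And>m n. m \<ge> M \<Longrightarrow> n \<ge> M \<Longrightarrow> dist (X m) (X n) < e"
      using metric_CauchyD[OF X] by blast
    moreover have "dist (coord (X m) i) (coord (X n) i) \<le> dist (X m) (X n)" for m n
      using coord_le_norm[of "X m - X n" i] by (simp add: dist_norm minus_ell2.rep_eq)
    ultimately have "dist (coord (X m) i) (coord (X n) i) < e" if "m \<ge> M" "n \<ge> M" for m n
      using that by (blast intro: order_le_less_trans)
    then show "\<exists>M. \<forall>m\<ge>M. \<forall>n\<ge>M. dist (coord (X m) i) (coord (X n) i) < e"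
      by blast
  qed
  then have "\<forall>i. \<exists>a. (\<lambda>n. coord (X n) i) \<longlonglongrightarrow> a"
    by (auto simp: Cauchy_convergent_iff convergent_def)
  then obtain l where l: "\<And>i. (\<lambda>n. coord (X n) i) \<longlonglongrightarrow> l i"
    by (auto dest!: choice)
  have tail: "(\<Sum>i\<in>F. (cmod (coord (X m) i - l i))\<^sup>2) \<le> e\<^sup>2"
    if M: "\<And>m n. m \<ge> M \<Longrightarrow> n \<ge> M \<Longrightarrow> dist (X m) (X n) < e" and "m \<ge> M" and "finite F" for e M m F
  proof (rule LIMSEQ_le_const2)
    show "(\<lambda>n. \<Sum>i\<in>F. (cmod (coord (X m) i - coord (X n) i))\<^sup>2)
        \<longlonglongrightarrow> (\<Sum>i\<in>F. (cmod (coord (X m) i - l i))\<^sup>2)"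
      by (intro tendsto_intros l)
    have "(\<Sum>i\<in>F. (cmod (coord (X m) i - coord (X n) i))\<^sup>2) \<le> e\<^sup>2" if "n \<ge> M" for n
    proof -
      have "(\<Sum>i\<in>F. (cmod (coord (X m - X n) i))\<^sup>2) \<le> (norm (X m - X n))\<^sup>2"
        using \<open>finite F\<close> by (rule sum_coord_le_norm)
      also have "\<dots> \<le> e\<^sup>2"
        using M[OF \<open>m \<ge> M\<close> that] by (intro power_mono) (auto simp: dist_norm)
      finally show ?thesis by (simp add: minus_ell2.rep_eq)
    qed
    then show "\<exists>N. \<forall>n\<ge>N. (\<Sum>i\<in>F. (cmod (coord (X m) i - coord (X n) i))\<^sup>2) \<le> e\<^sup>2"
      by blast
  qed
  obtain M1 where M1: "\<And>m n. m \<ge> M1 \<Longrightarrow> n \<ge> M1 \<Longrightarrow> dist (X m) (X n) < 1"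
    using metric_CauchyD[OF X zero_less_one] by blast
  have d: "(\<lambda>i. (cmod (coord (X M1) i - l i))\<^sup>2) summable_on UNIV"
    by (rule nonneg_bdd_above_summable_on)
      (auto intro!: bdd_aboveI[of _ 1] tail[OF M1, simplified])
  have ls: "(\<lambda>i. (cmod (l i))\<^sup>2) summable_on UNIV"
    using sq_summable_add[OF coord_sq_summable[of "X M1"], of "\<lambda>i. l i - coord (X M1) i"] d
    by (simp add: norm_minus_commute)
  define L where "L = Abs_ell2 l"
  have L: "coord L = l"
    using ls by (simp add: L_def Abs_ell2_inverse)
  have "X \<longlonglongrightarrow> L"
  proof (rule metric_LIMSEQ_I)
    fix e :: real assume "0 < e"
    then obtain M where M: "\<And>m n. m \<ge> M \<Longrightarrow> n \<ge> M \<Longrightarrow> dist (X m) (X n) < e / 2"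
      using metric_CauchyD[OF X, of "e / 2"] by auto
    have "dist (X m) L < e" if "m \<ge> M" for m
    proof -
      have "(\<Sum>\<^sub>\<infinity>i. (cmod (coord (X m - L) i))\<^sup>2) \<le> (e / 2)\<^sup>2"
        by (rule infsum_le_finite_sums[OF coord_sq_summable])
          (use tail[OF M that] in \<open>auto simp: minus_ell2.rep_eq L\<close>)
      then have "norm (X m - L) \<le> sqrt ((e / 2)\<^sup>2)"
        unfolding norm_ell2_def by (rule real_sqrt_le_mono)
      then show ?thesis using \<open>0 < e\<close> by (simp add: dist_norm)
    qed
    then show "\<exists>M. \<forall>m\<ge>M. dist (X m) L < e" by blast
  qed
  then show "convergent X" by (auto simp: convergent_def)
qed


section \<open>Bounded operators\<close>

text \<open>The type \<open>'a ell2 \<Rightarrow>\<^sub>L 'a ell2\<close> consists of the real-linear bounded maps; the algebra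
  \<open>B(\<ell>\<^sup>2)\<close> is its subset of complex-linear ones, with product \<open>(o\<^sub>L)\<close>, unit \<open>id_blinfun\<close> and the
  operator norm.\<close>

type_synonym 'a op = "'a ell2 \<Rightarrow>\<^sub>L 'a ell2"

definition Bop :: "'a op set" where
  "Bop = {T :: 'a op. \<forall>c x. T (ell2_scale c x) = ell2_scale c (T x)}"

lemma bounded_linear_ell2_scale: "bounded_linear (ell2_scale c)"
proof (rule bounded_linear_intro[where K = "cmod c"])
  show "ell2_scale c (x + y) = ell2_scale c x + ell2_scale c y" for x y :: "'a ell2"
    by transfer (simp add: distrib_left)
  show "ell2_scale c (r *\<^sub>R x) = r *\<^sub>R ell2_scale c x" for r and x :: "'a ell2"
    by transfer (simp add: mult.left_commute)
  show "norm (ell2_scale c x) \<le> norm x * cmod c" for x :: "'a ell2"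
    by (simp add: norm_ell2_scale mult.commute)
qed

definition op_scale :: "complex \<Rightarrow> 'a op \<Rightarrow> 'a op" where
  "op_scale c T = Blinfun (\<lambda>x. ell2_scale c (T x))"

lemma op_scale_apply [simp]: "op_scale c T x = ell2_scale c (T x)"
  unfolding op_scale_def
  by (subst bounded_linear_Blinfun_apply)
    (auto intro: bounded_linear_compose[OF bounded_linear_ell2_scale] blinfun.bounded_linear_right)

definition op_adj :: "'a op \<Rightarrow> 'a op" where
  "op_adj T = (THE S. S \<in> Bop \<and> (\<forall>x y. cinner (T x) y = cinner x (S y)))"

definition op_positive :: "'a op \<Rightarrow> bool" where
  "op_positive T \<longleftrightarrow> T \<in> Bop \<and> (\<forall>x. cinner (T x) x \<in> \<real>\<^sub>\<ge>\<^sub>0)"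

definition op_le :: "'a op \<Rightarrow> 'a op \<Rightarrow> bool" where
  "op_le S T \<longleftrightarrow> op_positive (T - S)"

definition mat_entry :: "'a op \<Rightarrow> 'a \<Rightarrow> 'a \<Rightarrow> complex" where
  "mat_entry T i j = cinner (T (ket j)) (ket i)"


section \<open>Von Neumann algebras\<close>

definition commutant :: "'a op set \<Rightarrow> 'a op set" where
  "commutant M = {T \<in> Bop. \<forall>S\<in>M. T o\<^sub>L S = S o\<^sub>L T}"

definition von_neumann_algebra :: "'a op set \<Rightarrow> bool" where
  "von_neumann_algebra M \<longleftrightarrow>
     M \<subseteq> Bop \<and> (\<forall>T\<in>M. op_adj T \<in> M) \<and> commutant (commutant M) = M"

definition pos_part :: "'a op set \<Rightarrow> 'a op set" where
  "pos_part M = {T \<in> M. op_positive T}"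

definition star_subalgebra :: "'a op set \<Rightarrow> bool" where
  "star_subalgebra A \<longleftrightarrow> A \<subseteq> Bop \<and> 0 \<in> A \<and>
     (\<forall>S\<in>A. \<forall>T\<in>A. S + T \<in> A \<and> S o\<^sub>L T \<in> A) \<and>
     (\<forall>c. \<forall>T\<in>A. op_scale c T \<in> A) \<and> (\<forall>T\<in>A. op_adj T \<in> A)"

text \<open>An increasing net of finite-dimensional *-subalgebras with dense union. Real and complex
  finite-dimensionality agree for complex subspaces, hence the real \<^const>\<open>span\<close>. On *-subalgebras
  the strong operator closure coincides with the weak operator and (in a von Neumann algebra) the
  weak* closure.\<close>

definition hyperfinite :: "'a op set \<Rightarrow> bool" where
  "hyperfinite M \<longleftrightarrow> (\<exists>\<A>. \<A> \<noteq> {} \<and>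
     (\<forall>A\<in>\<A>. star_subalgebra A \<and> A \<subseteq> M \<and> (\<exists>B. finite B \<and> A \<subseteq> span B)) \<and>
     (\<forall>A\<in>\<A>. \<forall>B\<in>\<A>. \<exists>C\<in>\<A>. A \<subseteq> C \<and> B \<subseteq> C) \<and>
     M \<subseteq> strong_operator_topology closure_of (\<Union>\<A>))"


section \<open>Normality and traces\<close>

text \<open>Bounded increasing nets in the positive cone are rendered as directed sets having a supremum.\<close>

definition is_directed :: "'a op set \<Rightarrow> bool" where
  "is_directed D \<longleftrightarrow> D \<noteq> {} \<and> (\<forall>S\<in>D. \<forall>T\<in>D. \<exists>R\<in>D. op_le S R \<and> op_le T R)"

definition is_sup_in :: "'a op set \<Rightarrow> 'a op set \<Rightarrow> 'a op \<Rightarrow> bool" where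
  "is_sup_in M D S \<longleftrightarrow> S \<in> pos_part M \<and> (\<forall>T\<in>D. op_le T S) \<and>
     (\<forall>R\<in>pos_part M. (\<forall>T\<in>D. op_le T R) \<longrightarrow> op_le S R)"

definition normal_map :: "'a op set \<Rightarrow> 'b op set \<Rightarrow> ('a op \<Rightarrow> 'b op) \<Rightarrow> bool" where
  "normal_map N M \<phi> \<longleftrightarrow>
     (\<forall>D S. D \<subseteq> pos_part N \<and> is_directed D \<and> is_sup_in N D S \<longrightarrow> is_sup_in M (\<phi> ` D) (\<phi> S))"

text \<open>A trace is a weight on the positive cone; only its values on \<^term>\<open>pos_part M\<close> matter.\<close>

definition is_trace :: "'a op set \<Rightarrow> ('a op \<Rightarrow> ennreal) \<Rightarrow> bool" where
  "is_trace M \<tau> \<longleftrightarrow>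
     (\<forall>S\<in>pos_part M. \<forall>T\<in>pos_part M. \<tau> (S + T) = \<tau> S + \<tau> T) \<and>
     (\<forall>r\<ge>0. \<forall>T\<in>pos_part M. \<tau> (r *\<^sub>R T) = ennreal r * \<tau> T) \<and>
     (\<forall>T\<in>M. \<tau> (op_adj T o\<^sub>L T) = \<tau> (T o\<^sub>L op_adj T))"

definition normal_trace :: "'a op set \<Rightarrow> ('a op \<Rightarrow> ennreal) \<Rightarrow> bool" where
  "normal_trace M \<tau> \<longleftrightarrow>
     (\<forall>D S. D \<subseteq> pos_part M \<and> is_directed D \<and> is_sup_in M D S \<longrightarrow> \<tau> S = (SUP T\<in>D. \<tau> T))"

definition semifinite_trace :: "'a op set \<Rightarrow> ('a op \<Rightarrow> ennreal) \<Rightarrow> bool" where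
  "semifinite_trace M \<tau> \<longleftrightarrow>
     (\<forall>T\<in>pos_part M. T \<noteq> 0 \<longrightarrow> (\<exists>S\<in>pos_part M. S \<noteq> 0 \<and> op_le S T \<and> \<tau> S < \<infinity>))"

definition faithful_trace :: "'a op set \<Rightarrow> ('a op \<Rightarrow> ennreal) \<Rightarrow> bool" where
  "faithful_trace M \<tau> \<longleftrightarrow> (\<forall>T\<in>pos_part M. \<tau> T = 0 \<longrightarrow> T = 0)"

definition nsf_trace :: "'a op set \<Rightarrow> ('a op \<Rightarrow> ennreal) \<Rightarrow> bool" where
  "nsf_trace M \<tau> \<longleftrightarrow>
     is_trace M \<tau> \<and> normal_trace M \<tau> \<and> semifinite_trace M \<tau> \<and> faithful_trace M \<tau>"

text \<open>The linear extension of \<open>\<tau>\<close> to its definition ideal \<open>M \<inter> L\<^sup>1(M)\<close>, the linear span of the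
  positive elements of finite trace.\<close>

definition fin_pos :: "'a op set \<Rightarrow> ('a op \<Rightarrow> ennreal) \<Rightarrow> 'a op set" where
  "fin_pos M \<tau> = {T \<in> pos_part M. \<tau> T < \<infinity>}"

definition trace_decomp ::
  "'a op set \<Rightarrow> ('a op \<Rightarrow> ennreal) \<Rightarrow> 'a op \<Rightarrow> complex \<Rightarrow> bool" where
  "trace_decomp M \<tau> T z \<longleftrightarrow>
     (\<exists>a\<in>fin_pos M \<tau>. \<exists>b\<in>fin_pos M \<tau>. \<exists>c\<in>fin_pos M \<tau>. \<exists>d\<in>fin_pos M \<tau>.
        T = (a - b) + op_scale \<i> (c - d) \<and>
        z = Complex (enn2real (\<tau> a) - enn2real (\<tau> b)) (enn2real (\<tau> c) - enn2real (\<tau> d)))"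

definition L1_part :: "'a op set \<Rightarrow> ('a op \<Rightarrow> ennreal) \<Rightarrow> 'a op set" where
  "L1_part M \<tau> = {T. \<exists>z. trace_decomp M \<tau> T z}"

definition trace_ext :: "'a op set \<Rightarrow> ('a op \<Rightarrow> ennreal) \<Rightarrow> 'a op \<Rightarrow> complex" where
  "trace_ext M \<tau> T = (THE z. trace_decomp M \<tau> T z)"

text \<open>The usual trace of \<open>B(\<ell>\<^sup>2)\<close> on positive operators.\<close>

definition Tr :: "'a op \<Rightarrow> ennreal" where
  "Tr T = (\<Sum>\<^sub>\<infinity>i. ennreal (Re (mat_entry T i i)))"


section \<open>Maps between von Neumann algebras\<close>

definition op_linear_on :: "'a op set \<Rightarrow> ('a op \<Rightarrow> 'b op) \<Rightarrow> bool" where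
  "op_linear_on N \<phi> \<longleftrightarrow> (\<forall>S\<in>N. \<forall>T\<in>N. \<phi> (S + T) = \<phi> S + \<phi> T) \<and>
     (\<forall>c. \<forall>T\<in>N. \<phi> (op_scale c T) = op_scale c (\<phi> T))"

definition star_hom :: "'a op set \<Rightarrow> 'b op set \<Rightarrow> ('a op \<Rightarrow> 'b op) \<Rightarrow> bool" where
  "star_hom N M \<phi> \<longleftrightarrow> \<phi> ` N \<subseteq> M \<and> op_linear_on N \<phi> \<and>
     (\<forall>S\<in>N. \<forall>T\<in>N. \<phi> (S o\<^sub>L T) = \<phi> S o\<^sub>L \<phi> T) \<and> (\<forall>T\<in>N. \<phi> (op_adj T) = op_adj (\<phi> T))"

definition unital :: "('a op \<Rightarrow> 'b op) \<Rightarrow> bool" where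
  "unital \<phi> \<longleftrightarrow> \<phi> id_blinfun = id_blinfun"

definition star_automorphism :: "'a op set \<Rightarrow> ('a op \<Rightarrow> 'a op) \<Rightarrow> bool" where
  "star_automorphism M \<phi> \<longleftrightarrow> star_hom M M \<phi> \<and> bij_betw \<phi> M M"

definition trace_preserving ::
  "'a op set \<Rightarrow> ('a op \<Rightarrow> ennreal) \<Rightarrow> ('b op \<Rightarrow> ennreal) \<Rightarrow> ('a op \<Rightarrow> 'b op) \<Rightarrow> bool" where
  "trace_preserving N \<tau>\<^sub>N \<tau>\<^sub>M \<phi> \<longleftrightarrow> (\<forall>T\<in>pos_part N. \<tau>\<^sub>M (\<phi> T) = \<tau>\<^sub>N T)"

definition positive_map :: "'a op set \<Rightarrow> 'b op set \<Rightarrow> ('a op \<Rightarrow> 'b op) \<Rightarrow> bool" where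
  "positive_map N M \<phi> \<longleftrightarrow>
     \<phi> ` N \<subseteq> M \<and> op_linear_on N \<phi> \<and> \<phi> ` pos_part N \<subseteq> pos_part M"

text \<open>An \<open>m \<times> m\<close> matrix of operators is positive as an operator on the direct sum of \<open>m\<close> copies of
  the Hilbert space.\<close>

definition op_matrix_positive :: "nat \<Rightarrow> (nat \<Rightarrow> nat \<Rightarrow> 'a op) \<Rightarrow> bool" where
  "op_matrix_positive m X \<longleftrightarrow>
     (\<forall>\<xi> :: nat \<Rightarrow> 'a ell2. (\<Sum>p<m. \<Sum>q<m. cinner (X p q (\<xi> q)) (\<xi> p)) \<in> \<real>\<^sub>\<ge>\<^sub>0)"

definition completely_positive :: "'a op set \<Rightarrow> 'b op set \<Rightarrow> ('a op \<Rightarrow> 'b op) \<Rightarrow> bool" where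
  "completely_positive N M \<phi> \<longleftrightarrow> \<phi> ` N \<subseteq> M \<and> op_linear_on N \<phi> \<and>
     (\<forall>m X. (\<forall>p<m. \<forall>q<m. X p q \<in> N) \<and> op_matrix_positive m X \<longrightarrow>
        op_matrix_positive m (\<lambda>p q. \<phi> (X p q)))"

definition canonical_cond_exp ::
  "'a op set \<Rightarrow> ('a op \<Rightarrow> ennreal) \<Rightarrow> 'b op set \<Rightarrow> ('b op \<Rightarrow> ennreal) \<Rightarrow>
     ('a op \<Rightarrow> 'b op) \<Rightarrow> ('b op \<Rightarrow> 'a op) \<Rightarrow> bool" where
  "canonical_cond_exp N \<tau>\<^sub>N M \<tau>\<^sub>M J E \<longleftrightarrow>
     positive_map M N E \<and> normal_map M N E \<and> (\<forall>y\<in>pos_part M. E y = 0 \<longrightarrow> y = 0) \<and>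
     (\<forall>y\<in>M. \<forall>x\<in>L1_part N \<tau>\<^sub>N.
        trace_ext N \<tau>\<^sub>N (E y o\<^sub>L x) = trace_ext M \<tau>\<^sub>M (y o\<^sub>L J x))"


section \<open>Schur multipliers\<close>

definition schur_map :: "('i \<Rightarrow> 'i \<Rightarrow> complex) \<Rightarrow> 'i op \<Rightarrow> 'i op" where
  "schur_map A T = (THE S. S \<in> Bop \<and> (\<forall>i j. mat_entry S i j = A i j * mat_entry T i j))"

definition schur_multiplier :: "('i \<Rightarrow> 'i \<Rightarrow> complex) \<Rightarrow> bool" where
  "schur_multiplier A \<longleftrightarrow>
     (\<forall>T\<in>Bop. \<exists>S\<in>Bop. \<forall>i j. mat_entry S i j = A i j * mat_entry T i j) \<and>
     (\<exists>K. \<forall>T\<in>Bop. norm (schur_map A T) \<le> K * norm T)"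


section \<open>Products of powers\<close>

text \<open>\<open>(f 1)^(k 1) \<circ> \<dots> \<circ> (f n)^(k n)\<close>\<close>

definition power_product :: "nat \<Rightarrow> (nat \<Rightarrow> 'a \<Rightarrow> 'a) \<Rightarrow> (nat \<Rightarrow> nat) \<Rightarrow> 'a \<Rightarrow> 'a" where
  "power_product n f k = foldr (\<lambda>l g. (f l ^^ k l) \<circ> g) [1..<Suc n] id"

section \<open>Index type of the dilation space\<close>

text \<open>HOL cannot quantify existentially over types, so the Hilbert space on which the dilating algebra
  acts has to be named. Finite subsets of \<open>'i \<times> nat\<close> label the standard basis of the antisymmetric
  Fock space over \<open>\<ell>\<^sup>2('i \<times> nat)\<close>; hence this type indexes
  \<open>\<ell>\<^sup>2('i)\<close> tensored with that Fock space. Its cardinality is the larger of those of \<open>'i\<close> and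
  \<open>nat\<close>. No condition ties the algebra to this structure.\<close>

type_synonym 'i dilation_index = "'i \<times> ('i \<times> nat) fset"

end

theory Submission
  imports Defs
begin

text \<open>A unital positive Schur multiplier with real entries has a Gram matrix
  \<open>A\<^sub>l(i,j) = \<langle>v\<^sub>i, v\<^sub>j\<rangle>\<close> of real unit vectors. In the Clifford algebra over a real Hilbert space with
  one copy of the space of the \<open>v\<^sub>i\<close> for each slot \<open>(l, m)\<close>, \<open>m\<close> an integer, the \<open>v\<^sub>i\<close> become
  self-adjoint unitaries \<open>c(v\<^sub>i)\<close> with \<open>tr (c(v\<^sub>i) c(v\<^sub>j)) = A\<^sub>l(i,j)\<close>. Let \<open>U\<^sub>l\<close> conjugate matrices over the
  Clifford algebra by the diagonal of the \<open>c(v\<^sub>i)\<close> placed in slot \<open>(l, 0)\<close> and then shift \<open>(l, m)\<close> to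
  \<open>(l, m + 1)\<close>. Each application multiplies the \<open>(i,j)\<close> entry by a product of fresh generators, so the
  trace of the entries picks up a factor \<open>A\<^sub>l(i,j)\<close>. For \<open>l \<noteq> m\<close> the diagonals anticommute instead of
  commuting, but conjugation does not see the sign, so the \<open>U\<^sub>l\<close> commute and a single Clifford
  algebra serves all of them.

  The algebra is the commutant of the right regular representation of the twisted group algebra
  of finite sets of generators, so it is a von Neumann algebra by definition, and its trace and
  conditional expectation are given by vacuum entries.\<close>


section \<open>Vectors of \<open>\<ell>\<^sup>2\<close>\<close>

text \<open>The word "fresh" is made precise by commutation: every operator reached from
  \<open>Jm x\<close> commutes with all generators in slots \<open>(l, m)\<close> with m \<le> 0.
  Conjugation by a diagonal inserts two Clifford factors into each entry, so their signs cancel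
  against any other generator, and the shift then moves the used slot \<open>(l, 0)\<close> to
  \<open>(l, 1)\<close>. The positions run over the integers so that the shift is onto and
  conjugation by it is an automorphism. Given freshness, expanding the two Clifford vectors leaves
  only the diagonal terms of a double sum, and these add up to the Gram entry. Real entries give
  real Gram vectors, and a real unit combination of anticommuting self-adjoint involutions is again
  a self-adjoint involution. Since the index type of the Hilbert space is fixed in advance, the Gram
  vectors may use only the index set itself as coordinates, which rules out the usual quotient and
  completion. All questions of normality rest on one fact: in a commutant, the supremum of a bounded
  directed set is its weak operator limit, so it can be tested on single matrix entries.\<close>

lemma ell2_eqI: "(\<And>i. coord x i = coord y i) \<Longrightarrow> x = y"
  by (simp add: coord_inject[symmetric] fun_eq_iff)

lemmas coord_simps [simp] = zero_ell2.rep_eq plus_ell2.rep_eq uminus_ell2.rep_eq minus_ell2.rep_eq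
  scaleR_ell2.rep_eq ell2_scale.rep_eq ket.rep_eq

lemma coord_sum [simp]: "coord (sum f F) i = (\<Sum>a\<in>F. coord (f a) i)"
  by (induction F rule: infinite_finite_induct) auto

lemma norm_sq_has_sum: "((\<lambda>i. (cmod (coord x i))\<^sup>2) has_sum (norm x)\<^sup>2) UNIV"
  unfolding norm_ell2_def
  by (simp add: infsum_nonneg coord_sq_summable has_sum_infsum)

lemma norm_sq_infsum: "(norm x)\<^sup>2 = (\<Sum>\<^sub>\<infinity>i. (cmod (coord x i))\<^sup>2)"
  by (rule infsumI[OF norm_sq_has_sum, symmetric])

lemma norm_le_coordwise:
  assumes "\<And>k. cmod (coord x k) \<le> cmod (coord y k)"
  shows "norm x \<le> norm y"
proof -
  have "(norm x)\<^sup>2 \<le> (norm y)\<^sup>2"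
    unfolding norm_sq_infsum
    by (intro infsum_mono coord_sq_summable power_mono assms) simp
  then show ?thesis by (simp add: power2_le_iff_abs_le)
qed

text \<open>Bounds on finite partial sums are what the later constructions provide; they give square
  summability and the norm bound at once.\<close>

lemma ell2_exists:
  assumes "\<And>F. finite F \<Longrightarrow> (\<Sum>i\<in>F. (cmod (g i))\<^sup>2) \<le> K\<^sup>2" and "K \<ge> 0"
  shows "\<exists>x. coord x = g \<and> norm x \<le> K"
proof -
  have s: "(\<lambda>i. (cmod (g i))\<^sup>2) summable_on UNIV"
    by (rule nonneg_bdd_above_summable_on) (auto intro!: bdd_aboveI[of _ "K\<^sup>2"] assms)
  define x where "x = Abs_ell2 g"
  have x: "coord x = g" using s by (simp add: x_def Abs_ell2_inverse)
  have "(norm x)\<^sup>2 \<le> K\<^sup>2"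
    unfolding norm_sq_infsum x by (rule infsum_le_finite_sums[OF s]) (use assms in auto)
  then have "norm x \<le> K" using assms(2) by (simp add: power2_le_iff_abs_le)
  with x show ?thesis by blast
qed

lemma cinner_ket_right [simp]: "cinner x (ket i) = coord x i"
proof -
  have "cinner x (ket i) = (\<Sum>\<^sub>\<infinity>j. coord x j * cnj (if j = i then 1 else 0))"
    by (simp add: cinner.rep_eq)
  also have "\<dots> = coord x i"
    by (subst infsum_cong_neutral[where T = "{i}" and g = "\<lambda>j. coord x i"]) auto
  finally show ?thesis .
qed

lemma cinner_eq_flip: "cinner x y = cinner u w \<longleftrightarrow> cinner y x = cinner w u"
  using cinner_commute[of y x] cinner_commute[of w u] by simp

lemma cinner_ket_left [simp]: "cinner (ket i) x = cnj (coord x i)"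
  using cinner_commute[of "ket i" x] by simp

lemma cinner_add_right: "cinner x (y + z) = cinner x y + cinner x z"
  by (metis cinner_commute cinner_add_left complex_cnj_add)

lemma cinner_scale_right: "cinner x (ell2_scale c y) = cnj c * cinner x y"
  by (metis cinner_commute cinner_scale_left complex_cnj_mult)

lemma ell2_scale_minus_one: "ell2_scale (-1) x = - x"
  by (rule ell2_eqI) simp

lemma ell2_scale_one [simp]: "ell2_scale 1 x = x"
  by (rule ell2_eqI) simp

lemma ell2_scale_zero [simp]: "ell2_scale 0 x = 0" "ell2_scale c 0 = 0"
  by (auto intro: ell2_eqI)

lemma ell2_scale_scale [simp]: "ell2_scale c (ell2_scale d x) = ell2_scale (c * d) x"
  by (rule ell2_eqI) simp

lemma ell2_scale_add: "ell2_scale c (x + y) = ell2_scale c x + ell2_scale c y"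
  "ell2_scale (c + d) x = ell2_scale c x + ell2_scale d x"
  by (rule ell2_eqI, simp add: algebra_simps)+

lemma cinner_minus_left: "cinner (- x) y = - cinner x y"
  using cinner_scale_left[of "-1" x y] by (simp add: ell2_scale_minus_one)

lemma cinner_minus_right: "cinner x (- y) = - cinner x y"
  using cinner_scale_right[of x "-1" y] by (simp add: ell2_scale_minus_one)

lemma cinner_diff_left: "cinner (x - y) z = cinner x z - cinner y z"
  using cinner_add_left[of x "- y" z] by (simp add: cinner_minus_left)

lemma cinner_diff_right: "cinner z (x - y) = cinner z x - cinner z y"
  using cinner_add_right[of z x "- y"] by (simp add: cinner_minus_right)

lemma cinner_scaleR_left: "cinner (r *\<^sub>R x) y = r *\<^sub>R cinner x y"
  by (simp add: scaleR_eq_ell2_scale cinner_scale_left scaleR_conv_of_real)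

lemma cinner_scaleR_right: "cinner x (r *\<^sub>R y) = r *\<^sub>R cinner x y"
  by (simp add: scaleR_eq_ell2_scale cinner_scale_right scaleR_conv_of_real)

lemma cinner_zero [simp]: "cinner 0 y = 0" "cinner x 0 = 0"
  using cinner_minus_left[of 0 y] cinner_minus_right[of x 0] by auto

lemma cinner_same: "cinner x x = of_real ((norm x)\<^sup>2)"
  by (simp only: cinner_self norm_sq_infsum)

lemma cinner_sum_left: "cinner (sum f F) y = (\<Sum>a\<in>F. cinner (f a) y)"
  by (induction F rule: infinite_finite_induct) (auto simp: cinner_add_left)

lemma cinner_sum_right: "cinner y (sum f F) = (\<Sum>a\<in>F. cinner y (f a))"
  by (induction F rule: infinite_finite_induct) (auto simp: cinner_add_right)

lemma cmod_cinner_le: "cmod (cinner x y) \<le> norm x * norm y"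
proof (cases "cinner x y = 0")
  case False
  \<comment> \<open>The phase \<open>u\<close> turns the inner product into a nonnegative real, to
    which the real Cauchy-Schwarz inequality for \<open>inner\<close> applies.\<close>
  define u where "u = cnj (cinner x y) / cmod (cinner x y)"
  have u: "cmod u = 1" using False by (simp add: u_def norm_divide)
  have "u * cinner x y = of_real (cmod (cinner x y))"
    using False complex_norm_square[of "cinner x y"]
    by (simp add: u_def field_simps power2_eq_square)
  then have "cmod (cinner x y) = inner (ell2_scale u x) y"
    by (simp add: inner_ell2_def cinner_scale_left)
  also have "\<dots> \<le> norm (ell2_scale u x) * norm y"
    by (rule norm_cauchy_schwarz)
  finally show ?thesis by (simp add: norm_ell2_scale u)
qed simp

lemma bounded_bilinear_cinner: "bounded_bilinear cinner"
  by standard (auto simp: cinner_add_left cinner_add_right cinner_scaleR_left cinner_scaleR_right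
      intro!: exI[of _ 1] cmod_cinner_le)

lemmas tendsto_cinner [tendsto_intros] = bounded_bilinear.tendsto[OF bounded_bilinear_cinner]

lemma tendsto_ell2_scale [tendsto_intros]:
  "(f \<longlongrightarrow> x) F \<Longrightarrow> ((\<lambda>a. ell2_scale c (f a)) \<longlongrightarrow> ell2_scale c x) F"
  by (rule bounded_linear.tendsto[OF bounded_linear_ell2_scale])

lemma tendsto_coord [tendsto_intros]:
  "(f \<longlongrightarrow> x) F \<Longrightarrow> ((\<lambda>a. coord (f a) i) \<longlongrightarrow> coord x i) F"
  using tendsto_cinner[OF _ tendsto_const[of "ket i"], of f x F] by simp

lemma cinner_eqI: "(\<And>y. cinner x y = cinner x' y) \<Longrightarrow> x = x'"
  by (metis cinner_ket_right ell2_eqI)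


section \<open>Complex-linear operators\<close>

text \<open>Unlike \<open>Bop\<close>, this also covers maps between different spaces, such as
  \<open>Vm\<close> and \<open>Qm\<close> below.\<close>

definition clin :: "('a ell2 \<Rightarrow>\<^sub>L 'b ell2) \<Rightarrow> bool" where
  "clin T \<longleftrightarrow> (\<forall>c x. T (ell2_scale c x) = ell2_scale c (T x))"

lemma clinD: "clin T \<Longrightarrow> T (ell2_scale c x) = ell2_scale c (T x)"
  by (simp add: clin_def)

lemma Bop_iff: "T \<in> Bop \<longleftrightarrow> clin T"
  by (simp add: Bop_def clin_def)

lemma clin_zero [simp]: "clin 0" and clin_id [simp]: "clin id_blinfun"
  and clin_add: "clin S \<Longrightarrow> clin T \<Longrightarrow> clin (S + T)"
  and clin_diff: "clin S \<Longrightarrow> clin T \<Longrightarrow> clin (S - T)"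
  and clin_scaleR: "clin T \<Longrightarrow> clin (r *\<^sub>R T)"
  by (auto simp: clin_def plus_blinfun.rep_eq minus_blinfun.rep_eq uminus_blinfun.rep_eq
      scaleR_blinfun.rep_eq ell2_eqI algebra_simps)

lemma clin_comp: "clin S \<Longrightarrow> clin T \<Longrightarrow> clin (S o\<^sub>L T)"
  by (simp add: clin_def)

lemma clin_op_scale: "clin T \<Longrightarrow> clin (op_scale c T)"
  by (simp add: clin_def mult.commute)

lemma clin_sum: "(\<And>a. a \<in> F \<Longrightarrow> clin (f a)) \<Longrightarrow> clin (sum f F)"
  by (induction F rule: infinite_finite_induct) (auto intro: clin_add)

text \<open>Linearity is checked one coordinate at a time and only finite sums have to be bounded,
  so every concrete operator below is obtained without a summability argument of its own.\<close>

lemma op_exists: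
  fixes g :: "'a ell2 \<Rightarrow> 'b \<Rightarrow> complex"
  assumes add: "\<And>x y k. g (x + y) k = g x k + g y k"
    and scale: "\<And>c x k. g (ell2_scale c x) k = c * g x k"
    and bound: "\<And>x F. finite F \<Longrightarrow> (\<Sum>k\<in>F. (cmod (g x k))\<^sup>2) \<le> (K * norm x)\<^sup>2"
    and K: "K \<ge> 0"
  shows "\<exists>T. clin T \<and> norm T \<le> K \<and> (\<forall>x k. coord (blinfun_apply T x) k = g x k)"
proof -
  have "\<exists>y. coord y = g x \<and> norm y \<le> K * norm x" for x
    by (rule ell2_exists) (use bound K in auto)
  then obtain t where t: "\<And>x. coord (t x) = g x" and tn: "\<And>x. norm (t x) \<le> K * norm x"
    by metis
  have bl: "bounded_linear t"
  proof (rule bounded_linear_intro[where K = K])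
    show "t (x + y) = t x + t y" for x y by (rule ell2_eqI) (simp add: t add)
    show "t (r *\<^sub>R x) = r *\<^sub>R t x" for r x
      by (rule ell2_eqI) (simp add: t scale scaleR_eq_ell2_scale)
  qed (use tn in \<open>simp add: mult.commute\<close>)
  have app: "blinfun_apply (Blinfun t) = t" by (rule bounded_linear_Blinfun_apply[OF bl])
  have "clin (Blinfun t)" unfolding clin_def app by (auto intro!: ell2_eqI simp: t scale)
  moreover have "norm (Blinfun t) \<le> K"
    by (rule norm_blinfun_bound[OF K]) (simp add: app tn)
  ultimately show ?thesis using app t by metis
qed

text \<open>Generalised monomial operators: \<open>f\<close> sends an output coordinate to the input coordinate it
  reads, so \<open>mon f s\<close> maps \<open>ket (f k)\<close> to a multiple of \<open>ket k\<close>.\<close>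

definition mon :: "('b \<Rightarrow> 'a) \<Rightarrow> ('b \<Rightarrow> complex) \<Rightarrow> 'a ell2 \<Rightarrow>\<^sub>L 'b ell2" where
  "mon f s = (SOME T. clin T \<and> norm T \<le> 1 \<and> (\<forall>x k. coord (blinfun_apply T x) k = s k * coord x (f k)))"

text \<open>Injectivity is asked only where the weight is nonzero; this admits \<open>Vm\<close> and
  \<open>matrix_unit\<close>, whose index maps are far from injective.\<close>

lemma
  fixes f :: "'b \<Rightarrow> 'a" and s :: "'b \<Rightarrow> complex"
  assumes inj: "inj_on f {k. s k \<noteq> 0}" and s: "\<And>k. cmod (s k) \<le> 1"
  shows clin_mon: "clin (mon f s)" and norm_mon: "norm (mon f s) \<le> 1"
    and coord_mon: "coord (mon f s x) k = s k * coord x (f k)"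
proof -
  have "\<exists>T. clin T \<and> norm T \<le> 1 \<and> (\<forall>x k. coord (blinfun_apply T x) k = s k * coord x (f k))"
  proof (rule op_exists)
    fix x :: "'a ell2" and F :: "'b set"
    assume F: "finite F"
    have "(\<Sum>k\<in>F. (cmod (s k * coord x (f k)))\<^sup>2)
        = (\<Sum>k\<in>F \<inter> {k. s k \<noteq> 0}. (cmod (s k * coord x (f k)))\<^sup>2)"
      by (rule sum.mono_neutral_right) (use F in auto)
    also have "\<dots> \<le> (\<Sum>k\<in>F \<inter> {k. s k \<noteq> 0}. (cmod (coord x (f k)))\<^sup>2)"
      by (intro sum_mono power_mono) (simp_all add: norm_mult mult_left_le_one_le s)
    also have "\<dots> = (\<Sum>k\<in>f ` (F \<inter> {k. s k \<noteq> 0}). (cmod (coord x k))\<^sup>2)"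
      by (subst sum.reindex) (auto intro: inj_on_subset[OF inj])
    also have "\<dots> \<le> (norm x)\<^sup>2"
      using F by (intro sum_coord_le_norm) auto
    finally show "(\<Sum>k\<in>F. (cmod (s k * coord x (f k)))\<^sup>2) \<le> (1 * norm x)\<^sup>2" by simp
  qed (simp_all add: algebra_simps)
  from someI_ex[OF this] show "clin (mon f s)" "norm (mon f s) \<le> 1"
    "coord (mon f s x) k = s k * coord x (f k)"
    unfolding mon_def by blast+
qed

section \<open>Coordinate projections and convergence tested on basis vectors\<close>

definition Pr :: "'a set \<Rightarrow> 'a op" where
  "Pr B = mon id (\<lambda>k. if k \<in> B then 1 else 0)"

lemma coord_Pr [simp]: "coord (Pr B x) k = (if k \<in> B then coord x k else 0)"
  unfolding Pr_def by (subst coord_mon) auto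

lemma clin_Pr [simp]: "clin (Pr B)"
  unfolding Pr_def by (rule clin_mon) auto

lemma Pr_norm_split: "(norm x)\<^sup>2 = (norm (Pr B x))\<^sup>2 + (norm (x - Pr B x))\<^sup>2"
proof -
  have "(norm (Pr B x))\<^sup>2 + (norm (x - Pr B x))\<^sup>2
      = (\<Sum>\<^sub>\<infinity>i. (cmod (coord (Pr B x) i))\<^sup>2 + (cmod (coord (x - Pr B x) i))\<^sup>2)"
    unfolding norm_sq_infsum by (intro infsum_add[symmetric] coord_sq_summable)
  also have "\<dots> = (norm x)\<^sup>2"
    unfolding norm_sq_infsum by (rule infsum_cong) auto
  finally show ?thesis by simp
qed

lemma norm_Pr_finite: "finite F \<Longrightarrow> (norm (Pr F x))\<^sup>2 = (\<Sum>i\<in>F. (cmod (coord x i))\<^sup>2)"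
  unfolding norm_sq_infsum
  by (subst infsum_cong_neutral[where T = F and g = "\<lambda>i. (cmod (coord x i))\<^sup>2"]) auto

lemma Pr_finite_eq_sum:
  assumes "finite F"
  shows "Pr F x = (\<Sum>i\<in>F. ell2_scale (coord x i) (ket i))"
proof (rule ell2_eqI)
  fix k
  have "(\<Sum>i\<in>F. coord x i * (if k = i then 1 else 0)) = (\<Sum>i\<in>F. if i = k then coord x k else 0)"
    by (intro sum.cong) auto
  then show "coord (Pr F x) k = coord (\<Sum>i\<in>F. ell2_scale (coord x i) (ket i)) k"
    using assms by simp
qed

text \<open>The family of sets and the filter are arbitrary because \<open>pinch_tendsto\<close>
  needs sets indexed by finite subsets of another type. Once \<open>B c\<close> contains a finite
  \<open>F\<close>, the error is at most the tail of \<open>x\<close> outside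
  \<open>F\<close>.\<close>

lemma tendsto_Pr:
  assumes ev: "\<And>k. eventually (\<lambda>c. k \<in> B c) G"
  shows "((\<lambda>c. Pr (B c) x) \<longlongrightarrow> x) G"
proof (rule tendstoI)
  fix e :: real assume e: "e > 0"
  have "eventually (\<lambda>F. dist (\<Sum>i\<in>F. (cmod (coord x i))\<^sup>2) ((norm x)\<^sup>2) < e\<^sup>2)
      (finite_subsets_at_top UNIV)"
    using norm_sq_has_sum[of x] e unfolding has_sum_def by (simp add: tendstoD)
  then obtain F where F: "finite F" "dist (\<Sum>i\<in>F. (cmod (coord x i))\<^sup>2) ((norm x)\<^sup>2) < e\<^sup>2"
    by (auto simp: eventually_finite_subsets_at_top)
  have "(norm (x - Pr F x))\<^sup>2 < e\<^sup>2"
    using F Pr_norm_split[of x F] norm_Pr_finite[of F x] by (auto simp: dist_real_def)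
  then have less: "norm (x - Pr F x) < e"
    using e by (simp add: power2_less_imp_less)
  have "eventually (\<lambda>c. \<forall>k\<in>F. k \<in> B c) G"
    using F(1) ev by (simp add: eventually_ball_finite)
  then show "eventually (\<lambda>c. dist (Pr (B c) x) x < e) G"
  proof eventually_elim
    case (elim c)
    have "norm (x - Pr (B c) x) \<le> norm (x - Pr F x)"
      by (rule norm_le_coordwise) (use elim in auto)
    then show ?case using less by (simp add: dist_norm norm_minus_commute)
  qed
qed

lemma Pr_tendsto_finite: "((\<lambda>F. Pr F x) \<longlongrightarrow> x) (finite_subsets_at_top UNIV)"
  by (rule tendsto_Pr) (auto simp: eventually_finite_subsets_at_top)

lemma clin_apply_Pr:
  assumes "clin T" "finite F"
  shows "T (Pr F x) = (\<Sum>i\<in>F. ell2_scale (coord x i) (T (ket i)))"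
  by (simp add: Pr_finite_eq_sum assms blinfun.sum_right clinD)

lemma tendsto_of_ket:
  fixes T :: "'c \<Rightarrow> 'a ell2 \<Rightarrow>\<^sub>L 'b ell2"
  assumes cl: "\<And>c. clin (T c)" "clin S" and K: "\<And>c. norm (T c) \<le> K"
    and ket: "\<And>k. ((\<lambda>c. T c (ket k)) \<longlongrightarrow> S (ket k)) G"
  shows "((\<lambda>c. T c x) \<longlongrightarrow> S x) G"
proof (rule tendstoI)
  fix e :: real assume e: "e > 0"
  \<comment> \<open>\<open>L\<close> controls both tail terms together; the added 1 keeps it
    positive for the division below.\<close>
  define L where "L = \<bar>K\<bar> + norm S + 1"
  have L: "L > 0" unfolding L_def using norm_ge_zero[of S] by linarith
  have "eventually (\<lambda>F. dist (Pr F x) x < e / (2 * L)) (finite_subsets_at_top UNIV)"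
    by (rule tendstoD[OF Pr_tendsto_finite]) (use e L in auto)
  then obtain F where F: "finite F" "dist (Pr F x) x < e / (2 * L)"
    by (auto simp: eventually_finite_subsets_at_top)
  have "((\<lambda>c. T c (Pr F x)) \<longlongrightarrow> S (Pr F x)) G"
    unfolding clin_apply_Pr[OF cl(1) F(1)] clin_apply_Pr[OF cl(2) F(1)]
    by (intro tendsto_intros ket)
  then have "eventually (\<lambda>c. dist (T c (Pr F x)) (S (Pr F x)) < e / 2) G"
    by (rule tendstoD) (use e in auto)
  then show "eventually (\<lambda>c. dist (T c x) (S x) < e) G"
  proof eventually_elim
    case (elim c)
    have "norm (T c (x - Pr F x)) \<le> \<bar>K\<bar> * norm (x - Pr F x)"
      by (rule order_trans[OF norm_blinfun]) (use K[of c] in \<open>auto intro!: mult_right_mono\<close>)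
    moreover have "norm (S (Pr F x - x)) \<le> norm S * norm (x - Pr F x)"
      using norm_blinfun[of S "Pr F x - x"] by (simp add: norm_minus_commute)
    moreover have "T c x - S x = T c (x - Pr F x) + ((T c (Pr F x) - S (Pr F x)) + S (Pr F x - x))"
      by (simp add: blinfun.diff_right)
    ultimately have "norm (T c x - S x) \<le> \<bar>K\<bar> * norm (x - Pr F x)
        + (norm (T c (Pr F x) - S (Pr F x)) + norm S * norm (x - Pr F x))"
      using norm_triangle_ineq[of "T c (x - Pr F x)" "(T c (Pr F x) - S (Pr F x)) + S (Pr F x - x)"]
        norm_triangle_ineq[of "T c (Pr F x) - S (Pr F x)" "S (Pr F x - x)"] by simp
    also have "\<dots> \<le> L * norm (x - Pr F x) + norm (T c (Pr F x) - S (Pr F x))"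
      by (simp add: L_def algebra_simps)
    also have "\<dots> < L * (e / (2 * L)) + e / 2"
      using F(2) elim L by (intro add_strict_mono mult_strict_left_mono)
        (auto simp: dist_norm norm_minus_commute)
    also have "\<dots> = e" using L by simp
    finally show ?case by (simp add: dist_norm)
  qed
qed

lemma op_ket_eqI:
  fixes S T :: "'a ell2 \<Rightarrow>\<^sub>L 'b ell2"
  assumes "clin S" "clin T" "\<And>k. S (ket k) = T (ket k)"
  shows "S = T"
proof (rule blinfun_eqI)
  fix x
  have "((\<lambda>c::'a set. S x) \<longlongrightarrow> T x) (finite_subsets_at_top UNIV)"
    by (rule tendsto_of_ket[where K = "norm S"]) (use assms in auto)
  then show "S x = T x"
    by (metis tendsto_const tendsto_unique finite_subsets_at_top_neq_bot)
qed

lemma mat_entry_coord: "mat_entry T i j = coord (T (ket j)) i"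
  by (simp add: mat_entry_def)

lemma op_entry_eqI:
  assumes "S \<in> Bop" "T \<in> Bop" "\<And>i j. coord (S (ket j)) i = coord (T (ket j)) i"
  shows "S = T"
  using assms by (auto intro!: op_ket_eqI ell2_eqI simp: Bop_iff)

text \<open>The coordinates of \<open>T x\<close> must be \<open>B x (ket k)\<close>. Testing the
  form on the finite vector \<open>y\<close> with these coordinates turns \<open>B x y\<close> into
  their square sum, which is also the squared norm of \<open>y\<close>; dividing the bound on the
  form by \<open>norm y\<close> bounds the square sum.\<close>

lemma form_op_exists:
  fixes B :: "'a ell2 \<Rightarrow> 'b ell2 \<Rightarrow> complex"
  assumes addl: "\<And>x x' y. B (x + x') y = B x y + B x' y"
    and scl: "\<And>c x y. B (ell2_scale c x) y = c * B x y"
    and addr: "\<And>x y y'. B x (y + y') = B x y + B x y'"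
    and scr: "\<And>c x y. B x (ell2_scale c y) = cnj c * B x y"
    and bd: "\<And>x y. cmod (B x y) \<le> K * norm x * norm y"
    and K: "K \<ge> 0"
  shows "\<exists>T. clin T \<and> norm T \<le> K \<and> (\<forall>x y. cinner (blinfun_apply T x) y = B x y)"
proof -
  have sum: "B x (sum h F) = (\<Sum>a\<in>F. B x (h a))" for x and h :: "'b \<Rightarrow> 'b ell2" and F
    by (induction F rule: infinite_finite_induct)
      (use addr scr[of x 0 0] in \<open>auto\<close>)
  have "\<exists>T. clin T \<and> norm T \<le> K \<and> (\<forall>x k. coord (blinfun_apply T x) k = B x (ket k))"
  proof (rule op_exists)
    fix x F assume F: "finite (F :: 'b set)"
    define y where "y = (\<Sum>k\<in>F. ell2_scale (B x (ket k)) (ket k))"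
    define n2 where "n2 = (\<Sum>k\<in>F. (cmod (B x (ket k)))\<^sup>2)"
    have "B x y = (\<Sum>k\<in>F. cnj (B x (ket k)) * B x (ket k))"
      by (simp add: y_def sum scr)
    also have "\<dots> = of_real n2"
      by (simp add: n2_def complex_norm_square[symmetric] mult.commute flip: of_real_power)
    finally have "B x y = of_real n2" .
    moreover have "n2 \<ge> 0" by (simp add: n2_def sum_nonneg)
    ultimately have By: "cmod (B x y) = n2" by simp
    have "coord y k = (\<Sum>i\<in>F. if i = k then B x (ket k) else 0)" for k
      unfolding y_def coord_sum by (intro sum.cong) auto
    then have yc: "coord y k = (if k \<in> F then B x (ket k) else 0)" for k
      using F by simp
    have "Pr F y = y" by (rule ell2_eqI) (simp add: yc)
    then have "(norm y)\<^sup>2 = n2"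
      using norm_Pr_finite[OF F, of y] by (simp add: yc n2_def)
    moreover have "n2 \<le> K * norm x * norm y" using bd[of x y] By by simp
    ultimately have "norm y * norm y \<le> (K * norm x) * norm y" by (simp add: power2_eq_square)
    then have "norm y \<le> K * norm x"
      using K by (cases "norm y = 0") auto
    then show "n2 \<le> (K * norm x)\<^sup>2"
      using \<open>(norm y)\<^sup>2 = n2\<close> by (metis norm_ge_zero power_mono)
  qed (use addl scl K in auto)
  then obtain T where T: "clin T" "norm T \<le> K" "\<And>x k. coord (blinfun_apply T x) k = B x (ket k)"
    by blast
  have "cinner (T x) y = B x y" for x y
  proof -
    have fin: "cinner (T x) (Pr F y) = B x (Pr F y)" if "finite F" for F
      using that by (simp add: Pr_finite_eq_sum cinner_sum_right cinner_scale_right sum scr T)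
    \<comment> \<open>Conjugate linearity is still real linearity, which is enough for continuity in
      \<open>y\<close>.\<close>
    have bl: "bounded_linear (B x)"
    proof (rule bounded_linear_intro[where K = "K * norm x"])
      show "B x (r *\<^sub>R y) = r *\<^sub>R B x y" for r y
        by (simp add: scaleR_eq_ell2_scale scr scaleR_conv_of_real)
    qed (use bd addr in \<open>auto simp: mult.commute\<close>)
    have lim: "((\<lambda>F. B x (Pr F y)) \<longlongrightarrow> B x y) (finite_subsets_at_top UNIV)"
      by (rule bounded_linear.tendsto[OF bl Pr_tendsto_finite])
    have "((\<lambda>F. cinner (T x) (Pr F y)) \<longlongrightarrow> cinner (T x) y) (finite_subsets_at_top UNIV)"
      by (intro tendsto_intros Pr_tendsto_finite)
    moreover have "eventually (\<lambda>F. cinner (T x) (Pr F y) = B x (Pr F y)) (finite_subsets_at_top UNIV)"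
      by (rule eventually_finite_subsets_at_top_weakI) (rule fin)
    ultimately have "((\<lambda>F. B x (Pr F y)) \<longlongrightarrow> cinner (T x) y) (finite_subsets_at_top UNIV)"
      by (rule Lim_transform_eventually)
    then show ?thesis
      using lim tendsto_unique[OF finite_subsets_at_top_neq_bot] by blast
  qed
  with T show ?thesis by blast
qed

section \<open>Adjoints\<close>

lemma op_adj_exists:
  assumes "T \<in> Bop"
  shows "\<exists>S\<in>Bop. \<forall>x y. cinner (T x) y = cinner x (S y)"
proof -
  have "\<exists>S. clin S \<and> norm S \<le> norm T \<and> (\<forall>x y. cinner (blinfun_apply S x) y = cinner x (T y))"
  proof (rule form_op_exists)
    fix x y
    show "cmod (cinner x (T y)) \<le> norm T * norm x * norm y"
      using order_trans[OF cmod_cinner_le mult_left_mono[OF norm_blinfun[of T y] norm_ge_zero[of x]]]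
      by (simp add: mult_ac)
  qed (use assms in \<open>auto simp: cinner_add_left cinner_add_right cinner_scale_left
      cinner_scale_right blinfun.add_right Bop_iff clinD\<close>)
  then obtain S where "clin S" "\<And>x y. cinner (blinfun_apply S x) y = cinner x (T y)" by blast
  then show ?thesis
    by (intro bexI[of _ S]) (simp_all add: Bop_iff cinner_eq_flip[of "blinfun_apply T _"])
qed

lemma
  assumes "T \<in> Bop"
  shows op_adj_Bop [simp]: "op_adj T \<in> Bop"
    and cinner_op_adj: "cinner (T x) y = cinner x (op_adj T y)"
proof -
  have "\<exists>!S. S \<in> Bop \<and> (\<forall>x y. cinner (T x) y = cinner x (S y))"
  proof -
    have "S = S'" if "S \<in> Bop \<and> (\<forall>x y. cinner (T x) y = cinner x (S y))"
      "S' \<in> Bop \<and> (\<forall>x y. cinner (T x) y = cinner x (S' y))" for S S'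
      using that by (intro blinfun_eqI cinner_eqI) (simp add: cinner_eq_flip[of "blinfun_apply S _"])
    with op_adj_exists[OF assms] show ?thesis by blast
  qed
  from theI'[OF this] show "op_adj T \<in> Bop" "cinner (T x) y = cinner x (op_adj T y)"
    unfolding op_adj_def by blast+
qed

lemma op_adj_eqI:
  assumes "T \<in> Bop" "\<And>x y. cinner (T x) y = cinner x (blinfun_apply S y)"
  shows "op_adj T = S"
  by (intro blinfun_eqI cinner_eqI)
    (simp add: cinner_eq_flip[of "blinfun_apply (op_adj T) _"] assms flip: cinner_op_adj[OF assms(1)])

lemma cinner_op_adj_left: "T \<in> Bop \<Longrightarrow> cinner (op_adj T x) y = cinner x (T y)"
  using cinner_op_adj[of T y x] cinner_commute[of "op_adj T x" y] cinner_commute[of x "T y"] by simp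

lemma op_adj_adj [simp]: "T \<in> Bop \<Longrightarrow> op_adj (op_adj T) = T"
  by (rule op_adj_eqI) (auto simp: cinner_op_adj_left)

lemma Bop_simps [simp]: "0 \<in> Bop" "id_blinfun \<in> Bop"
  "S \<in> Bop \<Longrightarrow> T \<in> Bop \<Longrightarrow> S + T \<in> Bop" "S \<in> Bop \<Longrightarrow> T \<in> Bop \<Longrightarrow> S - T \<in> Bop"
  "S \<in> Bop \<Longrightarrow> T \<in> Bop \<Longrightarrow> S o\<^sub>L T \<in> Bop" "T \<in> Bop \<Longrightarrow> op_scale c T \<in> Bop"
  "T \<in> Bop \<Longrightarrow> r *\<^sub>R T \<in> Bop" "Pr B \<in> Bop"
  by (auto simp: Bop_iff clin_add clin_diff clin_comp clin_op_scale clin_scaleR)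

lemma op_adj_add: "S \<in> Bop \<Longrightarrow> T \<in> Bop \<Longrightarrow> op_adj (S + T) = op_adj S + op_adj T"
  by (rule op_adj_eqI) (auto simp: blinfun.add_left cinner_add_left cinner_add_right cinner_op_adj)

lemma op_adj_scaleR: "T \<in> Bop \<Longrightarrow> op_adj (r *\<^sub>R T) = r *\<^sub>R op_adj T"
  by (rule op_adj_eqI)
    (auto simp: blinfun.scaleR_left cinner_scaleR_left cinner_scaleR_right cinner_op_adj)

lemma op_adj_diff: "S \<in> Bop \<Longrightarrow> T \<in> Bop \<Longrightarrow> op_adj (S - T) = op_adj S - op_adj T"
  by (rule op_adj_eqI) (auto simp: blinfun.diff_left cinner_diff_left cinner_diff_right cinner_op_adj)

lemma op_adj_comp: "S \<in> Bop \<Longrightarrow> T \<in> Bop \<Longrightarrow> op_adj (S o\<^sub>L T) = op_adj T o\<^sub>L op_adj S"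
  by (rule op_adj_eqI) (auto simp: cinner_op_adj)

lemma op_adj_scale: "T \<in> Bop \<Longrightarrow> op_adj (op_scale c T) = op_scale (cnj c) (op_adj T)"
  by (rule op_adj_eqI) (auto simp: cinner_scale_left cinner_scale_right cinner_op_adj)

lemma op_adj_id [simp]: "op_adj id_blinfun = id_blinfun"
  by (rule op_adj_eqI) auto

lemma op_adj_zero [simp]: "op_adj 0 = 0"
  by (rule op_adj_eqI) auto

lemma coord_op_adj: "T \<in> Bop \<Longrightarrow> coord (op_adj T (ket j)) i = cnj (coord (T (ket i)) j)"
  using cinner_op_adj[of T "ket i" "ket j"] by simp

lemma op_adj_Pr [simp]: "op_adj (Pr B) = Pr B"
  by (rule op_entry_eqI) (auto simp: coord_op_adj)


section \<open>Direct sums\<close>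

text \<open>Bessel's inequality for the orthogonal pieces into which the fibres of
  \<open>\<pi>\<close> cut \<open>x\<close>.\<close>

lemma sum_norm_fibres_le:
  assumes "finite G"
  shows "(\<Sum>g\<in>G. (norm (Pr (\<pi> -` {g}) x))\<^sup>2) \<le> (norm x)\<^sup>2"
proof -
  have "(\<Sum>g\<in>G. (norm (Pr (\<pi> -` {g}) x))\<^sup>2) = (norm (Pr (\<pi> -` G) x))\<^sup>2"
    using assms
  proof (induction G)
    case empty
    have "Pr (\<pi> -` {}) x = 0" by (rule ell2_eqI) simp
    then show ?case by simp
  next
    case (insert g G)
    let ?z = "Pr (\<pi> -` insert g G) x"
    have "Pr (\<pi> -` {g}) ?z = Pr (\<pi> -` {g}) x" by (rule ell2_eqI) simp
    moreover have "?z - Pr (\<pi> -` {g}) ?z = Pr (\<pi> -` G) x"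
      using insert.hyps by (intro ell2_eqI) auto
    ultimately show ?case
      using Pr_norm_split[of ?z "\<pi> -` {g}"] insert by simp
  qed
  also have "\<dots> \<le> (norm x)\<^sup>2" using Pr_norm_split[of x "\<pi> -` G"] by simp
  finally show ?thesis .
qed

text \<open>The block diagonal operator whose block on the fibre over \<open>g\<close> is the
  compression of \<open>T g\<close> to that fibre; for constant \<open>T\<close> it is a pinching.
  \<open>K\<close> is quantified inside because the one chosen operator has to meet every admissible
  bound.\<close>

definition dsum :: "('a \<Rightarrow> 'g) \<Rightarrow> ('g \<Rightarrow> 'a op) \<Rightarrow> 'a op" where
  "dsum \<pi> T = (SOME S. clin S \<and> (\<forall>K\<ge>0. (\<forall>g. norm (T g) \<le> K) \<longrightarrow> norm S \<le> K) \<and>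
     (\<forall>x k. coord (blinfun_apply S x) k = coord (T (\<pi> k) (Pr (\<pi> -` {\<pi> k}) x)) k))"

lemma
  fixes T :: "'g \<Rightarrow> 'a op" and \<pi> :: "'a \<Rightarrow> 'g"
  assumes cl: "\<And>g. clin (T g)" and bd: "\<And>g. norm (T g) \<le> K"
  shows clin_dsum: "clin (dsum \<pi> T)" and norm_dsum: "norm (dsum \<pi> T) \<le> K"
    and coord_dsum: "coord (dsum \<pi> T x) k = coord (T (\<pi> k) (Pr (\<pi> -` {\<pi> k}) x)) k"
proof -
  have ex: "\<exists>S. clin S \<and> norm S \<le> L \<and>
      (\<forall>x k. coord (blinfun_apply S x) k = coord (T (\<pi> k) (Pr (\<pi> -` {\<pi> k}) x)) k)"
    if L: "L \<ge> 0" and bd: "\<And>g. norm (T g) \<le> L" for L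
  proof (rule op_exists)
    fix x F assume F: "finite (F :: 'a set)"
    let ?h = "\<lambda>k. (cmod (coord (T (\<pi> k) (Pr (\<pi> -` {\<pi> k}) x)) k))\<^sup>2"
    have "sum ?h F = (\<Sum>g\<in>\<pi> ` F. sum ?h {k \<in> F. \<pi> k = g})"
      by (rule sum.image_gen[OF F])
    also have "\<dots> \<le> (\<Sum>g\<in>\<pi> ` F. (L * norm (Pr (\<pi> -` {g}) x))\<^sup>2)"
    proof (rule sum_mono)
      fix g
      have "sum ?h {k \<in> F. \<pi> k = g}
          = (\<Sum>k\<in>{k \<in> F. \<pi> k = g}. (cmod (coord (T g (Pr (\<pi> -` {g}) x)) k))\<^sup>2)"
        by (intro sum.cong) auto
      also have "\<dots> \<le> (norm (T g (Pr (\<pi> -` {g}) x)))\<^sup>2"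
        by (rule sum_coord_le_norm) (use F in auto)
      also have "\<dots> \<le> (L * norm (Pr (\<pi> -` {g}) x))\<^sup>2"
        by (intro power_mono order_trans[OF norm_blinfun] mult_right_mono bd) auto
      finally show "sum ?h {k \<in> F. \<pi> k = g} \<le> (L * norm (Pr (\<pi> -` {g}) x))\<^sup>2" .
    qed
    also have "\<dots> = L\<^sup>2 * (\<Sum>g\<in>\<pi> ` F. (norm (Pr (\<pi> -` {g}) x))\<^sup>2)"
      by (simp add: power_mult_distrib sum_distrib_left)
    also have "\<dots> \<le> (L * norm x)\<^sup>2"
      unfolding power_mult_distrib
      by (intro mult_left_mono sum_norm_fibres_le) (use F in auto)
    finally show "sum ?h F \<le> (L * norm x)\<^sup>2" .
  qed (use L cl in \<open>auto simp: blinfun.add_right clinD clin_Pr\<close>)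
  have K: "K \<ge> 0" using order_trans[OF norm_ge_zero bd] .
  obtain S where S: "clin S" "norm S \<le> K"
    "\<And>x k. coord (blinfun_apply S x) k = coord (T (\<pi> k) (Pr (\<pi> -` {\<pi> k}) x)) k"
    using ex[OF K bd] by blast
  \<comment> \<open>The operator constructed for \<open>L\<close> has the same coordinates as
    \<open>S\<close>, hence equals it.\<close>
  have "norm S \<le> L" if L: "L \<ge> 0" "\<forall>g. norm (T g) \<le> L" for L
  proof -
    obtain S' where S': "clin S'" "norm S' \<le> L"
      "\<And>x k. coord (blinfun_apply S' x) k = coord (T (\<pi> k) (Pr (\<pi> -` {\<pi> k}) x)) k"
      using ex[OF L(1)] L(2) by blast
    have "S' = S" by (intro blinfun_eqI ell2_eqI) (simp add: S S')
    then show ?thesis using S' by simp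
  qed
  then have "\<exists>S. clin S \<and> (\<forall>K\<ge>0. (\<forall>g. norm (T g) \<le> K) \<longrightarrow> norm S \<le> K) \<and>
     (\<forall>x k. coord (blinfun_apply S x) k = coord (T (\<pi> k) (Pr (\<pi> -` {\<pi> k}) x)) k)"
    using S by blast
  from someI_ex[OF this] show "clin (dsum \<pi> T)" "norm (dsum \<pi> T) \<le> K"
    "coord (dsum \<pi> T x) k = coord (T (\<pi> k) (Pr (\<pi> -` {\<pi> k}) x)) k"
    unfolding dsum_def using K bd by blast+
qed


section \<open>Positive operators\<close>

lemma polarization:
  assumes "T \<in> Bop"
  shows "4 * cinner (T x) y = cinner (T (x + y)) (x + y) - cinner (T (x - y)) (x - y)
    + \<i> * (cinner (T (x + ell2_scale \<i> y)) (x + ell2_scale \<i> y)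
         - cinner (T (x - ell2_scale \<i> y)) (x - ell2_scale \<i> y))"
  using assms
  by (simp add: cinner_add_left cinner_add_right cinner_diff_left cinner_diff_right
      cinner_scale_left cinner_scale_right blinfun.add_right blinfun.diff_right Bop_iff clinD
      algebra_simps)

lemma op_zeroI:
  assumes "T \<in> Bop" "\<And>x. cinner (T x) x = 0"
  shows "T = 0"
proof (intro blinfun_eqI cinner_eqI)
  fix x y
  have "4 * cinner (T x) y = 0" unfolding polarization[OF assms(1)] assms(2) by simp
  then show "cinner (T x) y = cinner (blinfun_apply 0 x) y" by simp
qed

lemma selfadjointI:
  assumes T: "T \<in> Bop" and Im: "\<And>x. Im (cinner (T x) x) = 0"
  shows "op_adj T = T"
proof -
  have "op_adj T - T = 0"
  proof (rule op_zeroI)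
    fix x
    have "cinner (op_adj T x) x = cnj (cinner (T x) x)"
      using T by (simp add: cinner_op_adj_left cinner_commute[of "T x" x])
    also have "\<dots> = cinner (T x) x" using Im by (simp add: complex_eq_iff)
    finally show "cinner ((op_adj T - T) x) x = 0"
      by (simp add: blinfun.diff_left cinner_diff_left)
  qed (use T in auto)
  then show ?thesis by simp
qed

lemma op_positive_iff:
  "op_positive T \<longleftrightarrow> T \<in> Bop \<and> (\<forall>x. Im (cinner (T x) x) = 0 \<and> Re (cinner (T x) x) \<ge> 0)"
  by (auto simp: op_positive_def complex_nonneg_Reals_iff)

lemma op_positive_Bop: "op_positive T \<Longrightarrow> T \<in> Bop"
  by (simp add: op_positive_def)

lemma op_positive_adj: "op_positive T \<Longrightarrow> op_adj T = T"
  by (rule selfadjointI) (auto simp: op_positive_iff)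

lemma op_positive_zero [simp]: "op_positive 0"
  by (simp add: op_positive_iff)

lemma op_positive_add: "op_positive S \<Longrightarrow> op_positive T \<Longrightarrow> op_positive (S + T)"
  by (auto simp: op_positive_iff blinfun.add_left cinner_add_left)

lemma op_positive_scaleR: "r \<ge> 0 \<Longrightarrow> op_positive T \<Longrightarrow> op_positive (r *\<^sub>R T)"
  by (auto simp: op_positive_iff blinfun.scaleR_left cinner_scaleR_left)

lemma op_positive_conj:
  assumes "op_positive T" "S \<in> Bop"
  shows "op_positive (S o\<^sub>L T o\<^sub>L op_adj S)"
  unfolding op_positive_iff using assms cinner_op_adj[OF assms(2)]
  by (auto simp: op_positive_iff)

lemma op_positive_adj_self: "S \<in> Bop \<Longrightarrow> op_positive (op_adj S o\<^sub>L S)"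
  by (auto simp: op_positive_iff cinner_op_adj_left cinner_same)

lemma op_le_iff:
  assumes "S \<in> Bop" "T \<in> Bop"
  shows "op_le S T \<longleftrightarrow>
    (\<forall>x. Im (cinner (S x) x) = Im (cinner (T x) x) \<and> Re (cinner (S x) x) \<le> Re (cinner (T x) x))"
  using assms by (auto simp: op_le_def op_positive_iff blinfun.diff_left cinner_diff_left)

lemma op_le_trans: "op_le R S \<Longrightarrow> op_le S T \<Longrightarrow> op_le R T"
  using op_positive_add[of "S - R" "T - S"] by (simp add: op_le_def)

lemma op_le_refl [simp]: "op_le S S"
  by (simp add: op_le_def)

lemma op_le_antisym:
  assumes "op_le S T" "op_le T S"
  shows "S = T"
proof -
  have "T - S = 0"
  proof (rule op_zeroI)
    show "T - S \<in> Bop" using assms by (simp add: op_le_def op_positive_Bop)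
    show "cinner ((T - S) x) x = 0" for x
      using assms unfolding op_le_def op_positive_iff
      by (auto simp: blinfun.diff_left cinner_diff_left complex_eq_iff intro!: antisym)
  qed
  then show ?thesis by simp
qed

text \<open>The form of \<open>T\<close> is a possibly degenerate inner product. Evaluating it at
  \<open>x - r w y\<close>, where the factor \<open>w\<close> absorbs the phase, gives a real
  quadratic in \<open>r\<close> that is nowhere negative.\<close>

lemma op_positive_Cauchy_Schwarz:
  assumes T: "op_positive T"
  shows "(cmod (cinner (T x) y))\<^sup>2 \<le> Re (cinner (T x) x) * Re (cinner (T y) y)"
proof -
  define w where "w = cinner (T x) y"
  define a where "a = Re (cinner (T x) x)"
  define b where "b = Re (cinner (T y) y)"
  have TB: "T \<in> Bop" using T by (simp add: op_positive_Bop)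
  have yx: "cinner (T y) x = cnj w"
    using cinner_op_adj[OF TB, of y x] by (simp add: op_positive_adj[OF T] w_def cinner_commute[of "T x" y])
  have a: "cinner (T x) x = of_real a" "a \<ge> 0" and b: "cinner (T y) y = of_real b" "b \<ge> 0"
    using T by (auto simp: op_positive_iff complex_eq_iff a_def b_def)
  have key: "a - 2 * r * (cmod w)\<^sup>2 + r\<^sup>2 * (cmod w)\<^sup>2 * b \<ge> 0" for r :: real
  proof -
    let ?z = "x - ell2_scale (of_real r * w) y"
    have "cinner (T ?z) ?z = of_real a - of_real r * (w * cnj w) - of_real r * (w * cnj w)
        + (of_real r)\<^sup>2 * (w * cnj w) * of_real b"
      using TB by (simp add: blinfun.diff_right Bop_iff clinD cinner_diff_left cinner_diff_right
          cinner_scale_left cinner_scale_right a b yx w_def[symmetric] power2_eq_square algebra_simps)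
    also have "\<dots> = of_real (a - 2 * r * (cmod w)\<^sup>2 + r\<^sup>2 * (cmod w)\<^sup>2 * b)"
      by (simp add: complex_norm_square[symmetric])
    finally have "Re (cinner (T ?z) ?z) = a - 2 * r * (cmod w)\<^sup>2 + r\<^sup>2 * (cmod w)\<^sup>2 * b"
      by simp
    then show ?thesis using T by (metis op_positive_iff)
  qed
  have "(cmod w)\<^sup>2 \<le> a * b"
  proof (cases "b = 0")
    case True
    have "w = 0"
    proof (rule ccontr)
      assume w: "w \<noteq> 0"
      \<comment> \<open>For \<open>b = 0\<close> the quadratic is affine in \<open>r\<close>; this
        \<open>r\<close> would give it the value -1.\<close>
      have "a - 2 * ((a + 1) / (2 * (cmod w)\<^sup>2)) * (cmod w)\<^sup>2 \<ge> 0"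
        using key[of "(a + 1) / (2 * (cmod w)\<^sup>2)"] by (simp add: True)
      then show False using w by simp
    qed
    then show ?thesis using True by simp
  next
    case False
    then have "b > 0" using b by simp
    \<comment> \<open>The quadratic attains its minimum at \<open>r = 1 / b\<close>.\<close>
    then have "0 \<le> (a - (cmod w)\<^sup>2 / b) * b"
      using key[of "1 / b"] by (intro mult_nonneg_nonneg) (simp_all add: power2_eq_square)
    also have "\<dots> = a * b - (cmod w)\<^sup>2" using \<open>b > 0\<close> by (simp add: field_simps)
    finally show ?thesis by simp
  qed
  then show ?thesis by (simp add: w_def a_def b_def)
qed

text \<open>Cauchy-Schwarz for the form of \<open>T\<close> at \<open>y = T x\<close>, divided by
  the squared norm of \<open>T x\<close>. In particular a vanishing \<open>cinner (T x) x\<close>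
  forces \<open>T x = 0\<close>.\<close>

lemma op_positive_norm_sq_le:
  assumes T: "op_positive T"
  shows "(norm (T x))\<^sup>2 \<le> norm T * Re (cinner (T x) x)"
proof (cases "T x = 0")
  case True
  then show ?thesis by simp
next
  case False
  let ?n = "(norm (T x))\<^sup>2" and ?q = "Re (cinner (T x) x)"
  have q: "?q \<ge> 0" using T by (simp add: op_positive_iff)
  have "Re (cinner (T (T x)) (T x)) \<le> norm (T (T x)) * norm (T x)"
    using complex_Re_le_cmod cmod_cinner_le order_trans by blast
  also have "\<dots> \<le> norm T * ?n"
    unfolding power2_eq_square mult.assoc[symmetric] by (intro mult_right_mono norm_blinfun) simp
  finally have le: "Re (cinner (T (T x)) (T x)) \<le> norm T * ?n" .
  have "?n\<^sup>2 = (cmod (cinner (T x) (T x)))\<^sup>2" by (simp add: cinner_same norm_power)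
  also have "\<dots> \<le> ?q * Re (cinner (T (T x)) (T x))" by (rule op_positive_Cauchy_Schwarz[OF T])
  also have "\<dots> \<le> ?q * (norm T * ?n)" by (rule mult_left_mono[OF le q])
  finally have "?n * ?n \<le> (norm T * ?q) * ?n" by (simp add: power2_eq_square[of ?n] mult_ac)
  moreover have "?n > 0" using False by simp
  ultimately show ?thesis by (rule mult_right_le_imp_le)
qed

lemma Re_cinner_le_norm: "Re (cinner (blinfun_apply T x) x) \<le> norm T * (norm x)\<^sup>2"
proof -
  have "Re (cinner (T x) x) \<le> norm (T x) * norm x"
    using complex_Re_le_cmod cmod_cinner_le order_trans by blast
  also have "\<dots> \<le> norm T * norm x * norm x"
    by (intro mult_right_mono norm_blinfun) simp
  finally show ?thesis by (simp add: power2_eq_square mult.assoc)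
qed

text \<open>Estimating \<open>S x\<close> through the forms of \<open>S\<close> and then
  \<open>T\<close> yields \<open>norm S * norm S\<close> \<le> \<open>norm S * norm T\<close>, which
  is divided by \<open>norm S\<close>.\<close>

lemma op_le_norm_mono:
  assumes "op_positive S" "op_le S T" "T \<in> Bop"
  shows "norm S \<le> norm T"
proof (cases "norm S = 0")
  case False
  have "(norm (S x))\<^sup>2 \<le> (sqrt (norm S * norm T) * norm x)\<^sup>2" for x
  proof -
    have "(norm (S x))\<^sup>2 \<le> norm S * Re (cinner (S x) x)"
      by (rule op_positive_norm_sq_le[OF assms(1)])
    also have "\<dots> \<le> norm S * Re (cinner (T x) x)"
      using assms op_le_iff[of S T] op_positive_Bop[of S] by (intro mult_left_mono) auto
    also have "\<dots> \<le> norm S * (norm T * (norm x)\<^sup>2)"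
      by (intro mult_left_mono Re_cinner_le_norm) simp
    finally show ?thesis by (simp add: power_mult_distrib mult.assoc)
  qed
  then have "norm (S x) \<le> sqrt (norm S * norm T) * norm x" for x
    by (rule power2_le_imp_le) simp
  then have "norm S \<le> sqrt (norm S * norm T)"
    by (intro norm_blinfun_bound) auto
  then have "(norm S)\<^sup>2 \<le> (sqrt (norm S * norm T))\<^sup>2"
    by (rule power_mono) simp
  then have "norm S * norm S \<le> norm S * norm T"
    by (simp add: power2_eq_square)
  then show ?thesis using False by simp
qed simp


section \<open>Square roots\<close>

lemma blinfun_diff_compose:
  "(S - T) o\<^sub>L R = (S o\<^sub>L R) - (T o\<^sub>L R)" "R o\<^sub>L (S - T) = (R o\<^sub>L S) - (R o\<^sub>L T)"
  "(S + T) o\<^sub>L R = (S o\<^sub>L R) + (T o\<^sub>L R)" "R o\<^sub>L (S + T) = (R o\<^sub>L S) + (R o\<^sub>L T)"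
  "(r *\<^sub>R S) o\<^sub>L R = r *\<^sub>R (S o\<^sub>L R)" "R o\<^sub>L (r *\<^sub>R S) = r *\<^sub>R (R o\<^sub>L S)"
  by (rule blinfun_eqI, simp add: blinfun.diff_left blinfun.diff_right blinfun.add_left
      blinfun.add_right blinfun.scaleR_left blinfun.scaleR_right)+

lemma blinfun_compose_id [simp]: "id_blinfun o\<^sub>L T = T" "T o\<^sub>L id_blinfun = T"
  by (rule blinfun_eqI, simp)+

lemma blinfun_compose_assoc: "(S o\<^sub>L T) o\<^sub>L R = S o\<^sub>L (T o\<^sub>L R)"
  by (rule blinfun_eqI) simp

text \<open>A fixed point satisfies \<open>2 Y = A + Y Y\<close>, hence
  \<open>(1 - Y)(1 - Y) = 1 - A\<close>. For \<open>A = 1 - T\<close> the operator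
  \<open>1 - Y\<close> is therefore a square root of \<open>T\<close>.\<close>

primrec sqrt_iter :: "'a op \<Rightarrow> nat \<Rightarrow> 'a op" where
  "sqrt_iter A 0 = 0"
| "sqrt_iter A (Suc n) = (1/2) *\<^sub>R (A + (sqrt_iter A n o\<^sub>L sqrt_iter A n))"

primrec sqrt_bound :: "nat \<Rightarrow> real" where
  "sqrt_bound 0 = 0"
| "sqrt_bound (Suc n) = (1 + (sqrt_bound n)\<^sup>2) / 2"

lemma sqrt_bound_bounds: "0 \<le> sqrt_bound n \<and> sqrt_bound n \<le> 1"
proof (induction n)
  case (Suc n)
  then have "(sqrt_bound n)\<^sup>2 \<le> 1\<^sup>2" by (intro power_mono) auto
  then show ?case by simp
qed simp

lemma sqrt_bound_Suc: "sqrt_bound n \<le> sqrt_bound (Suc n)"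
  using zero_le_power2[of "1 - sqrt_bound n"] by (simp add: power2_diff)

text \<open>Comparison with a monotone bounded scalar iteration makes the operator iteration converge in norm.\<close>

lemma sqrt_iter_bounds:
  assumes A: "norm A \<le> 1"
  shows "norm (sqrt_iter A n) \<le> sqrt_bound n \<and>
    norm (sqrt_iter A (Suc n) - sqrt_iter A n) \<le> sqrt_bound (Suc n) - sqrt_bound n"
proof (induction n)
  case 0
  then show ?case using A by simp
next
  case (Suc n)
  let ?Y = "sqrt_iter A" and ?y = sqrt_bound
  have n1: "norm (?Y (Suc n)) \<le> ?y (Suc n)"
  proof -
    have "norm (?Y n o\<^sub>L ?Y n) \<le> (?y n)\<^sup>2"
      unfolding power2_eq_square using Suc
      by (intro order_trans[OF norm_blinfun_compose] mult_mono) (auto intro: order_trans[OF norm_ge_zero])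
    then have "norm (A + (?Y n o\<^sub>L ?Y n)) \<le> 1 + (?y n)\<^sup>2"
      using A by (intro order_trans[OF norm_triangle_ineq] add_mono)
    then show ?thesis by simp
  qed
  have "?Y (Suc (Suc n)) - ?Y (Suc n)
      = (1/2) *\<^sub>R ((A + (?Y (Suc n) o\<^sub>L ?Y (Suc n))) - (A + (?Y n o\<^sub>L ?Y n)))"
    by (simp only: sqrt_iter.simps scaleR_diff_right)
  \<comment> \<open>This way of splitting a difference of squares does not require the two iterates
    to commute.\<close>
  also have "(A + (?Y (Suc n) o\<^sub>L ?Y (Suc n))) - (A + (?Y n o\<^sub>L ?Y n))
      = (?Y (Suc n) o\<^sub>L (?Y (Suc n) - ?Y n)) + ((?Y (Suc n) - ?Y n) o\<^sub>L ?Y n)"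
    by (simp only: blinfun_diff_compose) simp
  finally have eq: "?Y (Suc (Suc n)) - ?Y (Suc n)
      = (1/2) *\<^sub>R ((?Y (Suc n) o\<^sub>L (?Y (Suc n) - ?Y n)) + ((?Y (Suc n) - ?Y n) o\<^sub>L ?Y n))" .
  have "norm (?Y (Suc n) o\<^sub>L (?Y (Suc n) - ?Y n)) \<le> ?y (Suc n) * (?y (Suc n) - ?y n)"
    using Suc n1 sqrt_bound_bounds[of "Suc n"]
    by (intro order_trans[OF norm_blinfun_compose] mult_mono) auto
  moreover have "norm ((?Y (Suc n) - ?Y n) o\<^sub>L ?Y n) \<le> (?y (Suc n) - ?y n) * ?y n"
    using Suc sqrt_bound_Suc[of n]
    by (intro order_trans[OF norm_blinfun_compose] mult_mono) auto
  ultimately have "norm (?Y (Suc (Suc n)) - ?Y (Suc n))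
      \<le> (1/2) * (?y (Suc n) * (?y (Suc n) - ?y n) + (?y (Suc n) - ?y n) * ?y n)"
    unfolding eq norm_scaleR by (intro mult_mono order_trans[OF norm_triangle_ineq] add_mono) auto
  also have "\<dots> = ?y (Suc (Suc n)) - ?y (Suc n)"
    unfolding sqrt_bound.simps(2)[of "Suc n"] by (simp add: field_simps power2_eq_square)
  finally show ?case using n1 by blast
qed

lemma sqrt_iter_Cauchy:
  assumes A: "norm A \<le> 1"
  shows "Cauchy (sqrt_iter A)"
proof -
  have mono: "norm (sqrt_iter A m - sqrt_iter A n) \<le> sqrt_bound m - sqrt_bound n" if "m \<ge> n" for m n
    using that
  proof (induction m rule: dec_induct)
    case (step m)
    have "norm (sqrt_iter A (Suc m) - sqrt_iter A n)
        \<le> norm (sqrt_iter A (Suc m) - sqrt_iter A m) + norm (sqrt_iter A m - sqrt_iter A n)"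
      using norm_triangle_ineq[of "sqrt_iter A (Suc m) - sqrt_iter A m" "sqrt_iter A m - sqrt_iter A n"]
      by (simp only: diff_add_cancel add_diff_eq)
    then show ?case using step.IH sqrt_iter_bounds[OF A, of m] by linarith
  qed simp
  have "incseq sqrt_bound" by (intro incseq_SucI sqrt_bound_Suc)
  moreover have "Bseq sqrt_bound"
    by (rule BseqI'[of _ 1]) (use sqrt_bound_bounds in auto)
  ultimately have "Cauchy sqrt_bound"
    by (intro convergent_Cauchy Bseq_monoseq_convergent) (auto simp: incseq_imp_monoseq)
  show ?thesis
  proof (rule metric_CauchyI)
    fix e :: real assume "e > 0"
    then obtain M where M: "\<And>m n. m \<ge> M \<Longrightarrow> n \<ge> M \<Longrightarrow> dist (sqrt_bound m) (sqrt_bound n) < e"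
      using metric_CauchyD[OF \<open>Cauchy sqrt_bound\<close>] by blast
    have "dist (sqrt_iter A m) (sqrt_iter A n) < e" if "m \<ge> M" "n \<ge> M" for m n
    proof (cases "m \<ge> n")
      case True
      then show ?thesis using mono[OF True] M[OF that] by (simp add: dist_norm)
    next
      case False
      then show ?thesis using mono[of m n] M[OF that] by (simp add: dist_norm norm_minus_commute)
    qed
    then show "\<exists>M. \<forall>m\<ge>M. \<forall>n\<ge>M. dist (sqrt_iter A m) (sqrt_iter A n) < e" by blast
  qed
qed

lemma norm_id_minus_le:
  assumes T: "op_positive T" "norm T \<le> 1"
  shows "norm (id_blinfun - T) \<le> 1"
proof -
  have le: "Re (cinner (T x) x) \<le> (norm x)\<^sup>2" for x
    using Re_cinner_le_norm[of T x] mult_right_mono[OF T(2), of "(norm x)\<^sup>2"] by simp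
  have "norm (id_blinfun - T) \<le> norm (id_blinfun :: 'a op)"
  proof (rule op_le_norm_mono)
    show "op_positive (id_blinfun - T)"
      using T le by (auto simp: op_positive_iff blinfun.diff_left cinner_diff_left cinner_same
          simp flip: of_real_power)
    show "op_le (id_blinfun - T) id_blinfun" using T by (simp add: op_le_def)
  qed simp
  also have "\<dots> \<le> 1" by (rule norm_blinfun_bound) auto
  finally show ?thesis .
qed

text \<open>The commutation clause keeps the root inside every commutant that contains
  \<open>T\<close>. It holds because each iterate is a polynomial in \<open>T\<close>, and it
  survives the norm limit.\<close>

lemma op_sqrt_contraction:
  assumes T: "op_positive T" "norm T \<le> 1"
  shows "\<exists>h. op_positive h \<and> h o\<^sub>L h = T \<and> (\<forall>S. S o\<^sub>L T = T o\<^sub>L S \<longrightarrow> S o\<^sub>L h = h o\<^sub>L S)"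
proof -
  define A where "A = id_blinfun - T"
  have nA: "norm A \<le> 1" unfolding A_def by (rule norm_id_minus_le[OF T])
  have TB: "T \<in> Bop" using T by (simp add: op_positive_Bop)
  have AB: "A \<in> Bop" unfolding A_def using TB by simp
  let ?Y = "sqrt_iter A"
  obtain Y where Y: "?Y \<longlonglongrightarrow> Y"
    using sqrt_iter_Cauchy[OF nA] by (auto simp: Cauchy_convergent_iff convergent_def)
  have Yx: "(\<lambda>n. ?Y n x) \<longlonglongrightarrow> Y x" for x
    by (intro blinfun.tendsto Y tendsto_const)
  have comp_lim: "(\<lambda>n. f n o\<^sub>L g n) \<longlonglongrightarrow> (a o\<^sub>L b)" if "f \<longlonglongrightarrow> a" "g \<longlonglongrightarrow> b" for f g :: "nat \<Rightarrow> 'a op" and a b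
    using bounded_bilinear.tendsto[OF bounded_bilinear_blinfun_compose that] .
  have fix_eq: "Y = (1/2) *\<^sub>R (A + (Y o\<^sub>L Y))"
  proof (rule LIMSEQ_unique)
    show "(\<lambda>n. ?Y (Suc n)) \<longlonglongrightarrow> Y" using Y by (rule LIMSEQ_Suc)
    show "(\<lambda>n. ?Y (Suc n)) \<longlonglongrightarrow> (1/2) *\<^sub>R (A + (Y o\<^sub>L Y))"
      unfolding sqrt_iter.simps by (intro tendsto_intros comp_lim Y)
  qed
  have YnB: "?Y n \<in> Bop \<and> op_adj (?Y n) = ?Y n" for n
  proof (induction n)
    case (Suc n)
    have "op_adj A = A" using TB T by (simp add: A_def op_adj_diff op_positive_adj)
    with Suc AB show ?case by (simp add: op_adj_scaleR op_adj_add op_adj_comp)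
  qed simp
  have YB: "Y \<in> Bop"
    unfolding Bop_iff clin_def
  proof (intro allI LIMSEQ_unique)
    fix c x
    show "(\<lambda>n. ?Y n (ell2_scale c x)) \<longlonglongrightarrow> Y (ell2_scale c x)" by (rule Yx)
    have "?Y n (ell2_scale c x) = ell2_scale c (?Y n x)" for n
      using YnB[of n] by (simp add: Bop_iff clinD)
    then show "(\<lambda>n. ?Y n (ell2_scale c x)) \<longlonglongrightarrow> ell2_scale c (Y x)"
      using tendsto_ell2_scale[OF Yx] by simp
  qed
  have nY: "norm Y \<le> 1"
    using tendsto_upperbound[OF tendsto_norm[OF Y], of 1] sqrt_iter_bounds[OF nA] sqrt_bound_bounds
    by (metis (no_types, lifting) eventuallyI order_trans sequentially_bot)
  have Y_real: "Im (cinner (Y x) x) = 0" for x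
  proof -
    have "(\<lambda>n. Im (cinner (?Y n x) x)) \<longlonglongrightarrow> Im (cinner (Y x) x)"
      by (intro tendsto_intros Yx)
    moreover have "Im (cinner (?Y n x) x) = 0" for n
      using cinner_op_adj[of "?Y n" x x] YnB[of n] cinner_commute[of x "?Y n x"]
      by (simp add: complex_eq_iff)
    ultimately show ?thesis by (simp add: LIMSEQ_const_iff)
  qed
  define h where "h = id_blinfun - Y"
  have "op_positive h"
  proof -
    have "Re (cinner (Y x) x) \<le> (norm x)\<^sup>2" for x
      using Re_cinner_le_norm[of Y x] mult_right_mono[OF nY, of "(norm x)\<^sup>2"] by simp
    then show ?thesis
      using YB Y_real unfolding h_def
      by (auto simp: op_positive_iff blinfun.diff_left cinner_diff_left cinner_same
          simp flip: of_real_power)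
  qed
  moreover have "h o\<^sub>L h = T"
  proof -
    have "(1/2) *\<^sub>R (A + (Y o\<^sub>L Y)) + (1/2) *\<^sub>R (A + (Y o\<^sub>L Y)) = Y + Y"
      using fix_eq by simp
    then have YY: "A + (Y o\<^sub>L Y) = Y + Y"
      by (simp only: scaleR_add_left[symmetric]) simp
    have "h o\<^sub>L h = id_blinfun + (Y o\<^sub>L Y) - (Y + Y)"
      by (simp add: h_def blinfun_diff_compose)
    also have "\<dots> = T" unfolding YY[symmetric] A_def by simp
    finally show ?thesis .
  qed
  moreover have "S o\<^sub>L h = h o\<^sub>L S" if S: "S o\<^sub>L T = T o\<^sub>L S" for S
  proof -
    have SA: "S o\<^sub>L A = A o\<^sub>L S" using S by (simp add: A_def blinfun_diff_compose)
    have Sn: "S o\<^sub>L ?Y n = ?Y n o\<^sub>L S" for n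
    proof (induction n)
      case 0
      then show ?case by (intro blinfun_eqI) simp
    next
      case (Suc n)
      have "S o\<^sub>L (?Y n o\<^sub>L ?Y n) = (?Y n o\<^sub>L ?Y n) o\<^sub>L S"
        using Suc by (metis blinfun_compose_assoc)
      then show ?case by (simp add: blinfun_diff_compose SA)
    qed
    have "(\<lambda>n. S o\<^sub>L ?Y n) \<longlonglongrightarrow> (S o\<^sub>L Y)" by (intro comp_lim Y tendsto_const)
    moreover have "(\<lambda>n. S o\<^sub>L ?Y n) \<longlonglongrightarrow> (Y o\<^sub>L S)"
      unfolding Sn by (intro comp_lim Y tendsto_const)
    ultimately have "S o\<^sub>L Y = Y o\<^sub>L S" by (rule LIMSEQ_unique)
    then show ?thesis by (simp add: h_def blinfun_diff_compose)
  qed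
  ultimately show ?thesis by blast
qed

lemma op_sqrt_exists:
  assumes T: "op_positive T"
  shows "\<exists>h. op_positive h \<and> h o\<^sub>L h = T \<and> (\<forall>S. S o\<^sub>L T = T o\<^sub>L S \<longrightarrow> S o\<^sub>L h = h o\<^sub>L S)"
proof (cases "T = 0")
  case True
  then show ?thesis by (intro exI[of _ 0]) (auto intro!: blinfun_eqI)
next
  case False
  define r where "r = norm T"
  have r: "r > 0" using False by (simp add: r_def)
  have pos: "op_positive ((1/r) *\<^sub>R T)" using T r by (intro op_positive_scaleR) auto
  have nrm: "norm ((1/r) *\<^sub>R T) \<le> 1" using r by (simp add: r_def)
  obtain h where h: "op_positive h" "h o\<^sub>L h = (1/r) *\<^sub>R T"
    "\<And>S. S o\<^sub>L ((1/r) *\<^sub>R T) = ((1/r) *\<^sub>R T) o\<^sub>L S \<Longrightarrow> S o\<^sub>L h = h o\<^sub>L S"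
    using op_sqrt_contraction[OF pos nrm] by blast
  show ?thesis
  proof (intro exI[of _ "sqrt r *\<^sub>R h"] conjI allI impI)
    show "op_positive (sqrt r *\<^sub>R h)" using r h(1) by (intro op_positive_scaleR) auto
    show "(sqrt r *\<^sub>R h) o\<^sub>L (sqrt r *\<^sub>R h) = T"
      using r by (simp add: blinfun_diff_compose h(2))
    fix S assume "S o\<^sub>L T = T o\<^sub>L S"
    then show "S o\<^sub>L (sqrt r *\<^sub>R h) = (sqrt r *\<^sub>R h) o\<^sub>L S"
      using h(3)[of S] by (simp add: blinfun_diff_compose)
  qed
qed


section \<open>Weak limits of directed sets\<close>

text \<open>The filter of final sections of \<open>D\<close>: the directed set becomes a net indexed
  by itself, and limits along it are ordinary \<open>tendsto\<close> statements.\<close>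

definition dnet :: "'a op set \<Rightarrow> 'a op filter" where
  "dnet D = (INF T\<in>D. principal {R \<in> D. op_le T R})"

lemma eventually_dnet:
  assumes "is_directed D"
  shows "eventually P (dnet D) \<longleftrightarrow> (\<exists>T\<in>D. \<forall>R\<in>D. op_le T R \<longrightarrow> P R)"
proof -
  have "eventually P (dnet D) \<longleftrightarrow> (\<exists>T\<in>D. eventually P (principal {R \<in> D. op_le T R}))"
    unfolding dnet_def
  proof (rule eventually_INF_base)
    show "D \<noteq> {}" using assms by (simp add: is_directed_def)
    fix S T assume "S \<in> D" "T \<in> D"
    then obtain R where "R \<in> D" "op_le S R" "op_le T R"
      using assms by (auto simp: is_directed_def)
    then show "\<exists>R\<in>D. principal {R' \<in> D. op_le R R'}
        \<le> inf (principal {R \<in> D. op_le S R}) (principal {R \<in> D. op_le T R})"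
      by (intro bexI[of _ R]) (auto intro: op_le_trans)
  qed
  then show ?thesis by (auto simp: eventually_principal)
qed

lemma dnet_neq_bot: "is_directed D \<Longrightarrow> dnet D \<noteq> bot"
  unfolding trivial_limit_def eventually_dnet
  by (metis op_le_refl)

lemma eventually_in_dnet: "is_directed D \<Longrightarrow> eventually (\<lambda>T. T \<in> D) (dnet D)"
  by (auto simp: eventually_dnet is_directed_def)

lemma tendsto_dnet_mono:
  fixes f :: "'a op \<Rightarrow> real"
  assumes D: "is_directed D"
    and mono: "\<And>S T. S \<in> D \<Longrightarrow> T \<in> D \<Longrightarrow> op_le S T \<Longrightarrow> f S \<le> f T"
    and bdd: "\<And>T. T \<in> D \<Longrightarrow> f T \<le> B"
  shows "(f \<longlongrightarrow> (SUP T\<in>D. f T)) (dnet D)"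
proof (rule tendstoI)
  fix e :: real assume e: "e > 0"
  have ne: "D \<noteq> {}" using D by (simp add: is_directed_def)
  have bdd': "bdd_above (f ` D)" by (rule bdd_aboveI2[OF bdd])
  have "(SUP T\<in>D. f T) - e < (SUP T\<in>D. f T)" using e by simp
  then obtain T where T: "T \<in> D" "(SUP T\<in>D. f T) - e < f T"
    using less_cSUP_iff[OF ne bdd'] by blast
  show "eventually (\<lambda>T. dist (f T) (SUP T\<in>D. f T) < e) (dnet D)"
    unfolding eventually_dnet[OF D]
  proof (intro bexI[OF _ T(1)] ballI impI)
    fix R assume R: "R \<in> D" "op_le T R"
    have "f R \<le> (SUP T\<in>D. f T)" using R by (intro cSUP_upper bdd')
    moreover have "f T \<le> f R" using R T by (intro mono)
    ultimately show "dist (f R) (SUP T\<in>D. f T) < e" using T by (simp add: dist_real_def)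
  qed
qed

text \<open>Polarization extends convergence from quadratic forms to all pairs of vectors; the
  limits form a bounded sesquilinear form, which \<open>form_op_exists\<close> represents.\<close>

lemma weak_limit_exists:
  fixes F :: "'a op filter"
  assumes F: "F \<noteq> bot" and ev: "eventually (\<lambda>T. T \<in> Bop \<and> norm T \<le> K) F"
    and lim: "\<And>x. \<exists>l. ((\<lambda>T. cinner (blinfun_apply T x) x) \<longlongrightarrow> l) F"
  shows "\<exists>S\<in>Bop. \<forall>x y. ((\<lambda>T. cinner (blinfun_apply T x) y) \<longlongrightarrow> cinner (blinfun_apply S x) y) F"
proof -
  obtain q where q: "\<And>x. ((\<lambda>T. cinner (blinfun_apply T x) x) \<longlongrightarrow> q x) F"
    using lim by metis
  have "\<exists>l. ((\<lambda>T. cinner (blinfun_apply T x) y) \<longlongrightarrow> l) F" for x y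
  proof -
    let ?L = "(q (x + y) - q (x - y) + \<i> * (q (x + ell2_scale \<i> y) - q (x - ell2_scale \<i> y))) / 4"
    let ?f = "\<lambda>T. (cinner (blinfun_apply T (x + y)) (x + y) - cinner (T (x - y)) (x - y)
      + \<i> * (cinner (T (x + ell2_scale \<i> y)) (x + ell2_scale \<i> y)
         - cinner (T (x - ell2_scale \<i> y)) (x - ell2_scale \<i> y))) / 4"
    have "(?f \<longlongrightarrow> ?L) F" by (intro tendsto_intros q) auto
    moreover have "eventually (\<lambda>T. ?f T = cinner (blinfun_apply T x) y) F"
      using ev by eventually_elim (simp flip: polarization)
    ultimately show ?thesis by (intro exI) (rule Lim_transform_eventually)
  qed
  then obtain B where B: "\<And>x y. ((\<lambda>T. cinner (blinfun_apply T x) y) \<longlongrightarrow> B x y) F"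
    by metis
  have evB: "eventually (\<lambda>T. T \<in> Bop) F" using ev by eventually_elim simp
  have uniq: "B x y = l" if "((\<lambda>T. cinner (blinfun_apply T x) y) \<longlongrightarrow> l) F" for x y l
    using tendsto_unique[OF F B that] .
  have K: "K \<ge> 0"
  proof -
    obtain T :: "'a op" where "norm T \<le> K"
      using ev F by (metis (no_types, lifting) eventually_happens)
    then show ?thesis by (meson norm_ge_zero order_trans)
  qed
  have "\<exists>S. clin S \<and> norm S \<le> K \<and> (\<forall>x y. cinner (blinfun_apply S x) y = B x y)"
  proof (rule form_op_exists[OF _ _ _ _ _ K])
    fix x x' y y' :: "'a ell2" and c :: complex
    show "B (x + x') y = B x y + B x' y"
      by (rule uniq) (simp add: blinfun.add_right cinner_add_left tendsto_add B)
    show "B x (y + y') = B x y + B x y'"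
      by (rule uniq) (simp add: cinner_add_right tendsto_add B)
    show "B x (ell2_scale c y) = cnj c * B x y"
      by (rule uniq) (simp add: cinner_scale_right tendsto_mult B)
    \<comment> \<open>Complex homogeneity in \<open>x\<close> is available only for \<open>T\<close>
      in \<open>Bop\<close>, hence only eventually along \<open>F\<close>.\<close>
    show "B (ell2_scale c x) y = c * B x y"
    proof (rule uniq)
      have "((\<lambda>T. c * cinner (blinfun_apply T x) y) \<longlongrightarrow> c * B x y) F"
        by (intro tendsto_intros B)
      moreover have "eventually (\<lambda>T. c * cinner (blinfun_apply T x) y
          = cinner (blinfun_apply T (ell2_scale c x)) y) F"
        using evB by eventually_elim (simp add: Bop_iff clinD cinner_scale_left)
      ultimately show "((\<lambda>T. cinner (blinfun_apply T (ell2_scale c x)) y) \<longlongrightarrow> c * B x y) F"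
        by (rule Lim_transform_eventually)
    qed
    show "cmod (B x y) \<le> K * norm x * norm y"
    proof (rule tendsto_upperbound[OF tendsto_norm[OF B] _ F])
      show "eventually (\<lambda>T. cmod (cinner (blinfun_apply T x) y) \<le> K * norm x * norm y) F"
        using ev
      proof eventually_elim
        case (elim T)
        have "cmod (cinner (T x) y) \<le> norm (T x) * norm y" by (rule cmod_cinner_le)
        also have "\<dots> \<le> norm T * norm x * norm y" by (intro mult_right_mono norm_blinfun) simp
        also have "\<dots> \<le> K * norm x * norm y" using elim by (intro mult_right_mono) auto
        finally show ?case .
      qed
    qed
  qed
  then obtain S where "clin S" "\<And>x y. cinner (blinfun_apply S x) y = B x y" by blast
  then show ?thesis using B by (intro bexI[of _ S]) (auto simp: Bop_iff)
qed

definition wlim :: "'a op set \<Rightarrow> 'a op \<Rightarrow> bool" where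
  "wlim D S \<longleftrightarrow> (\<forall>x y. ((\<lambda>T. cinner (blinfun_apply T x) y) \<longlongrightarrow> cinner (blinfun_apply S x) y) (dnet D))"

lemma wlimD: "wlim D S \<Longrightarrow> ((\<lambda>T. cinner (blinfun_apply T x) y) \<longlongrightarrow> cinner (blinfun_apply S x) y) (dnet D)"
  by (simp add: wlim_def)

text \<open>Each quadratic form increases along \<open>D\<close> and is bounded by that of
  \<open>B\<close>, so it converges; \<open>B\<close> also bounds the norms, which turns these
  limits into an operator.\<close>

lemma Vigier:
  assumes D: "is_directed D" and pos: "\<And>T. T \<in> D \<Longrightarrow> op_positive T"
    and B: "B \<in> Bop" "\<And>T. T \<in> D \<Longrightarrow> op_le T B"
  shows "\<exists>S\<in>Bop. wlim D S"
  unfolding wlim_def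
proof (rule weak_limit_exists[OF dnet_neq_bot[OF D]])
  show "eventually (\<lambda>T. T \<in> Bop \<and> norm T \<le> norm B) (dnet D)"
    using eventually_in_dnet[OF D]
    by eventually_elim (use pos B op_le_norm_mono op_positive_Bop in blast)
next
  fix x
  have Bop: "T \<in> Bop" if "T \<in> D" for T using pos[OF that] by (rule op_positive_Bop)
  have "((\<lambda>T. Re (cinner (blinfun_apply T x) x)) \<longlongrightarrow> (SUP T\<in>D. Re (cinner (blinfun_apply T x) x))) (dnet D)"
    by (rule tendsto_dnet_mono[OF D, where B = "Re (cinner (B x) x)"])
      (use B Bop op_le_iff in blast)+
  then have "((\<lambda>T. of_real (Re (cinner (blinfun_apply T x) x)) :: complex) \<longlongrightarrow>
      of_real (SUP T\<in>D. Re (cinner (blinfun_apply T x) x))) (dnet D)"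
    by (rule tendsto_of_real)
  moreover have "eventually (\<lambda>T. of_real (Re (cinner (blinfun_apply T x) x)) = cinner (blinfun_apply T x) x) (dnet D)"
    using eventually_in_dnet[OF D]
    by eventually_elim (use pos in \<open>auto simp: op_positive_iff complex_eq_iff\<close>)
  ultimately show "\<exists>l. ((\<lambda>T. cinner (blinfun_apply T x) x) \<longlongrightarrow> l) (dnet D)"
    by (intro exI) (rule Lim_transform_eventually)
qed

lemma wlim_Re:
  assumes "wlim D S"
  shows "((\<lambda>T. Re (cinner (blinfun_apply T x) x)) \<longlongrightarrow> Re (cinner (blinfun_apply S x) x)) (dnet D)"
  by (intro tendsto_intros wlimD assms)

lemma wlim_positive:
  assumes D: "is_directed D" and pos: "\<And>T. T \<in> D \<Longrightarrow> op_positive T"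
    and S: "S \<in> Bop" "wlim D S"
  shows "op_positive S"
  unfolding op_positive_iff
proof (intro conjI allI S)
  fix x
  show "Re (cinner (S x) x) \<ge> 0"
    by (rule tendsto_lowerbound[OF wlim_Re[OF S(2)] _ dnet_neq_bot[OF D]])
      (rule eventually_mono[OF eventually_in_dnet[OF D]], use pos in \<open>auto simp: op_positive_iff\<close>)
  have "((\<lambda>T. Im (cinner (blinfun_apply T x) x)) \<longlongrightarrow> Im (cinner (S x) x)) (dnet D)"
    by (intro tendsto_intros wlimD S)
  moreover have "eventually (\<lambda>T. Im (cinner (blinfun_apply T x) x) = 0) (dnet D)"
    by (rule eventually_mono[OF eventually_in_dnet[OF D]]) (use pos in \<open>auto simp: op_positive_iff\<close>)
  ultimately have "((\<lambda>T::'a op. 0) \<longlongrightarrow> Im (cinner (S x) x)) (dnet D)"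
    by (rule Lim_transform_eventually)
  then show "Im (cinner (S x) x) = 0"
    using tendsto_unique[OF dnet_neq_bot[OF D] tendsto_const] by metis
qed

lemma wlim_is_sup:
  assumes D: "is_directed D" "D \<subseteq> pos_part M" and S: "S \<in> M" "S \<in> Bop" "wlim D S"
  shows "is_sup_in M D S"
proof -
  have pos: "op_positive T" if "T \<in> D" for T using D that by (auto simp: pos_part_def)
  have Bop: "T \<in> Bop" if "T \<in> D" for T using pos[OF that] by (rule op_positive_Bop)
  have Sp: "op_positive S" by (rule wlim_positive[OF D(1) pos S(2,3)])
  have up: "op_le T S" if T: "T \<in> D" for T
    unfolding op_le_iff[OF Bop[OF T] S(2)]
  proof (intro allI conjI)
    fix x
    show "Im (cinner (T x) x) = Im (cinner (S x) x)"
      using pos[OF T] Sp by (simp add: op_positive_iff)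
    have "eventually (\<lambda>R. Re (cinner (T x) x) \<le> Re (cinner (blinfun_apply R x) x)) (dnet D)"
      unfolding eventually_dnet[OF D(1)]
      by (intro bexI[OF _ T]) (use op_le_iff Bop T in blast)
    then show "Re (cinner (T x) x) \<le> Re (cinner (S x) x)"
      by (rule tendsto_lowerbound[OF wlim_Re[OF S(3)] _ dnet_neq_bot[OF D(1)]])
  qed
  have least: "op_le S R" if R: "op_positive R" "\<And>T. T \<in> D \<Longrightarrow> op_le T R" for R
  proof -
    have RB: "R \<in> Bop" using R(1) by (rule op_positive_Bop)
    show ?thesis unfolding op_le_iff[OF S(2) RB]
    proof (intro allI conjI)
      fix x
      show "Im (cinner (S x) x) = Im (cinner (R x) x)" using Sp R by (simp add: op_positive_iff)
      have "eventually (\<lambda>T. Re (cinner (blinfun_apply T x) x) \<le> Re (cinner (R x) x)) (dnet D)"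
        by (rule eventually_mono[OF eventually_in_dnet[OF D(1)]]) (use R op_le_iff Bop RB in blast)
      then show "Re (cinner (S x) x) \<le> Re (cinner (R x) x)"
        by (rule tendsto_upperbound[OF wlim_Re[OF S(3)] _ dnet_neq_bot[OF D(1)]])
    qed
  qed
  show ?thesis unfolding is_sup_in_def using S Sp up least by (auto simp: pos_part_def)
qed


section \<open>Commutants\<close>

lemma commutant_anti: "A \<subseteq> B \<Longrightarrow> commutant B \<subseteq> commutant A"
  by (auto simp: commutant_def)

lemma subset_commutant2: "A \<subseteq> Bop \<Longrightarrow> A \<subseteq> commutant (commutant A)"
  by (auto simp: commutant_def)

text \<open>The operator \<open>r\<close> is moved to the other argument as \<open>op_adj r\<close>,
  so that commutation becomes an identity between entries and passes to weak limits.\<close>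

lemma wlim_commutant:
  assumes D: "is_directed D" "D \<subseteq> commutant R" and R: "R \<subseteq> Bop" and S: "S \<in> Bop" "wlim D S"
  shows "S \<in> commutant R"
  unfolding commutant_def
proof (intro CollectI conjI ballI S blinfun_eqI cinner_eqI)
  fix r x y assume r: "r \<in> R"
  then have rB: "r \<in> Bop" using R by blast
  have "((\<lambda>T. cinner (blinfun_apply T (r x)) y) \<longlongrightarrow> cinner (S (r x)) y) (dnet D)"
    by (rule wlimD[OF S(2)])
  moreover have "eventually (\<lambda>T. cinner (blinfun_apply T (r x)) y = cinner (blinfun_apply T x) (op_adj r y)) (dnet D)"
    using eventually_in_dnet[OF D(1)]
  proof eventually_elim
    case (elim T)
    then have "T o\<^sub>L r = r o\<^sub>L T" using D r by (auto simp: commutant_def)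
    then have "T (r x) = r (T x)" by (metis blinfun_apply_blinfun_compose)
    then show ?case using cinner_op_adj[OF rB] by simp
  qed
  ultimately have "((\<lambda>T. cinner (blinfun_apply T x) (op_adj r y)) \<longlongrightarrow> cinner (S (r x)) y) (dnet D)"
    by (rule Lim_transform_eventually)
  then have "cinner (S (r x)) y = cinner (S x) (op_adj r y)"
    using tendsto_unique[OF dnet_neq_bot[OF D(1)] _ wlimD[OF S(2)]] by blast
  then show "cinner ((S o\<^sub>L r) x) y = cinner ((r o\<^sub>L S) x) y"
    using cinner_op_adj[OF rB] by simp
qed

text \<open>Suprema in the notion of normality are order-theoretic and relative to the algebra. The
  weak limit of \<open>D\<close> exists, stays in the commutant and is itself a supremum there, so
  uniqueness of suprema identifies the two.\<close>

lemma sup_is_wlim: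
  assumes D: "is_directed D" "D \<subseteq> pos_part (commutant R)" and R: "R \<subseteq> Bop"
    and S: "is_sup_in (commutant R) D S"
  shows "wlim D S"
proof -
  have SB: "S \<in> Bop" using S by (auto simp: is_sup_in_def pos_part_def commutant_def)
  have "\<exists>S\<in>Bop. wlim D S"
    by (rule Vigier[OF D(1) _ SB]) (use D S in \<open>auto simp: is_sup_in_def pos_part_def\<close>)
  then obtain S' where S': "S' \<in> Bop" "wlim D S'" by blast
  have "D \<subseteq> commutant R" using D by (auto simp: pos_part_def)
  then have "S' \<in> commutant R" using wlim_commutant D R S' by blast
  then have "is_sup_in (commutant R) D S'" using wlim_is_sup D S' by blast
  then have "S' = S" using S by (intro op_le_antisym) (auto simp: is_sup_in_def)
  then show ?thesis using S' by simp
qed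

locale vn_commutant =
  fixes R :: "'a op set"
  assumes R_Bop: "R \<subseteq> Bop" and R_adj: "\<And>r. r \<in> R \<Longrightarrow> op_adj r \<in> R"
begin

abbreviation M :: "'a op set" where "M \<equiv> commutant R"

lemma M_Bop: "T \<in> M \<Longrightarrow> T \<in> Bop"
  by (simp add: commutant_def)

lemma M_comm: "T \<in> M \<Longrightarrow> r \<in> R \<Longrightarrow> T (r x) = r (T x)"
  by (auto simp: commutant_def) (metis blinfun_apply_blinfun_compose)

lemma M_I: "T \<in> Bop \<Longrightarrow> (\<And>r x. r \<in> R \<Longrightarrow> T (blinfun_apply r x) = r (T x)) \<Longrightarrow> T \<in> M"
  by (auto simp: commutant_def intro!: blinfun_eqI)

lemma M_adj: assumes T: "T \<in> M" shows "op_adj T \<in> M"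
proof (rule M_I)
  show "op_adj T \<in> Bop" using M_Bop[OF T] by simp
  fix r x assume r: "r \<in> R"
  then have rB: "r \<in> Bop" "op_adj r \<in> R" using R_Bop R_adj by auto
  show "op_adj T (r x) = r (op_adj T x)"
  proof (rule cinner_eqI)
    fix y
    have "cinner (op_adj T (r x)) y = cinner x (op_adj r (T y))"
      using M_Bop[OF T] rB by (simp add: cinner_op_adj_left cinner_op_adj)
    also have "\<dots> = cinner x (T (op_adj r y))" using M_comm[OF T rB(2)] by simp
    also have "\<dots> = cinner (r (op_adj T x)) y"
      using M_Bop[OF T] rB by (simp add: cinner_op_adj_left cinner_op_adj)
    finally show "cinner (op_adj T (r x)) y = cinner (r (op_adj T x)) y" .
  qed
qed

text \<open>The third commutant of \<open>R\<close> equals the first.\<close>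

lemma M_vn: "von_neumann_algebra M"
proof -
  have "commutant (commutant M) \<subseteq> M"
    by (rule commutant_anti[OF subset_commutant2[OF R_Bop]])
  moreover have "M \<subseteq> commutant (commutant M)"
    by (rule subset_commutant2) (auto simp: commutant_def)
  ultimately show ?thesis
    unfolding von_neumann_algebra_def using M_adj M_Bop by blast
qed

lemma R_linear: "r \<in> R \<Longrightarrow> r (ell2_scale c x) = ell2_scale c (r x)"
  using R_Bop by (auto simp: Bop_iff clinD)

lemma M_closed:
  "0 \<in> M" "id_blinfun \<in> M" "S \<in> M \<Longrightarrow> T \<in> M \<Longrightarrow> S + T \<in> M" "S \<in> M \<Longrightarrow> T \<in> M \<Longrightarrow> S - T \<in> M"
  "S \<in> M \<Longrightarrow> T \<in> M \<Longrightarrow> S o\<^sub>L T \<in> M" "T \<in> M \<Longrightarrow> op_scale c T \<in> M" "T \<in> M \<Longrightarrow> s *\<^sub>R T \<in> M"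
  by (rule M_I; simp add: M_Bop M_comm blinfun.add_left blinfun.add_right blinfun.diff_left
      blinfun.diff_right blinfun.scaleR_left blinfun.scaleR_right R_linear)+

lemma M_sqrt:
  assumes "T \<in> M" "op_positive T"
  shows "\<exists>h\<in>M. op_positive h \<and> h o\<^sub>L h = T"
proof -
  obtain h where h: "op_positive h" "h o\<^sub>L h = T" "\<And>S. S o\<^sub>L T = T o\<^sub>L S \<Longrightarrow> S o\<^sub>L h = h o\<^sub>L S"
    using op_sqrt_exists[OF assms(2)] by blast
  have "h \<in> M"
    unfolding commutant_def
  proof (intro CollectI conjI ballI)
    show "h \<in> Bop" using h(1) by (rule op_positive_Bop)
    fix r assume "r \<in> R"
    then have "r o\<^sub>L T = T o\<^sub>L r" using assms(1) by (simp add: commutant_def)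
    then show "h o\<^sub>L r = r o\<^sub>L h" using h(3) by simp
  qed
  then show ?thesis using h by blast
qed

end


declare cinner_ket_right [simp del] cinner_ket_left [simp del]

section \<open>Sums in the extended nonnegative reals\<close>

lemma infsum_ennreal_SUP:
  fixes f :: "'a \<Rightarrow> ennreal"
  shows "infsum f A = (SUP F\<in>{F. finite F \<and> F \<subseteq> A}. sum f F)"
  by (rule nonneg_infsum_complete) simp

lemma summable_ennreal: "(f :: 'a \<Rightarrow> ennreal) summable_on A"
  by (rule nonneg_summable_on_complete) simp

lemma infsum_ennreal_mult:
  fixes f :: "'a \<Rightarrow> ennreal"
  shows "(\<Sum>\<^sub>\<infinity>x\<in>A. c * f x) = c * (\<Sum>\<^sub>\<infinity>x\<in>A. f x)"
  unfolding infsum_ennreal_SUP by (simp add: SUP_mult_left_ennreal sum_distrib_left)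

lemma infsum_ennreal_mono:
  fixes f :: "'a \<Rightarrow> ennreal"
  shows "(\<And>x. x \<in> A \<Longrightarrow> f x \<le> g x) \<Longrightarrow> infsum f A \<le> infsum g A"
  by (intro infsum_mono summable_ennreal)

lemma sum_SUP_directed_ennreal:
  fixes f :: "'i \<Rightarrow> 'a \<Rightarrow> ennreal"
  assumes ne: "I \<noteq> {}" and F: "finite F"
    and dir: "\<And>i j. i \<in> I \<Longrightarrow> j \<in> I \<Longrightarrow> \<exists>k\<in>I. \<forall>x. f i x \<le> f k x \<and> f j x \<le> f k x"
  shows "(\<Sum>x\<in>F. SUP i\<in>I. f i x) = (SUP i\<in>I. \<Sum>x\<in>F. f i x)"
  using F
proof (induction F)
  case (insert a F)
  have "(SUP i\<in>I. f i a) + (SUP i\<in>I. \<Sum>x\<in>F. f i x) = (SUP i\<in>I. f i a + (\<Sum>x\<in>F. f i x))"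
  proof (rule SUP_add_directed_ennreal[symmetric])
    fix i j assume "i \<in> I" "j \<in> I"
    then obtain k where "k \<in> I" "\<And>x. f i x \<le> f k x \<and> f j x \<le> f k x" using dir by blast
    then show "\<exists>k\<in>I. f i a + (\<Sum>x\<in>F. f j x) \<le> f k a + (\<Sum>x\<in>F. f k x)"
      by (intro bexI[of _ k] add_mono sum_mono) auto
  qed
  then show ?case using insert by simp
qed (use ne in simp)

lemma infsum_SUP_directed_ennreal:
  fixes f :: "'i \<Rightarrow> 'a \<Rightarrow> ennreal"
  assumes ne: "I \<noteq> {}"
    and dir: "\<And>i j. i \<in> I \<Longrightarrow> j \<in> I \<Longrightarrow> \<exists>k\<in>I. \<forall>x. f i x \<le> f k x \<and> f j x \<le> f k x"
  shows "(\<Sum>\<^sub>\<infinity>x\<in>A. SUP i\<in>I. f i x) = (SUP i\<in>I. \<Sum>\<^sub>\<infinity>x\<in>A. f i x)"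
proof -
  have "(\<Sum>\<^sub>\<infinity>x\<in>A. SUP i\<in>I. f i x)
      = (SUP F\<in>{F. finite F \<and> F \<subseteq> A}. SUP i\<in>I. \<Sum>x\<in>F. f i x)"
    unfolding infsum_ennreal_SUP by (intro SUP_cong refl sum_SUP_directed_ennreal ne dir) auto
  also have "\<dots> = (SUP i\<in>I. \<Sum>\<^sub>\<infinity>x\<in>A. f i x)"
    unfolding infsum_ennreal_SUP by (rule SUP_commute)
  finally show ?thesis .
qed

text \<open>Tonelli for families: the inner sum is a directed supremum of finite sums, which may be
  taken outside.\<close>

lemma infsum_swap_ennreal:
  fixes f :: "'a \<Rightarrow> 'b \<Rightarrow> ennreal"
  shows "(\<Sum>\<^sub>\<infinity>x\<in>A. \<Sum>\<^sub>\<infinity>y\<in>B. f x y) = (\<Sum>\<^sub>\<infinity>y\<in>B. \<Sum>\<^sub>\<infinity>x\<in>A. f x y)"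
proof -
  let ?I = "{G. finite G \<and> G \<subseteq> B}"
  have "(\<Sum>\<^sub>\<infinity>x\<in>A. \<Sum>\<^sub>\<infinity>y\<in>B. f x y) = (\<Sum>\<^sub>\<infinity>x\<in>A. SUP G\<in>?I. \<Sum>y\<in>G. f x y)"
    by (simp add: infsum_ennreal_SUP[of _ B])
  also have "\<dots> = (SUP G\<in>?I. \<Sum>\<^sub>\<infinity>x\<in>A. \<Sum>y\<in>G. f x y)"
  proof (rule infsum_SUP_directed_ennreal)
    fix G G' assume "G \<in> ?I" "G' \<in> ?I"
    then show "\<exists>H\<in>?I. \<forall>x. (\<Sum>y\<in>G. f x y) \<le> (\<Sum>y\<in>H. f x y) \<and> (\<Sum>y\<in>G'. f x y) \<le> (\<Sum>y\<in>H. f x y)"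
      by (intro bexI[of _ "G \<union> G'"]) (auto intro!: sum_mono2)
  qed auto
  also have "\<dots> = (SUP G\<in>?I. \<Sum>y\<in>G. \<Sum>\<^sub>\<infinity>x\<in>A. f x y)"
  proof (rule SUP_cong[OF refl])
    fix G assume "G \<in> ?I"
    then have "finite G" by simp
    then show "(\<Sum>\<^sub>\<infinity>x\<in>A. \<Sum>y\<in>G. f x y) = (\<Sum>y\<in>G. \<Sum>\<^sub>\<infinity>x\<in>A. f x y)"
      by (induction G) (simp_all add: infsum_add summable_ennreal)
  qed
  also have "\<dots> = (\<Sum>\<^sub>\<infinity>y\<in>B. \<Sum>\<^sub>\<infinity>x\<in>A. f x y)"
    by (simp add: infsum_ennreal_SUP[of _ B])
  finally show ?thesis .
qed

lemma norm_sq_infsum_ennreal: "ennreal ((norm x)\<^sup>2) = (\<Sum>\<^sub>\<infinity>k. ennreal ((cmod (coord x k))\<^sup>2))"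
  unfolding norm_sq_infsum
  by (subst infsum_nonneg_is_SUPREMUM_ennreal)
    (auto simp: coord_sq_summable infsum_ennreal_SUP intro!: SUP_cong sum_ennreal[symmetric])


section \<open>Traces given by sums of vector states\<close>

text \<open>With \<open>Y\<close> the whole basis this is \<open>Tr\<close>; with \<open>Y\<close>
  the vacuum vectors it is the trace of the dilating algebra. One locale thus serves both.\<close>

definition diag_tr :: "'a set \<Rightarrow> 'a op \<Rightarrow> ennreal" where
  "diag_tr Y T = (\<Sum>\<^sub>\<infinity>y\<in>Y. ennreal (Re (cinner (T (ket y)) (ket y))))"

lemma diag_tr_adj_self:
  assumes "T \<in> Bop"
  shows "diag_tr Y (op_adj T o\<^sub>L T) = (\<Sum>\<^sub>\<infinity>y\<in>Y. ennreal ((norm (T (ket y)))\<^sup>2))"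
proof -
  have "cinner ((op_adj T o\<^sub>L T) x) x = of_real ((norm (T x))\<^sup>2)" for x
    using assms by (simp add: cinner_op_adj_left cinner_same)
  then show ?thesis unfolding diag_tr_def by simp
qed

text \<open>\<open>tracial\<close> is the trace identity for \<open>op_adj T o\<^sub>L T\<close>,
  written with norms of columns so that each instance can prove it by exchanging sums of squared
  entries.\<close>

locale diag_trace = vn_commutant R for R :: "'a op set" +
  fixes Y :: "'a set"
  assumes tracial: "\<And>T. T \<in> M \<Longrightarrow>
    (\<Sum>\<^sub>\<infinity>y\<in>Y. ennreal ((norm (T (ket y)))\<^sup>2)) = (\<Sum>\<^sub>\<infinity>y\<in>Y. ennreal ((norm (op_adj T (ket y)))\<^sup>2))"
begin

abbreviation \<tau> :: "'a op \<Rightarrow> ennreal" where "\<tau> \<equiv> diag_tr Y"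

lemma tr_comm:
  assumes T: "T \<in> M"
  shows "\<tau> (op_adj T o\<^sub>L T) = \<tau> (T o\<^sub>L op_adj T)"
  using tracial[OF T] diag_tr_adj_self[OF M_Bop[OF T]] diag_tr_adj_self[OF M_Bop[OF M_adj[OF T]]]
  by (simp add: M_Bop[OF T])

lemma tr_add:
  assumes "op_positive S" "op_positive T"
  shows "\<tau> (S + T) = \<tau> S + \<tau> T"
  unfolding diag_tr_def
  by (subst infsum_add[symmetric])
    (use assms in \<open>auto simp: blinfun.add_left cinner_add_left op_positive_iff summable_ennreal
      simp flip: ennreal_plus\<close>)

lemma tr_scale:
  assumes "r \<ge> 0"
  shows "\<tau> (r *\<^sub>R T) = ennreal r * \<tau> T"
  unfolding diag_tr_def infsum_ennreal_mult[symmetric]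
  using assms by (simp add: blinfun.scaleR_left cinner_scaleR_left ennreal_mult')

lemma tr_is_trace: "is_trace M \<tau>"
  unfolding is_trace_def using tr_comm by (auto simp: pos_part_def tr_add tr_scale)

text \<open>A supremum is a weak limit, so its diagonal entries are the suprema of those along
  \<open>D\<close>; directedness allows supremum and sum to be exchanged.\<close>

lemma tr_normal: "normal_trace M \<tau>"
  unfolding normal_trace_def
proof (intro allI impI, elim conjE)
  fix D S assume D: "D \<subseteq> pos_part M" "is_directed D" and S: "is_sup_in M D S"
  have w: "wlim D S" by (rule sup_is_wlim[OF D(2,1) R_Bop S])
  have pos: "op_positive T" if "T \<in> D" for T using D that by (auto simp: pos_part_def)
  have Bop: "T \<in> Bop" if "T \<in> D" for T using pos[OF that] by (rule op_positive_Bop)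
  have le: "op_le T S" if "T \<in> D" for T using S that by (simp add: is_sup_in_def)
  have SB: "S \<in> Bop" using S by (auto simp: is_sup_in_def pos_part_def M_Bop)
  let ?q = "\<lambda>T y. ennreal (Re (cinner (blinfun_apply T (ket y)) (ket y)))"
  have mono: "?q T y \<le> ?q T' y" if "op_le T T'" "T \<in> Bop" "T' \<in> Bop" for T T' y
    using that op_le_iff[of T T'] by (intro ennreal_leI) blast
  have "?q S y = (SUP T\<in>D. ?q T y)" for y
  proof (rule antisym)
    have "((\<lambda>T. ?q T y) \<longlongrightarrow> ?q S y) (dnet D)"
      by (intro tendsto_ennrealI wlim_Re[OF w])
    then show "?q S y \<le> (SUP T\<in>D. ?q T y)"
      by (rule tendsto_upperbound[OF _ eventually_mono[OF eventually_in_dnet[OF D(2)]] dnet_neq_bot[OF D(2)]])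
        (auto intro: SUP_upper)
    show "(SUP T\<in>D. ?q T y) \<le> ?q S y"
      by (intro SUP_least mono le Bop SB)
  qed
  then have "\<tau> S = (\<Sum>\<^sub>\<infinity>y\<in>Y. SUP T\<in>D. ?q T y)"
    by (simp add: diag_tr_def)
  also have "\<dots> = (SUP T\<in>D. \<Sum>\<^sub>\<infinity>y\<in>Y. ?q T y)"
  proof (rule infsum_SUP_directed_ennreal)
    show "D \<noteq> {}" using D by (simp add: is_directed_def)
    fix T T' assume TT: "T \<in> D" "T' \<in> D"
    then obtain U where U: "U \<in> D" "op_le T U" "op_le T' U" using D(2) unfolding is_directed_def by blast
    then show "\<exists>U\<in>D. \<forall>y. ?q T y \<le> ?q U y \<and> ?q T' y \<le> ?q U y"
      using TT by (intro bexI[OF _ U(1)] allI conjI mono Bop) auto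
  qed
  finally show "\<tau> S = (SUP T\<in>D. \<tau> T)" by (simp add: diag_tr_def)
qed

lemma fin_pos_has_sum:
  assumes a: "a \<in> fin_pos M \<tau>"
  shows "((\<lambda>y. cinner (a (ket y)) (ket y)) has_sum complex_of_real (enn2real (\<tau> a))) Y"
proof -
  have pos: "op_positive a" and fin: "\<tau> a < \<infinity>" using a by (auto simp: fin_pos_def pos_part_def)
  let ?q = "\<lambda>y. Re (cinner (a (ket y)) (ket y))"
  have q0: "?q y \<ge> 0" for y using pos by (simp add: op_positive_iff)
  have bound: "sum ?q F \<le> enn2real (\<tau> a)" if "finite F" "F \<subseteq> Y" for F
  proof -
    have "ennreal (sum ?q F) = (\<Sum>y\<in>F. ennreal (?q y))" using q0 by (intro sum_ennreal[symmetric]) 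
    also have "\<dots> \<le> \<tau> a" unfolding diag_tr_def infsum_ennreal_SUP
      using that by (intro SUP_upper) auto
    finally have "enn2real (ennreal (sum ?q F)) \<le> enn2real (\<tau> a)"
      using fin by (intro enn2real_mono) auto
    then show ?thesis using q0 by (simp add: sum_nonneg)
  qed
  have summable: "?q summable_on Y"
    by (rule nonneg_bdd_above_summable_on) (use q0 bound in \<open>auto intro!: bdd_aboveI[of _ "enn2real (\<tau> a)"]\<close>)
  have "ennreal (infsum ?q Y) = \<tau> a"
    unfolding diag_tr_def
    by (subst infsum_nonneg_is_SUPREMUM_ennreal)
      (use summable q0 in \<open>auto simp: infsum_ennreal_SUP intro!: SUP_cong sum_ennreal[symmetric]\<close>)
  then have "infsum ?q Y = enn2real (\<tau> a)"
    using q0 enn2real_ennreal[of "infsum ?q Y"] by (simp add: infsum_nonneg)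
  then have "(?q has_sum enn2real (\<tau> a)) Y" using has_sum_infsum[OF summable] by simp
  then have "((\<lambda>y. complex_of_real (?q y)) has_sum complex_of_real (enn2real (\<tau> a))) Y"
    by (rule has_sum_of_real)
  moreover have "complex_of_real (?q y) = cinner (a (ket y)) (ket y)" for y
    using pos by (simp add: op_positive_iff complex_eq_iff)
  ultimately show ?thesis by (simp)
qed

lemma trace_decomp_has_sum:
  assumes "trace_decomp M \<tau> T z"
  shows "((\<lambda>y. cinner (T (ket y)) (ket y)) has_sum z) Y"
proof -
  obtain a b c d where abcd: "a \<in> fin_pos M \<tau>" "b \<in> fin_pos M \<tau>" "c \<in> fin_pos M \<tau>" "d \<in> fin_pos M \<tau>"
    and T: "T = (a - b) + op_scale \<i> (c - d)"
    and z: "z = Complex (enn2real (\<tau> a) - enn2real (\<tau> b)) (enn2real (\<tau> c) - enn2real (\<tau> d))"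
    using assms unfolding trace_decomp_def by blast
  let ?t = "\<lambda>a. complex_of_real (enn2real (\<tau> a))" and ?q = "\<lambda>a y. cinner (blinfun_apply a (ket y)) (ket y)"
  have "((\<lambda>y. (?q a y - ?q b y) + \<i> * (?q c y - ?q d y)) has_sum ((?t a - ?t b) + \<i> * (?t c - ?t d))) Y"
    unfolding diff_conv_add_uminus
    by (intro has_sum_add has_sum_uminusI has_sum_cmult_right fin_pos_has_sum abcd)
  moreover have "(?t a - ?t b) + \<i> * (?t c - ?t d) = z" by (simp add: z complex_eq_iff)
  moreover have "(?q a y - ?q b y) + \<i> * (?q c y - ?q d y) = ?q T y" for y
    by (simp add: T blinfun.add_left blinfun.diff_left cinner_add_left cinner_diff_left cinner_scale_left)
  ultimately show ?thesis by (simp)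
qed

text \<open>Every decomposition into positive elements of finite trace yields the sum of the same
  diagonal entries, so the \<open>THE\<close> in \<open>trace_ext\<close> is well defined.\<close>

lemma trace_ext_eq:
  assumes "T \<in> L1_part M \<tau>"
  shows "trace_ext M \<tau> T = (\<Sum>\<^sub>\<infinity>y\<in>Y. cinner (T (ket y)) (ket y))"
proof -
  obtain z where z: "trace_decomp M \<tau> T z" using assms by (auto simp: L1_part_def)
  have "trace_ext M \<tau> T = z"
    unfolding trace_ext_def
    by (rule the_equality[where P = "trace_decomp M \<tau> T", OF z])
      (metis z infsumI trace_decomp_has_sum)
  then show ?thesis using infsumI[OF trace_decomp_has_sum[OF z]] by simp
qed

section \<open>The trace ideal and its stability under left multiplication\<close>

lemma L1_I:
  assumes "a \<in> fin_pos M \<tau>" "b \<in> fin_pos M \<tau>" "c \<in> fin_pos M \<tau>" "d \<in> fin_pos M \<tau>"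
    "T = (a - b) + op_scale \<i> (c - d)"
  shows "T \<in> L1_part M \<tau>"
  using assms unfolding L1_part_def trace_decomp_def by blast

lemma L1_E:
  assumes "T \<in> L1_part M \<tau>"
  obtains a b c d where "a \<in> fin_pos M \<tau>" "b \<in> fin_pos M \<tau>" "c \<in> fin_pos M \<tau>" "d \<in> fin_pos M \<tau>"
    "T = (a - b) + op_scale \<i> (c - d)"
  using assms unfolding L1_part_def trace_decomp_def by blast

lemma fin_pos_add: "a \<in> fin_pos M \<tau> \<Longrightarrow> b \<in> fin_pos M \<tau> \<Longrightarrow> a + b \<in> fin_pos M \<tau>"
  by (auto simp: fin_pos_def pos_part_def M_closed op_positive_add tr_add)

lemma fin_pos_scale: "r \<ge> 0 \<Longrightarrow> a \<in> fin_pos M \<tau> \<Longrightarrow> r *\<^sub>R a \<in> fin_pos M \<tau>"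
  by (auto simp: fin_pos_def pos_part_def M_closed op_positive_scaleR tr_scale ennreal_mult_less_top)

lemma fin_pos_zero: "0 \<in> fin_pos M \<tau>"
  by (auto simp: fin_pos_def pos_part_def M_closed diag_tr_def)

lemma L1_pos: "a \<in> fin_pos M \<tau> \<Longrightarrow> a \<in> L1_part M \<tau>"
  by (rule L1_I[of a 0 0 0]) (auto simp: fin_pos_zero intro!: blinfun_eqI)

lemma L1_add:
  assumes "S \<in> L1_part M \<tau>" "T \<in> L1_part M \<tau>"
  shows "S + T \<in> L1_part M \<tau>"
proof -
  obtain a b c d where 1: "a \<in> fin_pos M \<tau>" "b \<in> fin_pos M \<tau>" "c \<in> fin_pos M \<tau>" "d \<in> fin_pos M \<tau>"
    "S = (a - b) + op_scale \<i> (c - d)" using assms(1) by (rule L1_E)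
  obtain a' b' c' d' where 2: "a' \<in> fin_pos M \<tau>" "b' \<in> fin_pos M \<tau>" "c' \<in> fin_pos M \<tau>" "d' \<in> fin_pos M \<tau>"
    "T = (a' - b') + op_scale \<i> (c' - d')" using assms(2) by (rule L1_E)
  show ?thesis
  proof (rule L1_I)
    show "a + a' \<in> fin_pos M \<tau>" "b + b' \<in> fin_pos M \<tau>" "c + c' \<in> fin_pos M \<tau>" "d + d' \<in> fin_pos M \<tau>"
      using 1 2 by (auto intro: fin_pos_add)
    show "S + T = ((a + a') - (b + b')) + op_scale \<i> ((c + c') - (d + d'))"
      unfolding 1(5) 2(5)
      by (intro blinfun_eqI ell2_eqI) (simp add: blinfun.add_left blinfun.diff_left algebra_simps)
  qed
qed

lemma L1_i:
  assumes "T \<in> L1_part M \<tau>"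
  shows "op_scale \<i> T \<in> L1_part M \<tau>"
proof -
  obtain a b c d where 1: "a \<in> fin_pos M \<tau>" "b \<in> fin_pos M \<tau>" "c \<in> fin_pos M \<tau>" "d \<in> fin_pos M \<tau>"
    "T = (a - b) + op_scale \<i> (c - d)" using assms(1) by (rule L1_E)
  have "op_scale \<i> T = (d - c) + op_scale \<i> (a - b)"
    unfolding 1(5)
    by (intro blinfun_eqI ell2_eqI) (simp add: blinfun.add_left blinfun.diff_left algebra_simps)
  then show ?thesis using L1_I[OF 1(4,3,1,2)] by blast
qed

lemma L1_real:
  assumes "T \<in> L1_part M \<tau>"
  shows "r *\<^sub>R T \<in> L1_part M \<tau>"
proof -
  obtain a b c d where 1: "a \<in> fin_pos M \<tau>" "b \<in> fin_pos M \<tau>" "c \<in> fin_pos M \<tau>" "d \<in> fin_pos M \<tau>"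
    "T = (a - b) + op_scale \<i> (c - d)" using assms(1) by (rule L1_E)
  show ?thesis
  proof (cases "r \<ge> 0")
    case True
    have "r *\<^sub>R T = (r *\<^sub>R a - r *\<^sub>R b) + op_scale \<i> (r *\<^sub>R c - r *\<^sub>R d)"
      unfolding 1(5) by (intro blinfun_eqI ell2_eqI)
        (simp add: blinfun.add_left blinfun.diff_left blinfun.scaleR_left algebra_simps)
    then show ?thesis
      using L1_I[OF 1(1-4)[THEN fin_pos_scale[OF True]]] by blast
  next
    case False
    then have neg: "- r \<ge> 0" by simp
    have "r *\<^sub>R T = ((- r) *\<^sub>R b - (- r) *\<^sub>R a) + op_scale \<i> ((- r) *\<^sub>R d - (- r) *\<^sub>R c)"
      unfolding 1(5) by (intro blinfun_eqI ell2_eqI)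
        (simp add: blinfun.add_left blinfun.diff_left blinfun.scaleR_left blinfun.minus_left algebra_simps)
    then show ?thesis
      using L1_I[OF 1(2,1,4,3)[THEN fin_pos_scale[OF neg]]] by blast
  qed
qed

lemma L1_scale:
  assumes T: "T \<in> L1_part M \<tau>"
  shows "op_scale c T \<in> L1_part M \<tau>"
proof -
  have "op_scale c T = Re c *\<^sub>R T + Im c *\<^sub>R op_scale \<i> T"
  proof (intro blinfun_eqI ell2_eqI)
    fix x k
    have "coord (op_scale c T x) k = (of_real (Re c) + \<i> * of_real (Im c)) * coord (T x) k"
      by (simp flip: complex_eq)
    also have "\<dots> = coord ((Re c *\<^sub>R T + Im c *\<^sub>R op_scale \<i> T) x) k"
      by (simp add: blinfun.add_left blinfun.scaleR_left algebra_simps)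
    finally show "coord (op_scale c T x) k = coord ((Re c *\<^sub>R T + Im c *\<^sub>R op_scale \<i> T) x) k" .
  qed
  then show ?thesis by (simp add: L1_add L1_real L1_i T)
qed

text \<open>With \<open>h\<close> the square root of \<open>x\<close>, the conjugate is
  \<open>z h\<close> times its adjoint. The trace property reverses the order of these factors, and
  then \<open>norm z\<close> can be pulled out of the norms of the columns
  \<open>z (h (ket y))\<close>.\<close>

lemma fin_pos_conj:
  assumes x: "x \<in> fin_pos M \<tau>" and z: "z \<in> M"
  shows "z o\<^sub>L x o\<^sub>L op_adj z \<in> fin_pos M \<tau>"
proof -
  have xM: "x \<in> M" "op_positive x" "\<tau> x < \<infinity>" using x by (auto simp: fin_pos_def pos_part_def)
  obtain h where h: "h \<in> M" "op_positive h" "h o\<^sub>L h = x" using M_sqrt[OF xM(1,2)] by blast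
  have hB: "h \<in> Bop" "z \<in> Bop" using h z by (auto simp: M_Bop)
  have ha: "op_adj h = h" by (rule op_positive_adj[OF h(2)])
  have zh: "z o\<^sub>L h \<in> M" using h z by (intro M_closed)
  have "z o\<^sub>L x o\<^sub>L op_adj z = (z o\<^sub>L h) o\<^sub>L op_adj (z o\<^sub>L h)"
    using hB by (simp add: op_adj_comp ha h(3)[symmetric] blinfun_compose_assoc)
  then have "\<tau> (z o\<^sub>L x o\<^sub>L op_adj z) = (\<Sum>\<^sub>\<infinity>y\<in>Y. ennreal ((norm ((z o\<^sub>L h) (ket y)))\<^sup>2))"
    using tr_comm[OF zh] diag_tr_adj_self[OF M_Bop[OF zh], of Y] by simp
  also have "\<dots> \<le> (\<Sum>\<^sub>\<infinity>y\<in>Y. ennreal ((norm z)\<^sup>2) * ennreal ((norm (h (ket y)))\<^sup>2))"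
  proof (rule infsum_ennreal_mono)
    fix y
    have "(norm ((z o\<^sub>L h) (ket y)))\<^sup>2 \<le> (norm z * norm (h (ket y)))\<^sup>2"
      by (intro power_mono) (simp_all add: norm_blinfun)
    then show "ennreal ((norm ((z o\<^sub>L h) (ket y)))\<^sup>2) \<le> ennreal ((norm z)\<^sup>2) * ennreal ((norm (h (ket y)))\<^sup>2)"
      by (simp add: power_mult_distrib ennreal_leI flip: ennreal_mult)
  qed
  also have "\<dots> = ennreal ((norm z)\<^sup>2) * \<tau> x"
    using diag_tr_adj_self[OF hB(1), of Y] by (simp add: infsum_ennreal_mult ha h(3))
  also have "\<dots> < \<infinity>" using xM(3) by (simp add: ennreal_mult_less_top)
  finally have "\<tau> (z o\<^sub>L x o\<^sub>L op_adj z) < \<infinity>" .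
  then show ?thesis
    using op_positive_conj[OF xM(2) hB(2)] xM(1) z
    by (simp add: fin_pos_def pos_part_def M_closed M_adj)
qed

text \<open>The polarisation \<open>4 y x = \<Sum> c (y + c) x (y + c)\<^sup>*\<close> over the fourth roots of unity \<open>c\<close> writes a
  product as a combination of positive elements.\<close>

lemma L1_ideal_pos:
  assumes x: "x \<in> fin_pos M \<tau>" and y: "y \<in> M"
  shows "y o\<^sub>L x \<in> L1_part M \<tau>"
proof -
  define P where "P c = (let z = y + op_scale c id_blinfun in z o\<^sub>L x o\<^sub>L op_adj z)" for c
  have P: "P c \<in> fin_pos M \<tau>" for c
    unfolding P_def Let_def by (intro fin_pos_conj x M_closed y)
  have yB: "y \<in> Bop" and xB: "x \<in> Bop" using x y by (auto simp: fin_pos_def pos_part_def M_Bop)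
  have adj: "op_adj (y + op_scale c id_blinfun) = op_adj y + op_scale (cnj c) id_blinfun" for c
    using yB by (simp add: op_adj_add op_adj_scale)
  have Pv: "P c v = y (x (op_adj y v)) + ell2_scale (cnj c) (y (x v)) + ell2_scale c (x (op_adj y v))
      + ell2_scale (c * cnj c) (x v)" for c v
    using yB xB unfolding P_def Let_def adj
    by (simp add: blinfun.add_left blinfun.add_right Bop_iff clinD ell2_scale_add add_ac)
  have "y o\<^sub>L x = (1/4) *\<^sub>R (op_scale 1 (P 1) + op_scale \<i> (P \<i>) + op_scale (-1) (P (-1)) + op_scale (-\<i>) (P (-\<i>)))"
    by (intro blinfun_eqI ell2_eqI)
      (simp add: blinfun.add_left blinfun.scaleR_left Pv algebra_simps)
  moreover have "\<dots> \<in> L1_part M \<tau>"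
    by (intro L1_real L1_add L1_scale L1_pos P)
  ultimately show ?thesis by simp
qed

lemma L1_ideal:
  assumes x: "x \<in> L1_part M \<tau>" and y: "y \<in> M"
  shows "y o\<^sub>L x \<in> L1_part M \<tau>"
proof -
  obtain a b c d where 1: "a \<in> fin_pos M \<tau>" "b \<in> fin_pos M \<tau>" "c \<in> fin_pos M \<tau>" "d \<in> fin_pos M \<tau>"
    "x = (a - b) + op_scale \<i> (c - d)" using x by (rule L1_E)
  have "y o\<^sub>L x = ((y o\<^sub>L a) + (-1) *\<^sub>R (y o\<^sub>L b)) + op_scale \<i> ((y o\<^sub>L c) + (-1) *\<^sub>R (y o\<^sub>L d))"
    using M_Bop[OF y] by (intro blinfun_eqI)
      (simp add: 1(5) blinfun.add_left blinfun.add_right blinfun.diff_left blinfun.diff_right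
        blinfun.scaleR_left Bop_iff clinD)
  moreover have "\<dots> \<in> L1_part M \<tau>"
    by (intro L1_add L1_real L1_scale L1_ideal_pos y 1(1-4))
  ultimately show ?thesis by simp
qed

end

text \<open>The vectors of \<open>Y\<close> separate the algebra, which gives faithfulness; each of
  them is singled out within \<open>Y\<close> by an element of the algebra, which gives
  semifiniteness.\<close>

locale faithful_diag_trace = diag_trace +
  assumes separating: "\<And>T. T \<in> M \<Longrightarrow> (\<And>y. y \<in> Y \<Longrightarrow> T (ket y) = 0) \<Longrightarrow> T = 0"
    and minimal_projection: "\<And>y. y \<in> Y \<Longrightarrow> \<exists>p\<in>M. op_adj p = p \<and> (\<forall>z\<in>Y. p (ket z) = (if z = y then ket y else 0))"
begin

lemma tr_faithful_vector:
  assumes "op_positive T" "\<And>y. y \<in> Y \<Longrightarrow> cinner (T (ket y)) (ket y) = 0" "T \<in> M"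
  shows "T = 0"
proof (rule separating[OF assms(3)])
  fix y assume y: "y \<in> Y"
  have "(norm (T (ket y)))\<^sup>2 \<le> norm T * Re (cinner (T (ket y)) (ket y))"
    by (rule op_positive_norm_sq_le[OF assms(1)])
  then show "T (ket y) = 0" unfolding assms(2)[OF y] by simp
qed

lemma tr_faithful: "faithful_trace M \<tau>"
  unfolding faithful_trace_def
proof (intro ballI impI)
  fix T assume T: "T \<in> pos_part M" and z: "\<tau> T = 0"
  then have pos: "op_positive T" and TM: "T \<in> M" by (auto simp: pos_part_def)
  show "T = 0"
  proof (rule tr_faithful_vector[OF pos _ TM])
    fix y assume y: "y \<in> Y"
    have "ennreal (Re (cinner (T (ket y)) (ket y))) \<le> \<tau> T"
      unfolding diag_tr_def infsum_ennreal_SUP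
      using y by (intro SUP_upper2[of "{y}"]) auto
    then have "Re (cinner (T (ket y)) (ket y)) \<le> 0" unfolding z by (simp add: ennreal_eq_0_iff)
    then show "cinner (T (ket y)) (ket y) = 0"
      using pos unfolding op_positive_iff complex_eq_iff by (metis antisym zero_complex.sel)
  qed
qed

text \<open>A positive \<open>T \<noteq> 0\<close> dominates a multiple of \<open>T p T\<close>, where the projection \<open>p\<close> has trace one.\<close>

lemma tr_semifinite: "semifinite_trace M \<tau>"
  unfolding semifinite_trace_def
proof (intro ballI impI)
  fix T assume T: "T \<in> pos_part M" and T0: "T \<noteq> 0"
  then have pos: "op_positive T" and TM: "T \<in> M" by (auto simp: pos_part_def)
  have TB: "T \<in> Bop" by (rule M_Bop[OF TM])
  have Ta: "op_adj T = T" by (rule op_positive_adj[OF pos])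
  obtain y where y: "y \<in> Y" "cinner (T (ket y)) (ket y) \<noteq> 0"
    using tr_faithful_vector[OF pos _ TM] T0 by blast
  obtain p where p: "p \<in> M" "op_adj p = p" and pk: "\<And>z. z \<in> Y \<Longrightarrow> p (ket z) = (if z = y then ket y else 0)"
    using minimal_projection[OF y(1)] by blast
  have pB: "p \<in> Bop" by (rule M_Bop[OF p(1)])
  define w where "w = p o\<^sub>L T"
  have wM: "w \<in> M" unfolding w_def by (intro M_closed p TM)
  have wB: "w \<in> Bop" by (rule M_Bop[OF wM])
  have wa: "op_adj w = T o\<^sub>L p" using pB TB by (simp add: w_def op_adj_comp p Ta)
  \<comment> \<open>\<open>op_adj w o\<^sub>L w\<close> is dominated by
    \<open>(norm p)\<^sup>2 * norm T\<close> times \<open>T\<close>; the added 1 keeps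
    \<open>K\<close> positive.\<close>
  define K where "K = (norm p)\<^sup>2 * norm T + 1"
  have K: "K > 0" unfolding K_def by (simp add: add_nonneg_pos)
  define S where "S = (1/K) *\<^sub>R (op_adj w o\<^sub>L w)"
  have Spos: "op_positive S" unfolding S_def
    using K wB by (intro op_positive_scaleR op_positive_adj_self) auto
  have SM: "S \<in> M" unfolding S_def by (intro M_closed M_adj wM)
  have qS: "cinner (S x) x = of_real ((norm (w x))\<^sup>2 / K)" for x
    using wB by (simp add: S_def blinfun.scaleR_left cinner_scaleR_left cinner_op_adj_left
        cinner_same scaleR_conv_of_real)
  have "op_le S T"
    unfolding op_le_iff[OF M_Bop[OF SM] TB]
  proof (intro allI conjI)
    fix x
    show "Im (cinner (S x) x) = Im (cinner (T x) x)" using Spos pos by (simp add: op_positive_iff)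
    have q: "Re (cinner (T x) x) \<ge> 0" using pos by (simp add: op_positive_iff)
    have "(norm (w x))\<^sup>2 \<le> (norm p * norm (T x))\<^sup>2"
      unfolding w_def by (intro power_mono) (simp_all add: norm_blinfun)
    also have "\<dots> \<le> (norm p)\<^sup>2 * (norm T * Re (cinner (T x) x))"
      unfolding power_mult_distrib by (intro mult_left_mono op_positive_norm_sq_le pos) simp
    also have "\<dots> \<le> K * Re (cinner (T x) x)"
      using q by (simp add: K_def algebra_simps)
    finally show "Re (cinner (S x) x) \<le> Re (cinner (T x) x)"
      unfolding qS using K by (simp add: field_simps)
  qed
  moreover have "S \<noteq> 0"
  proof
    assume "S = 0"
    then have "cinner (S (ket y)) (ket y) = 0" by simp
    then have "of_real ((norm (w (ket y)))\<^sup>2 / K) = (0::complex)" unfolding qS .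
    then have "w (ket y) = 0" using K by simp
    then have "cinner (p (T (ket y))) (ket y) = 0" by (simp add: w_def)
    moreover have "cinner (p (T (ket y))) (ket y) = cinner (T (ket y)) (p (ket y))"
      using cinner_op_adj[OF pB] p(2) by simp
    ultimately show False using y pk[OF y(1)] by simp
  qed
  moreover have "\<tau> S < \<infinity>"
  proof -
    have "\<tau> S = ennreal (1/K) * (\<Sum>\<^sub>\<infinity>z\<in>Y. ennreal ((norm (op_adj w (ket z)))\<^sup>2))"
      unfolding S_def using K by (simp add: tr_scale diag_tr_adj_self[OF wB] tracial[OF wM])
    \<comment> \<open>After the trace property has replaced \<open>w\<close> by its adjoint
      \<open>T o\<^sub>L p\<close>, every vector of \<open>Y\<close> other than \<open>y\<close> is
      annihilated.\<close>
    also have "(\<Sum>\<^sub>\<infinity>z\<in>Y. ennreal ((norm (op_adj w (ket z)))\<^sup>2))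
        = (\<Sum>\<^sub>\<infinity>z\<in>{y}. ennreal ((norm (op_adj w (ket z)))\<^sup>2))"
      by (rule infsum_cong_neutral) (use y pk in \<open>auto simp: wa\<close>)
    finally show ?thesis by (simp add: ennreal_mult_less_top)
  qed
  ultimately show "\<exists>S\<in>pos_part M. S \<noteq> 0 \<and> op_le S T \<and> \<tau> S < \<infinity>"
    using Spos SM by (auto simp: pos_part_def)
qed

lemma tr_nsf: "nsf_trace M \<tau>"
  unfolding nsf_trace_def using tr_is_trace tr_normal tr_semifinite tr_faithful by blast

end


section \<open>Gram representation of real positive definite kernels\<close>

text \<open>Riesz representation for the functional with graph \<open>V\<close>; the representing vector minimises
  \<open>(norm x)\<^sup>2 - 2 \<beta>\<close> over the closure of \<open>V\<close>.\<close>

lemma graph_representer: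
  fixes V :: "('a::{real_inner,banach} \<times> real) set"
  assumes V: "subspace V" and c: "c \<ge> 0"
    and bd: "\<And>x b. (x, b) \<in> V \<Longrightarrow> b\<^sup>2 \<le> c * (norm x)\<^sup>2"
  shows "\<exists>p\<in>closure (fst ` V). (\<forall>y b. (y, b) \<in> V \<longrightarrow> inner p y = b) \<and> (norm p)\<^sup>2 \<le> c"
proof -
  define g where "g z = (norm (fst z))\<^sup>2 - 2 * snd z" for z :: "'a \<times> real"
  have abs_le: "\<bar>snd z\<bar> \<le> sqrt c * norm (fst z)" if "z \<in> V" for z
  proof -
    have "(snd z)\<^sup>2 \<le> (sqrt c * norm (fst z))\<^sup>2"
      using bd[of "fst z" "snd z"] that c by (simp add: power_mult_distrib)
    then have "\<bar>snd z\<bar> \<le> \<bar>sqrt c * norm (fst z)\<bar>" by (simp only: abs_le_square_iff)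
    then show ?thesis using c by simp
  qed
  have lower: "g z \<ge> - c" if "z \<in> V" for z
  proof -
    have "0 \<le> (norm (fst z) - sqrt c)\<^sup>2" by simp
    also have "\<dots> = (norm (fst z))\<^sup>2 - 2 * (sqrt c * norm (fst z)) + c"
      using c by (simp add: power2_diff)
    finally show ?thesis using abs_le[OF that] by (simp add: g_def)
  qed
  define m where "m = (INF z\<in>V. g z)"
  have bb: "bdd_below (g ` V)" by (rule bdd_belowI2[OF lower])
  have ne: "V \<noteq> {}" using subspace_0[OF V] by blast
  have m_le: "m \<le> g z" if "z \<in> V" for z unfolding m_def by (rule cINF_lower[OF bb that])
  have "\<exists>z\<in>V. g z < m + 1 / real (Suc n)" for n
    using cINF_less_iff[OF ne bb, of "m + 1 / real (Suc n)"] by (simp add: m_def)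
  then obtain z where zV: "\<And>n. z n \<in> V" and zg: "\<And>n. g (z n) < m + 1 / real (Suc n)" by metis
  have gz: "(\<lambda>n. g (z n)) \<longlonglongrightarrow> m"
  proof (rule tendsto_sandwich[of "\<lambda>_. m" _ _ "\<lambda>n. m + 1 / real (Suc n)"])
    show "(\<lambda>n. m + 1 / real (Suc n)) \<longlonglongrightarrow> m"
      using tendsto_add[OF tendsto_const[of m] LIMSEQ_inverse_real_of_nat]
      by (simp add: inverse_eq_divide)
  qed (use m_le[OF zV] zg less_imp_le in \<open>auto intro!: always_eventually\<close>)
  \<comment> \<open>The midpoint of two near-minimisers stays in \<open>V\<close>, so the
    parallelogram law makes the first components of a minimising sequence Cauchy.\<close>
  have para: "(norm (fst v - fst w))\<^sup>2 \<le> 2 * (g v - m) + 2 * (g w - m)" if "v \<in> V" "w \<in> V" for v w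
  proof -
    define u where "u = (1/2) *\<^sub>R (v + w)"
    have mid: "u \<in> V" unfolding u_def by (intro subspace_scale[OF V] subspace_add[OF V] that)
    have u: "norm (fst v + fst w) = 2 * norm (fst u)" "snd v + snd w = 2 * snd u"
      by (simp_all add: u_def flip: scaleR_add_right)
    have "4 * g u = (norm (fst v + fst w))\<^sup>2 - 4 * (snd v + snd w)"
      unfolding u by (simp add: g_def power_mult_distrib)
    moreover have "(norm (fst v + fst w))\<^sup>2 + (norm (fst v - fst w))\<^sup>2
        = 2 * (norm (fst v))\<^sup>2 + 2 * (norm (fst w))\<^sup>2"
      by (simp add: power2_norm_eq_inner inner_add_left inner_add_right inner_diff_left
          inner_diff_right inner_commute)
    ultimately show ?thesis using m_le[OF mid] unfolding g_def by argo
  qed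
  have "Cauchy (\<lambda>n. fst (z n))"
  proof (rule metric_CauchyI)
    fix e :: real assume e: "e > 0"
    have "eventually (\<lambda>n. g (z n) < m + e\<^sup>2 / 4) sequentially"
      using e by (intro order_tendstoD(2)[OF gz]) simp
    then obtain N where N: "\<And>n. n \<ge> N \<Longrightarrow> g (z n) < m + e\<^sup>2 / 4"
      by (auto simp: eventually_sequentially)
    have "dist (fst (z j)) (fst (z k)) < e" if "j \<ge> N" "k \<ge> N" for j k
    proof -
      have "(norm (fst (z j) - fst (z k)))\<^sup>2 < e\<^sup>2"
        using para[OF zV zV, of j k] N[OF that(1)] N[OF that(2)] by argo
      then show ?thesis using e by (simp add: dist_norm power2_less_imp_less)
    qed
    then show "\<exists>N. \<forall>j\<ge>N. \<forall>k\<ge>N. dist (fst (z j)) (fst (z k)) < e" by blast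
  qed
  then obtain p where p: "(\<lambda>n. fst (z n)) \<longlonglongrightarrow> p"
    by (auto simp: Cauchy_convergent_iff convergent_def)
  \<comment> \<open>\<open>g\<close> and the first component determine the second one, so
    \<open>snd (z n)\<close> converges as well, with this limit.\<close>
  define b where "b = ((norm p)\<^sup>2 - m) / 2"
  have "(\<lambda>n. ((norm (fst (z n)))\<^sup>2 - g (z n)) / 2) \<longlonglongrightarrow> b"
    unfolding b_def by (intro tendsto_intros p gz) simp
  then have zb: "(\<lambda>n. snd (z n)) \<longlonglongrightarrow> b" by (simp add: g_def)
  have rep: "inner p y = h" if yh: "(y, h) \<in> V" for y h
  proof (rule ccontr)
    assume ne: "inner p y \<noteq> h"
    define d where "d = inner p y - h"
    define N where "N = (norm y)\<^sup>2 + 1"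
    \<comment> \<open>This step along \<open>y\<close> would push \<open>g\<close> below its
      infimum; it is the optimal step up to the 1 in \<open>N\<close>, which avoids division by
      zero.\<close>
    define s where "s = - d / N"
    have N: "N > 0" by (simp add: N_def add_nonneg_pos)
    have "(\<lambda>n. g (z n + s *\<^sub>R (y, h))) \<longlonglongrightarrow> (norm (p + s *\<^sub>R y))\<^sup>2 - 2 * (b + s * h)"
      unfolding g_def by (simp, intro tendsto_intros p zb)
    moreover have "m \<le> g (z n + s *\<^sub>R (y, h))" for n
      by (intro m_le subspace_add[OF V] subspace_scale[OF V] zV yh)
    ultimately have "m \<le> (norm (p + s *\<^sub>R y))\<^sup>2 - 2 * (b + s * h)"
      by (intro tendsto_lowerbound[where F = sequentially]) auto
    moreover have "m = (norm p)\<^sup>2 - 2 * b" by (simp add: b_def field_simps)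
    moreover have "(norm (p + s *\<^sub>R y))\<^sup>2 = (norm p)\<^sup>2 + 2 * s * inner p y + s\<^sup>2 * (norm y)\<^sup>2"
      by (simp add: power2_norm_eq_inner inner_add_left inner_add_right inner_commute power2_eq_square[of s])
    ultimately have "0 \<le> 2 * s * d + s\<^sup>2 * (norm y)\<^sup>2"
      by (simp add: d_def algebra_simps)
    also have "\<dots> \<le> 2 * s * d + s\<^sup>2 * N" by (simp add: N_def mult_left_mono)
    also have "\<dots> = - (d\<^sup>2 / N)"
      using N by (simp add: s_def power2_eq_square field_simps)
    also have "\<dots> < 0" using ne N by (simp add: d_def)
    finally show False by simp
  qed
  have "(\<lambda>n. inner p (fst (z n))) \<longlonglongrightarrow> inner p p" by (intro tendsto_intros p)
  moreover have "inner p (fst (z n)) = snd (z n)" for n by (rule rep) (use zV in simp)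
  ultimately have pp: "inner p p = b" using zb LIMSEQ_unique by auto
  have "b\<^sup>2 \<le> c * (norm p)\<^sup>2"
  proof (rule LIMSEQ_le)
    show "(\<lambda>n. (snd (z n))\<^sup>2) \<longlonglongrightarrow> b\<^sup>2" by (intro tendsto_intros zb)
    show "(\<lambda>n. c * (norm (fst (z n)))\<^sup>2) \<longlonglongrightarrow> c * (norm p)\<^sup>2" by (intro tendsto_intros p)
    show "\<exists>N. \<forall>n\<ge>N. (snd (z n))\<^sup>2 \<le> c * (norm (fst (z n)))\<^sup>2"
      using bd[of "fst (z _)" "snd (z _)"] zV by simp
  qed
  then have "(norm p)\<^sup>2 * (norm p)\<^sup>2 \<le> c * (norm p)\<^sup>2"
    unfolding pp[symmetric] power2_norm_eq_inner[symmetric] by (simp only: power2_eq_square[of "(norm p)\<^sup>2"])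
  then have "(norm p)\<^sup>2 \<le> c"
    using c mult_right_le_imp_le[of "(norm p)\<^sup>2" "(norm p)\<^sup>2" c] by (cases "p = 0") auto
  moreover have "p \<in> closure (fst ` V)"
    unfolding closure_sequential using zV p by (intro exI[of _ "\<lambda>n. fst (z n)"]) auto
  ultimately show ?thesis using rep by blast
qed

lemma span_graph_combination:
  assumes "z \<in> span ((\<lambda>j. (v j, a j)) ` J)"
  shows "\<exists>F t. finite F \<and> F \<subseteq> J \<and> fst z = (\<Sum>j\<in>F. t j *\<^sub>R v j) \<and> snd z = (\<Sum>j\<in>F. t j * (a j :: real))"
  using assms
proof (induction rule: span_induct_alt)
  case base
  show ?case by (intro exI[of _ "{}"]) simp
next
  case (step c z w)
  then obtain F t j where F: "finite F" "F \<subseteq> J" "fst w = (\<Sum>j\<in>F. t j *\<^sub>R v j)" "snd w = (\<Sum>j\<in>F. t j * a j)"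
    and j: "j \<in> J" "z = (v j, a j)" by blast
  \<comment> \<open>\<open>j\<close> may already lie in \<open>F\<close>, so \<open>c\<close> is
    added to its old coefficient.\<close>
  define t' where "t' = (\<lambda>k. (if k \<in> F then t k else 0) + (if k = j then c else 0))"
  have s: "(\<Sum>k\<in>insert j F. t' k * h k) = c * h j + (\<Sum>k\<in>F. t k * h k)" for h :: "'b \<Rightarrow> real"
  proof -
    have "(\<Sum>k\<in>insert j F. t' k * h k)
        = (\<Sum>k\<in>insert j F. if k \<in> F then t k * h k else 0) + (\<Sum>k\<in>insert j F. if k = j then c * h j else 0)"
      unfolding t'_def sum.distrib[symmetric] by (intro sum.cong) (auto simp: algebra_simps)
    moreover have "(\<Sum>k\<in>insert j F. if k \<in> F then t k * h k else 0) = (\<Sum>k\<in>F. t k * h k)"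
      using F(1) by (intro sum.mono_neutral_cong_right) auto
    ultimately show ?thesis using F(1) by simp
  qed
  have v: "(\<Sum>k\<in>insert j F. t' k *\<^sub>R v k) = c *\<^sub>R v j + (\<Sum>k\<in>F. t k *\<^sub>R v k)"
  proof -
    have "(\<Sum>k\<in>insert j F. t' k *\<^sub>R v k)
        = (\<Sum>k\<in>insert j F. if k \<in> F then t k *\<^sub>R v k else 0) + (\<Sum>k\<in>insert j F. if k = j then c *\<^sub>R v j else 0)"
      unfolding t'_def sum.distrib[symmetric] by (intro sum.cong) (auto simp: algebra_simps)
    moreover have "(\<Sum>k\<in>insert j F. if k \<in> F then t k *\<^sub>R v k else 0) = (\<Sum>k\<in>F. t k *\<^sub>R v k)"
      using F(1) by (intro sum.mono_neutral_cong_right) auto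
    ultimately show ?thesis using F(1) by simp
  qed
  show ?case
    by (rule exI[of _ "insert j F"], rule exI[of _ t']) (use F j s v in auto)
qed

text \<open>The representing vector is only a limit of combinations; closedness lets it inherit real
  coordinates and the support.\<close>

lemma closed_ell2_support: "closed {x. \<forall>k. Im (coord x k) = 0 \<and> (k \<notin> K \<longrightarrow> coord x k = 0)}"
  unfolding closed_sequential_limits
proof (intro allI impI CollectI, elim conjE)
  fix X x k assume X: "\<forall>n. X n \<in> {x. \<forall>k. Im (coord x k) = 0 \<and> (k \<notin> K \<longrightarrow> coord x k = 0)}"
    and lim: "X \<longlonglongrightarrow> x"
  have 1: "(\<lambda>n. coord (X n) k) \<longlonglongrightarrow> coord x k" by (intro tendsto_intros lim)
  have "(\<lambda>n. Im (coord (X n) k)) \<longlonglongrightarrow> Im (coord x k)" by (intro tendsto_intros 1)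
  then show "Im (coord x k) = 0 \<and> (k \<notin> K \<longrightarrow> coord x k = 0)"
    using X 1 by (auto simp: LIMSEQ_const_iff)
qed

text \<open>The Cholesky decomposition along a well-order of the index set, so that the \<open>i\<close>-th vector is
  supported on the indices up to \<open>i\<close> and no further dimension is needed.\<close>

lemma gram_ell2:
  fixes A :: "'i \<Rightarrow> 'i \<Rightarrow> real"
  assumes sym: "\<And>i j. A i j = A j i" and one: "\<And>i. A i i = 1"
    and psd: "\<And>F t. finite F \<Longrightarrow> (\<Sum>i\<in>F. \<Sum>j\<in>F. t i * t j * A i j) \<ge> 0"
  shows "\<exists>u :: 'i \<Rightarrow> 'i \<Rightarrow> real. \<forall>i j. ((\<lambda>k. u i k * u j k) has_sum A i j) UNIV"
proof -
  obtain r where r: "well_order_on (UNIV :: 'i set) r" using well_order_on by blast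
  define lt where "lt = r - Id"
  have wf: "wf lt" using r by (simp add: lt_def well_order_on_def)
  have trans: "(i, k) \<in> lt" if "(i, j) \<in> lt" "(j, k) \<in> lt" for i j k
    using r that unfolding lt_def well_order_on_def linear_order_on_def partial_order_on_def
      preorder_on_def trans_def antisym_def by blast
  have tot: "i = j \<or> (i, j) \<in> lt \<or> (j, i) \<in> lt" for i j
    using r unfolding lt_def well_order_on_def linear_order_on_def total_on_def by blast
  have irr: "(i, i) \<notin> lt" for i by (simp add: lt_def)
  \<comment> \<open>The recursion constrains \<open>w\<close> only against earlier vectors; symmetry
    of \<open>A\<close> supplies the remaining inner products.\<close>
  define P where "P v i w \<longleftrightarrow> (\<forall>k. Im (coord w k) = 0 \<and> (coord w k \<noteq> 0 \<longrightarrow> k = i \<or> (k, i) \<in> lt)) \<and>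
    inner w w = 1 \<and> (\<forall>j. (j, i) \<in> lt \<longrightarrow> inner w (v j) = A i j)"
    for v :: "'i \<Rightarrow> 'i ell2" and i and w :: "'i ell2"
  have "\<exists>v. \<forall>i. P v i (v i)"
  proof (rule dependent_wf_choice[OF wf])
    show "P f x r = P g x r" if "\<And>z. (z, x) \<in> lt \<Longrightarrow> f z = g z" for f g x r
      using that by (auto simp: P_def)
    fix i v assume IH: "\<And>j. (j, i) \<in> lt \<Longrightarrow> P v j (v j)"
    let ?J = "{j. (j, i) \<in> lt}"
    have ip: "inner (v j) (v k) = A j k" if "j \<in> ?J" "k \<in> ?J" for j k
    proof -
      consider "j = k" | "(j, k) \<in> lt" | "(k, j) \<in> lt" using tot by blast
      then show ?thesis
      proof cases
        case 2
        then have "inner (v k) (v j) = A k j" using IH[of k] that by (simp add: P_def)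
        then show ?thesis by (simp add: inner_commute sym[of k])
      qed (use IH[of j] that one in \<open>auto simp: P_def\<close>)
    qed
    \<comment> \<open>The functional taking \<open>v j\<close> to \<open>A i j\<close> is kept as a
      graph because the \<open>v j\<close> may be linearly dependent. The bound \<open>bd\<close>
      below contains its well-definedness.\<close>
    define V where "V = span ((\<lambda>j. (v j, A i j)) ` ?J)"
    have bd: "b\<^sup>2 \<le> 1 * (norm x)\<^sup>2" if xb: "(x, b) \<in> V" for x b
    proof -
      obtain F t where F: "finite F" "F \<subseteq> ?J" "x = (\<Sum>j\<in>F. t j *\<^sub>R v j)" "b = (\<Sum>j\<in>F. t j * A i j)"
        using span_graph_combination[OF xb[unfolded V_def]] by auto
      have iF: "i \<notin> F" using F irr by auto
      have nx: "(norm x)\<^sup>2 = (\<Sum>j\<in>F. \<Sum>k\<in>F. t j * t k * A j k)"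
        unfolding F(3) power2_norm_eq_inner inner_sum_left inner_sum_right
        using F(2) ip by (auto intro!: sum.cong simp: subset_eq sym)
      \<comment> \<open>With coefficient \<open>-b\<close> at \<open>i\<close>, positivity of the
        section on \<open>insert i F\<close> reads \<open>b b - 2 b b + (norm x)\<^sup>2\<close>
        \<ge> 0, which is the desired bound.\<close>
      define t' where "t' = t(i := - b)"
      have t': "t' i = - b" "\<And>j. j \<in> F \<Longrightarrow> t' j = t j" using iF by (auto simp: t'_def)
      have "0 \<le> (\<Sum>j\<in>insert i F. \<Sum>k\<in>insert i F. t' j * t' k * A j k)"
        using F(1) by (intro psd) simp
      also have "\<dots> = b * b + (\<Sum>k\<in>F. (- b) * t k * A i k)
          + (\<Sum>j\<in>F. t j * (- b) * A j i) + (\<Sum>j\<in>F. \<Sum>k\<in>F. t j * t k * A j k)"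
        using F(1) iF by (simp add: t' one sum.distrib sum_negf sum_subtractf)
      also have "(\<Sum>k\<in>F. (- b) * t k * A i k) = - b * b"
        by (simp add: F(4) sum_distrib_left mult.assoc sum_negf)
      also have "(\<Sum>j\<in>F. t j * (- b) * A j i) = - b * b"
        unfolding F(4) sum_distrib_left by (intro sum.cong) (auto simp: sym[of _ i])
      finally show ?thesis by (simp add: nx power2_eq_square[of b])
    qed
    obtain p where p: "p \<in> closure (fst ` V)" "\<And>y b. (y, b) \<in> V \<Longrightarrow> inner p y = b" "(norm p)\<^sup>2 \<le> 1"
      using graph_representer[of V 1, OF _ _ bd] by (auto simp: V_def)
    let ?C = "{x. \<forall>k. Im (coord x k) = 0 \<and> (k \<notin> ?J \<longrightarrow> coord x k = 0)}"
    have vC: "v j \<in> ?C" if "j \<in> ?J" for j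
      using IH[of j] that trans[of _ j i] by (auto simp: P_def)
    have "fst ` V \<subseteq> ?C"
    proof
      fix x assume "x \<in> fst ` V"
      then obtain z where z: "z \<in> V" "x = fst z" by blast
      obtain F t where "F \<subseteq> ?J" "x = (\<Sum>j\<in>F. t j *\<^sub>R v j)"
        using span_graph_combination[OF z(1)[unfolded V_def]] z(2) by auto
      then show "x \<in> ?C" using vC by (auto simp: subset_eq intro!: sum.neutral)
    qed
    then have pC: "p \<in> ?C" using closure_minimal[OF _ closed_ell2_support[of ?J]] p(1) by blast
    \<comment> \<open>The length missing from \<open>p\<close> is placed on coordinate
      \<open>i\<close>, on which \<open>p\<close> and all earlier vectors vanish.\<close>
    define s where "s = sqrt (1 - (norm p)\<^sup>2)"
    have s2: "s\<^sup>2 = 1 - (norm p)\<^sup>2" using p(3) by (simp add: s_def)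
    define w where "w = p + s *\<^sub>R ket i"
    have ket: "inner x (ket i) = Re (coord x i)" for x
      by (simp add: inner_ell2_def cinner_ket_right)
    have pi: "coord p i = 0" using pC irr by auto
    have "inner w w = inner p p + 2 * s * inner p (ket i) + s\<^sup>2 * inner (ket i) (ket i)"
      by (simp add: w_def inner_add_left inner_add_right inner_commute power2_eq_square algebra_simps)
    then have "inner w w = 1" by (simp add: ket pi s2 power2_norm_eq_inner)
    moreover have "inner w (v j) = A i j" if "(j, i) \<in> lt" for j
    proof -
      have "(v j, A i j) \<in> V" unfolding V_def by (rule span_base) (use that in blast)
      moreover have "coord (v j) i = 0" using vC[of j] that irr by auto
      ultimately show ?thesis
        using p(2) by (simp add: w_def inner_add_left inner_commute[of "ket i"] ket)
    qed
    moreover have "Im (coord w k) = 0 \<and> (coord w k \<noteq> 0 \<longrightarrow> k = i \<or> (k, i) \<in> lt)" for k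
      using pC by (auto simp: w_def)
    ultimately show "\<exists>w. P v i w" unfolding P_def by blast
  qed
  then obtain v where v: "\<And>i. P v i (v i)" by blast
  have re: "coord (v i) k = of_real (Re (coord (v i) k))" for i k
    using v[of i] by (simp add: P_def complex_eq_iff)
  have ip: "inner (v i) (v j) = A i j" for i j
  proof -
    consider "i = j" | "(i, j) \<in> lt" | "(j, i) \<in> lt" using tot by blast
    then show ?thesis
    proof cases
      case 2
      then have "inner (v j) (v i) = A j i" using v[of j] by (simp add: P_def)
      then show ?thesis by (simp add: inner_commute sym[of j])
    qed (use v[of i] one in \<open>auto simp: P_def\<close>)
  qed
  have "((\<lambda>k. Re (coord (v i) k) * Re (coord (v j) k)) has_sum A i j) UNIV" for i j
  proof -
    have "((\<lambda>k. coord (v i) k * cnj (coord (v j) k)) has_sum cinner (v i) (v j)) UNIV"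
      unfolding cinner.rep_eq by (rule has_sum_infsum[OF summable_prod_cnj[OF coord_sq_summable coord_sq_summable]])
    then have "((\<lambda>k. Re (coord (v i) k * cnj (coord (v j) k))) has_sum Re (cinner (v i) (v j))) UNIV"
      by (rule has_sum_Re)
    moreover have "Re (coord (v i) k * cnj (coord (v j) k)) = Re (coord (v i) k) * Re (coord (v j) k)" for k
      using v[of i] by (simp add: P_def)
    ultimately show ?thesis using ip[of i j] by (simp only: inner_ell2_def)
  qed
  then show ?thesis by (intro exI[of _ "\<lambda>i k. Re (coord (v i) k)"] allI)
qed


section \<open>Finite sets under symmetric difference\<close>

definition sd :: "'s fset \<Rightarrow> 's fset \<Rightarrow> 's fset" where
  "sd F G = (F |-| G) |\<union>| (G |-| F)"

lemma sd_iff [simp]: "x |\<in>| sd F G \<longleftrightarrow> (x |\<in>| F) \<noteq> (x |\<in>| G)"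
  by (auto simp: sd_def)

lemma sd_commute: "sd F G = sd G F"
  and sd_assoc: "sd (sd F G) H = sd F (sd G H)"
  and sd_left_commute: "sd F (sd G H) = sd G (sd F H)"
  and sd_self [simp]: "sd F F = {||}"
  and sd_empty [simp]: "sd F {||} = F" "sd {||} F = F"
  and sd_cancel [simp]: "sd F (sd F G) = G" "sd (sd F G) G = F" "sd (sd G F) G = F" "sd G (sd F G) = F"
  by (auto intro!: fset_eqI)

lemma sd_eq_iff: "sd F G = H \<longleftrightarrow> F = sd H G"
  by auto

text \<open>On the right, elements of the intersection contribute twice and their factors square to
  one. This makes signs multiplicative under symmetric difference.\<close>

lemma prod_sd:
  fixes g :: "'s \<Rightarrow> complex"
  assumes "\<And>a. g a * g a = 1"
  shows "prod g (fset (sd F G)) = prod g (fset F) * prod g (fset G)"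
proof -
  have split: "prod g (fset F) = prod g (fset F \<inter> fset G) * prod g (fset F - fset G)" for F G
    by (rule prod.Int_Diff) simp
  have "prod g (fset (sd F G)) = prod g (fset F - fset G) * prod g (fset G - fset F)"
    unfolding sd_def by (simp add: prod.union_disjoint[symmetric] Diff_Int_distrib Int_commute disjoint_iff)
  moreover have "prod g (fset F \<inter> fset G) * prod g (fset F \<inter> fset G) = 1"
    by (simp add: prod.distrib[symmetric] assms)
  ultimately show ?thesis
    using split[of F G] split[of G F] by (simp add: Int_commute mult_ac)
qed

lemma sd_fimage:
  assumes g: "inj g"
  shows "sd (g |`| F) (g |`| G) = g |`| sd F G"
proof (rule fset_eqI)
  fix z
  have m: "z |\<in>| g |`| H \<longleftrightarrow> (\<exists>a. z = g a \<and> a |\<in>| H)" for H by auto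
  show "z |\<in>| sd (g |`| F) (g |`| G) \<longleftrightarrow> z |\<in>| g |`| sd F G"
    unfolding sd_iff m using g by (cases "\<exists>a. z = g a") (auto simp: inj_eq)
qed


section \<open>The Clifford algebra and its commutant\<close>

text \<open>Finite subsets of \<open>'s\<close> form a group under symmetric difference, and a tournament \<open>lt\<close> on \<open>'s\<close>
  gives the bicharacter \<open>sg\<close> below. The Clifford algebra is the twisted group algebra: \<open>Cm\<close> is the
  left and \<open>Rm\<close> the right regular representation, tensored with the identity on \<open>\<ell>\<^sup>2('i)\<close>.\<close>

locale clifford =
  fixes lt :: "'s \<Rightarrow> 's \<Rightarrow> bool" and index :: "'i itself"
  assumes lt_irrefl: "\<not> lt s s" and lt_tournament: "s \<noteq> t \<Longrightarrow> lt s t \<longleftrightarrow> \<not> lt t s"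
begin

text \<open>The sign in the product rule \<open>Cm F\<close> times \<open>Cm G\<close> equals
  \<open>sg F G\<close> times \<open>Cm (sd F G)\<close>: one factor -1 for each pair of generators
  that is out of order.\<close>

definition sg :: "'s fset \<Rightarrow> 's fset \<Rightarrow> complex" where
  "sg F G = (\<Prod>a\<in>fset F. \<Prod>b\<in>fset G. if lt b a then -1 else 1)"

lemma sg_empty [simp]: "sg {||} G = 1" "sg F {||} = 1"
  by (simp_all add: sg_def)

lemma sg_sq [simp]: "sg F G * sg F G = 1"
  unfolding sg_def by (simp add: prod.distrib[symmetric] if_distrib cong: if_cong)

lemma sg_sq' [simp]: "sg F G * (sg F G * z) = z"
  using sg_sq[of F G] by (simp add: mult.assoc[symmetric])

lemma sg_cases: "sg F G = 1 \<or> sg F G = -1"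
  using sg_sq[of F G] by (simp add: power2_eq_1_iff flip: power2_eq_square)

lemma sg_cnj [simp]: "cnj (sg F G) = sg F G" and cmod_sg [simp]: "cmod (sg F G) = 1"
  and sg_neq_0 [simp]: "sg F G \<noteq> 0"
  using sg_cases[of F G] by auto

lemma sg_sd_left: "sg (sd F G) H = sg F H * sg G H"
  unfolding sg_def
  by (rule prod_sd) (simp add: prod.distrib[symmetric] if_distrib cong: if_cong)

lemma sg_sd_right: "sg H (sd F G) = sg H F * sg H G"
  unfolding sg_def prod.distrib[symmetric]
  by (rule prod.cong[OF refl], rule prod_sd) auto

lemma sg_single: "sg {|s|} {|s|} = 1" "s \<noteq> t \<Longrightarrow> sg {|s|} {|t|} = - sg {|t|} {|s|}"
  using lt_tournament[of s t] by (auto simp: sg_def lt_irrefl)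

lemma sg_fimage:
  assumes "inj g" "\<And>a b. lt (g a) (g b) \<longleftrightarrow> lt a b"
  shows "sg (g |`| F) (g |`| G) = sg F G"
  unfolding sg_def using assms by (simp add: prod.reindex inj_on_def inj_def)

text \<open>\<open>mon\<close> is indexed by outputs, so the sign is taken at the input set
  \<open>sd F G\<close>; on basis vectors it becomes \<open>sg F G\<close>, as in
  \<open>Rm_ket\<close>.\<close>

definition Rm :: "'s fset \<Rightarrow> ('i \<times> 's fset) op" where
  "Rm G = mon (\<lambda>(i, F). (i, sd F G)) (\<lambda>(i, F). sg (sd F G) G)"

definition Cm :: "'s fset \<Rightarrow> ('i \<times> 's fset) op" where
  "Cm H = mon (\<lambda>(i, F). (i, sd H F)) (\<lambda>(i, F). sg H (sd H F))"

lemma coord_Rm [simp]: "coord (Rm G x) (i, F) = sg (sd F G) G * coord x (i, sd F G)"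
  and clin_Rm [simp]: "clin (Rm G)"
proof -
  have inj: "inj_on (\<lambda>(i::'i, F). (i, sd F G)) A" for A
    by (rule inj_onI) (auto simp: sd_eq_iff)
  show "coord (Rm G x) (i, F) = sg (sd F G) G * coord x (i, sd F G)"
    unfolding Rm_def by (subst coord_mon[OF inj]) auto
  show "clin (Rm G)" unfolding Rm_def by (rule clin_mon[OF inj]) auto
qed

lemma coord_Cm [simp]: "coord (Cm H x) (i, F) = sg H (sd H F) * coord x (i, sd H F)"
  and clin_Cm [simp]: "clin (Cm H)"
proof -
  have inj: "inj_on (\<lambda>(i::'i, F). (i, sd H F)) A" for A
    by (rule inj_onI) (auto simp: sd_eq_iff sd_commute[of H])
  show "coord (Cm H x) (i, F) = sg H (sd H F) * coord x (i, sd H F)"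
    unfolding Cm_def by (subst coord_mon[OF inj]) auto
  show "clin (Cm H)" unfolding Cm_def by (rule clin_mon[OF inj]) auto
qed

lemma ell2_pair_eqI: "(\<And>i F. coord x (i, F) = coord y (i, F)) \<Longrightarrow> x = y"
  by (rule ell2_eqI) auto

lemma Rm_ket: "Rm G (ket (j, F)) = ell2_scale (sg F G) (ket (j, sd F G))"
  by (rule ell2_pair_eqI) (auto simp: sd_eq_iff)

lemma Cm_ket: "Cm H (ket (j, F)) = ell2_scale (sg H F) (ket (j, sd H F))"
  by (rule ell2_pair_eqI) (auto simp: sd_eq_iff sd_commute[of H])

lemma Rm_ket_empty: "Rm G (ket (j, {||})) = ket (j, G)"
  by (simp add: Rm_ket)

lemma Cm_ket_empty: "Cm H (ket (j, {||})) = ket (j, H)"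
  by (simp add: Cm_ket)

lemma op_adj_Rm: "op_adj (Rm G) = op_scale (sg G G) (Rm G)"
proof -
  have "Rm G \<in> Bop" by (simp add: Bop_iff)
  then show ?thesis
    by (intro op_entry_eqI) (auto simp: coord_op_adj sd_eq_iff sg_sd_left)
qed

lemma op_adj_Cm: "op_adj (Cm G) = op_scale (sg G G) (Cm G)"
proof -
  have "Cm G \<in> Bop" by (simp add: Bop_iff)
  then show ?thesis
    by (intro op_entry_eqI) (auto simp: coord_op_adj sd_eq_iff sg_sd_right sd_commute[of G])
qed

text \<open>Scalar multiples are included because the adjoint of \<open>Rm G\<close> is
  \<open>Rm G\<close> only up to the sign \<open>sg G G\<close>.\<close>

definition RR :: "('i \<times> 's fset) op set" where
  "RR = {op_scale c (Rm G) | c G. True}"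

sublocale vn_commutant RR
proof
  show "RR \<subseteq> Bop" by (auto simp: RR_def Bop_iff clin_op_scale)
  fix r assume "r \<in> RR"
  then obtain c G where r: "r = op_scale c (Rm G)" by (auto simp: RR_def)
  have "op_adj r = op_scale (cnj c * sg G G) (Rm G)"
    unfolding r by (subst op_adj_scale) (auto simp: Bop_iff op_adj_Rm intro!: blinfun_eqI)
  then show "op_adj r \<in> RR" by (auto simp: RR_def)
qed

lemma M_iff: "T \<in> M \<longleftrightarrow> T \<in> Bop \<and> (\<forall>G x. T (Rm G x) = Rm G (T x))"
proof
  assume T: "T \<in> M"
  have "Rm G \<in> RR" for G
    unfolding RR_def by (intro CollectI exI[of _ 1] exI[of _ G]) (auto intro!: blinfun_eqI)
  then show "T \<in> Bop \<and> (\<forall>G x. T (Rm G x) = Rm G (T x))"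
    using M_Bop[OF T] M_comm[OF T] by blast
next
  assume "T \<in> Bop \<and> (\<forall>G x. T (Rm G x) = Rm G (T x))"
  then show "T \<in> M" by (intro M_I) (auto simp: RR_def Bop_iff clinD)
qed

lemma M_Rm: "T \<in> M \<Longrightarrow> T (Rm G x) = Rm G (T x)"
  by (simp add: M_iff)

text \<open>\<open>ket (j, G)\<close> is \<open>Rm G\<close> applied to a vacuum vector, so an
  element of \<open>M\<close> is determined by its vacuum columns.\<close>

lemma M_ket:
  assumes "T \<in> M"
  shows "coord (T (ket (j, G))) (i, F) = sg (sd F G) G * coord (T (ket (j, {||}))) (i, sd F G)"
  by (metis M_Rm[OF assms] Rm_ket_empty coord_Rm)

lemma M_ketI:
  assumes T: "T \<in> Bop"
    and "\<And>i F j G. coord (T (ket (j, G))) (i, F) = sg (sd F G) G * coord (T (ket (j, {||}))) (i, sd F G)"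
  shows "T \<in> M"
  unfolding M_iff
proof (intro conjI T allI)
  fix G x
  have "T o\<^sub>L Rm G = Rm G o\<^sub>L T"
  proof (rule op_ket_eqI)
    show "clin (T o\<^sub>L Rm G)" "clin (Rm G o\<^sub>L T)" using T by (auto simp: Bop_iff intro: clin_comp)
    fix k :: "'i \<times> 's fset"
    obtain j H where k: "k = (j, H)" by fastforce
    have Ts: "T (ell2_scale c y) = ell2_scale c (T y)" for c y using T by (simp add: Bop_iff clinD)
    show "(T o\<^sub>L Rm G) (ket k) = (Rm G o\<^sub>L T) (ket k)"
    proof (rule ell2_pair_eqI)
      fix i F
      let ?t = "\<lambda>F. coord (T (ket (j, {||}))) (i, F)"
      have "coord ((T o\<^sub>L Rm G) (ket k)) (i, F) = sg H G * (sg (sd F (sd H G)) (sd H G) * ?t (sd F (sd H G)))"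
        unfolding k by (simp add: Rm_ket Ts assms(2)[of j "sd H G"])
      also have "\<dots> = sg (sd F G) G * (sg (sd (sd F G) H) H * ?t (sd F (sd H G)))"
        by (simp add: sg_sd_left sg_sd_right mult_ac)
      also have "sd F (sd H G) = sd (sd F G) H"
        by (simp add: sd_assoc sd_commute[of H])
      also have "sg (sd F G) G * (sg (sd (sd F G) H) H * ?t (sd (sd F G) H)) = coord ((Rm G o\<^sub>L T) (ket k)) (i, F)"
        unfolding k by (simp add: assms(2)[of j H])
      finally show "coord ((T o\<^sub>L Rm G) (ket k)) (i, F) = coord ((Rm G o\<^sub>L T) (ket k)) (i, F)" .
    qed
  qed
  then show "T (Rm G x) = Rm G (T x)" by (metis blinfun_apply_blinfun_compose)
qed

lemma M_eqI:
  assumes "S \<in> M" "T \<in> M" "\<And>j. S (ket (j, {||})) = T (ket (j, {||}))"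
  shows "S = T"
proof (rule op_ket_eqI)
  show "clin S" "clin T" using M_Bop[OF assms(1)] M_Bop[OF assms(2)] by (simp_all add: Bop_iff)
  fix k :: "'i \<times> 's fset"
  obtain j G where k: "k = (j, G)" by fastforce
  show "S (ket k) = T (ket k)"
    using M_Rm[OF assms(1), of G "ket (j, {||})"] M_Rm[OF assms(2), of G "ket (j, {||})"] assms(3)[of j]
    by (simp add: k Rm_ket_empty)
qed

text \<open>Left and right translations commute because \<open>sg\<close> is multiplicative in both
  arguments.\<close>

lemma Cm_M [simp]: "Cm H \<in> M"
  unfolding M_iff
  by (auto simp: Bop_iff sg_sd_left sg_sd_right sd_assoc sd_commute sd_left_commute mult_ac
      intro!: ell2_pair_eqI)

section \<open>The trace of the Clifford algebra as a sum over vacuum vectors\<close>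

definition Y0 :: "('i \<times> 's fset) set" where
  "Y0 = range (\<lambda>i. (i, {||}))"

lemma infsum_Y0: "infsum f Y0 = (\<Sum>\<^sub>\<infinity>i. f (i, {||}))"
  unfolding Y0_def by (subst infsum_reindex) (auto simp: inj_on_def o_def)

lemma infsum_pair_ennreal:
  fixes f :: "'i \<times> 's fset \<Rightarrow> ennreal"
  shows "infsum f UNIV = (\<Sum>\<^sub>\<infinity>i. \<Sum>\<^sub>\<infinity>F. f (i, F))"
proof -
  have "infsum f UNIV = (\<Sum>\<^sub>\<infinity>z. \<Sum>\<^sub>\<infinity>i. if i = fst z then f z else 0)"
  proof (rule infsum_cong)
    fix z
    show "f z = (\<Sum>\<^sub>\<infinity>i. if i = fst z then f z else 0)"
      by (subst infsum_cong_neutral[where T = "{fst z}" and g = "\<lambda>i. f z"]) auto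
  qed
  also have "\<dots> = (\<Sum>\<^sub>\<infinity>i. \<Sum>\<^sub>\<infinity>z. if i = fst z then f z else 0)"
    by (rule infsum_swap_ennreal)
  also have "\<dots> = (\<Sum>\<^sub>\<infinity>i. \<Sum>\<^sub>\<infinity>F. f (i, F))"
  proof (rule infsum_cong)
    fix i
    have "(\<Sum>\<^sub>\<infinity>z. if i = fst z then f z else 0) = infsum f (range (\<lambda>F. (i, F)))"
      by (rule infsum_cong_neutral) auto
    also have "\<dots> = (\<Sum>\<^sub>\<infinity>F. f (i, F))"
      by (subst infsum_reindex) (auto simp: inj_on_def o_def)
    finally show "(\<Sum>\<^sub>\<infinity>z. if i = fst z then f z else 0) = (\<Sum>\<^sub>\<infinity>F. f (i, F))" .
  qed
  finally show ?thesis .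
qed

sublocale faithful_diag_trace RR Y0
proof
  fix T assume T: "T \<in> M"
  let ?t = "\<lambda>i j F. ennreal ((cmod (coord (T (ket (j, {||}))) (i, F)))\<^sup>2)"
  \<comment> \<open>Up to sign and conjugation, the vacuum columns of the adjoint contain the same
    entries with \<open>i\<close> and \<open>j\<close> exchanged, so the trace property is an
    exchange of two sums.\<close>
  have adj: "cmod (coord (op_adj T (ket (i, {||}))) (j, F)) = cmod (coord (T (ket (j, {||}))) (i, F))" for i j F
    by (simp add: coord_op_adj[OF M_Bop[OF T]] M_ket[OF T, of j F] norm_mult)
  have "(\<Sum>\<^sub>\<infinity>y\<in>Y0. ennreal ((norm (T (ket y)))\<^sup>2)) = (\<Sum>\<^sub>\<infinity>j. \<Sum>\<^sub>\<infinity>i. \<Sum>\<^sub>\<infinity>F. ?t i j F)"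
    by (simp add: infsum_Y0 norm_sq_infsum_ennreal infsum_pair_ennreal)
  also have "\<dots> = (\<Sum>\<^sub>\<infinity>i. \<Sum>\<^sub>\<infinity>j. \<Sum>\<^sub>\<infinity>F. ?t i j F)" by (rule infsum_swap_ennreal)
  also have "\<dots> = (\<Sum>\<^sub>\<infinity>y\<in>Y0. ennreal ((norm (op_adj T (ket y)))\<^sup>2))"
    by (simp add: infsum_Y0 norm_sq_infsum_ennreal infsum_pair_ennreal adj)
  finally show "(\<Sum>\<^sub>\<infinity>y\<in>Y0. ennreal ((norm (T (ket y)))\<^sup>2))
    = (\<Sum>\<^sub>\<infinity>y\<in>Y0. ennreal ((norm (op_adj T (ket y)))\<^sup>2))" .
next
  fix T assume T: "T \<in> M" "\<And>y. y \<in> Y0 \<Longrightarrow> T (ket y) = 0"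
  show "T = 0"
    by (rule M_eqI[OF T(1)]) (use T(2) M_closed in \<open>auto simp: Y0_def\<close>)
next
  fix y assume "y \<in> Y0"
  then obtain i where y: "y = (i, {||})" by (auto simp: Y0_def)
  show "\<exists>p\<in>M. op_adj p = p \<and> (\<forall>z\<in>Y0. p (ket z) = (if z = y then ket y else 0))"
  \<comment> \<open>The diagonal matrix unit at \<open>i\<close>, tensored with the identity of the
    Clifford algebra.\<close>
  proof (intro bexI[of _ "Pr (fst -` {i})"] conjI ballI)
    show "Pr (fst -` {i}) (ket z) = (if z = y then ket y else 0)" if "z \<in> Y0" for z
    proof -
      from that obtain k where z: "z = (k, {||})" by (auto simp: Y0_def)
      show ?thesis by (cases "k = i") (auto simp: z y intro!: ell2_pair_eqI)
    qed
    show "Pr (fst -` {i}) \<in> M" unfolding M_iff by (auto intro!: ell2_pair_eqI)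
  qed simp
qed


section \<open>Clifford vectors\<close>

abbreviation Cv :: "'s \<Rightarrow> ('i \<times> 's fset) op" where "Cv s \<equiv> Cm {|s|}"

lemma Cv_sq: "Cv s (Cv s x) = x"
  by (rule ell2_pair_eqI) (simp add: sg_sd_right sg_single)

lemma Cv_anticomm: "s \<noteq> t \<Longrightarrow> Cv s (Cv t x) = - Cv t (Cv s x)"
  by (rule ell2_pair_eqI)
    (simp add: sg_sd_right sg_single(1) sg_single(2)[of s t] sd_left_commute mult_ac)

lemma cinner_Cv: "cinner (Cv s x) y = cinner x (Cv s y)"
  using cinner_op_adj[of "Cv s" x y] by (simp add: op_adj_Cm sg_single Bop_iff)

text \<open>The mixed products cancel in pairs by anticommutation.\<close>

lemma Cv_sum_sq:
  assumes "finite F"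
  shows "(\<Sum>s\<in>F. v s *\<^sub>R Cv s) ((\<Sum>s\<in>F. v s *\<^sub>R Cv s) x) = (\<Sum>s\<in>F. (v s)\<^sup>2) *\<^sub>R x"
  using assms
proof (induction F)
  case (insert s F)
  let ?X = "\<Sum>s\<in>F. v s *\<^sub>R Cv s"
  have "Cv s (?X x) = - ?X (Cv s x)"
  proof -
    have "Cv s (?X x) = (\<Sum>t\<in>F. v t *\<^sub>R Cv s (Cv t x))"
      by (simp add: blinfun.sum_left blinfun.scaleR_left blinfun.sum_right blinfun.scaleR_right)
    also have "\<dots> = (\<Sum>t\<in>F. - (v t *\<^sub>R Cv t (Cv s x)))"
    proof (intro sum.cong refl)
      fix t assume "t \<in> F"
      then have "s \<noteq> t" using insert.hyps by blast
      then show "v t *\<^sub>R Cv s (Cv t x) = - (v t *\<^sub>R Cv t (Cv s x))"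
        unfolding Cv_anticomm[OF \<open>s \<noteq> t\<close>] by simp
    qed
    finally show ?thesis by (simp add: blinfun.sum_left blinfun.scaleR_left sum_negf)
  qed
  then have "(v s *\<^sub>R Cv s + ?X) ((v s *\<^sub>R Cv s + ?X) x) = (v s)\<^sup>2 *\<^sub>R x + ?X (?X x)"
    by (simp add: blinfun.add_left blinfun.add_right blinfun.scaleR_left blinfun.scaleR_right
        Cv_sq power2_eq_square scaleR_add_right)
  then show ?case using insert by (simp add: scaleR_add_left)
qed simp

text \<open>The operator norm of a real combination of generators is controlled by the Euclidean
  norm of its coefficients. This is why square summability suffices for convergence of
  \<open>cliff v\<close> in norm.\<close>

lemma norm_Cv_sum:
  assumes "finite F"
  shows "norm (\<Sum>s\<in>F. v s *\<^sub>R Cv s) \<le> sqrt (\<Sum>s\<in>F. (v s)\<^sup>2)"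
proof (rule norm_blinfun_bound)
  fix x
  let ?X = "\<Sum>s\<in>F. v s *\<^sub>R Cv s"
  have "cinner (?X y) z = cinner y (?X z)" for y z
    by (simp add: blinfun.sum_left blinfun.scaleR_left cinner_sum_left cinner_sum_right cinner_scaleR_left
        cinner_scaleR_right cinner_Cv)
  then have "cinner (?X x) (?X x) = cinner (?X (?X x)) x" by simp
  also have "\<dots> = of_real ((\<Sum>s\<in>F. (v s)\<^sup>2) * (norm x)\<^sup>2)"
    unfolding Cv_sum_sq[OF assms] by (simp add: cinner_scaleR_left cinner_same scaleR_conv_of_real)
  finally have "(norm (?X x))\<^sup>2 = (\<Sum>s\<in>F. (v s)\<^sup>2) * (norm x)\<^sup>2"
    unfolding cinner_same by (simp only: of_real_eq_iff)
  also have "\<dots> = (sqrt (\<Sum>s\<in>F. (v s)\<^sup>2) * norm x)\<^sup>2"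
    by (simp add: power_mult_distrib sum_nonneg)
  finally have sq: "(norm (?X x))\<^sup>2 = (sqrt (\<Sum>s\<in>F. (v s)\<^sup>2) * norm x)\<^sup>2" .
  show "norm (?X x) \<le> sqrt (\<Sum>s\<in>F. (v s)\<^sup>2) * norm x"
    by (rule power2_le_imp_le[OF eq_refl[OF sq]]) (intro mult_nonneg_nonneg real_sqrt_ge_zero sum_nonneg; simp)
qed (simp add: sum_nonneg)

definition cliff :: "('s \<Rightarrow> real) \<Rightarrow> ('i \<times> 's fset) op" where
  "cliff v = (\<Sum>\<^sub>\<infinity>s. v s *\<^sub>R Cv s)"

lemma cliff_summable:
  assumes v: "(\<lambda>s. (v s)\<^sup>2) summable_on UNIV"
  shows "(\<lambda>s. v s *\<^sub>R Cv s) summable_on UNIV"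
proof -
  let ?S = "\<lambda>F. \<Sum>s\<in>F. v s *\<^sub>R Cv s"
  have "\<exists>P. eventually P (finite_subsets_at_top UNIV) \<and> (\<forall>F G. P F \<and> P G \<longrightarrow> dist (?S F) (?S G) < e)"
    if e: "e > 0" for e
  proof -
    obtain l where "((\<lambda>s. (v s)\<^sup>2) has_sum l) UNIV" using v by (auto simp: summable_on_def)
    \<comment> \<open>Two partial sums within \<open>e\<^sup>2 / 8\<close> of the limit differ by
      less than \<open>(e / 2)\<^sup>2\<close>; the triangle inequality through \<open>H\<close>
      then spends \<open>e / 2\<close> twice.\<close>
    then have "eventually (\<lambda>F. dist (\<Sum>s\<in>F. (v s)\<^sup>2) l < e\<^sup>2 / 8) (finite_subsets_at_top UNIV)"
      unfolding has_sum_def using e by (intro tendstoD) auto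
    then obtain H where H: "finite H" "\<And>F. finite F \<Longrightarrow> H \<subseteq> F \<Longrightarrow> dist (\<Sum>s\<in>F. (v s)\<^sup>2) l < e\<^sup>2 / 8"
      by (auto simp: eventually_finite_subsets_at_top)
    have d: "norm (?S F - ?S H) < e / 2" if F: "finite F" "H \<subseteq> F" for F
    proof -
      have "?S F - ?S H = ?S (F - H)" using F by (subst sum_diff) auto
      moreover have "(\<Sum>s\<in>F - H. (v s)\<^sup>2) = (\<Sum>s\<in>F. (v s)\<^sup>2) - (\<Sum>s\<in>H. (v s)\<^sup>2)"
        using F by (subst sum_diff) auto
      moreover have "\<dots> < (e / 2)\<^sup>2"
      proof -
        have "(\<Sum>s\<in>F. (v s)\<^sup>2) - (\<Sum>s\<in>H. (v s)\<^sup>2) < e\<^sup>2 / 4"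
          using H(2)[OF F] H(2)[OF H(1) order_refl] unfolding dist_real_def by linarith
        then show ?thesis by (simp add: power_divide)
      qed
      ultimately have "norm (?S F - ?S H) < sqrt ((e / 2)\<^sup>2)"
        using norm_Cv_sum[of "F - H" v] F(1) real_sqrt_less_mono[of "\<Sum>s\<in>F - H. (v s)\<^sup>2" "(e / 2)\<^sup>2"] by auto
      then show ?thesis using e by simp
    qed
    show ?thesis
    proof (intro exI[of _ "\<lambda>F. finite F \<and> H \<subseteq> F"] conjI allI impI)
      show "eventually (\<lambda>F. finite F \<and> H \<subseteq> F) (finite_subsets_at_top UNIV)"
        using H(1) by (auto simp: eventually_finite_subsets_at_top)
      fix F G assume "(finite F \<and> H \<subseteq> F) \<and> (finite G \<and> H \<subseteq> G)"
      then show "dist (?S F) (?S G) < e"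
        using dist_triangle_half_l[of "?S F" "?S H" e "?S G"] d by (simp add: dist_norm)
    qed
  qed
  then have "cauchy_filter (filtermap ?S (finite_subsets_at_top UNIV))"
    by (simp add: cauchy_filter_metric_filtermap)
  moreover have "complete (UNIV :: ('i \<times> 's fset) op set)"
    by (meson Cauchy_convergent UNIV_I complete_def convergent_def)
  ultimately obtain L where "(?S \<longlongrightarrow> L) (finite_subsets_at_top UNIV)"
    using complete_uniform[where S = "UNIV :: ('i \<times> 's fset) op set"] by (force simp: filterlim_def)
  then show ?thesis using summable_on_def has_sum_def by blast
qed

lemma cliff_lim:
  assumes v: "(\<lambda>s. (v s)\<^sup>2) summable_on UNIV"
  shows "((\<lambda>F. \<Sum>s\<in>F. v s *\<^sub>R Cv s x) \<longlongrightarrow> cliff v x) (finite_subsets_at_top UNIV)"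
proof -
  have "((\<lambda>F. \<Sum>s\<in>F. v s *\<^sub>R Cv s) \<longlongrightarrow> cliff v) (finite_subsets_at_top UNIV)"
    using has_sum_infsum[OF cliff_summable[OF v]] by (simp add: has_sum_def cliff_def)
  from blinfun.tendsto[OF this tendsto_const[of x]] show ?thesis
    by (simp add: blinfun.sum_left blinfun.scaleR_left)
qed

lemma cliff_lim_unique:
  assumes "(\<lambda>s. (v s)\<^sup>2) summable_on UNIV"
    "((\<lambda>F. \<Sum>s\<in>F. v s *\<^sub>R Cv s x) \<longlongrightarrow> y) (finite_subsets_at_top UNIV)"
  shows "cliff v x = y"
  using tendsto_unique[OF finite_subsets_at_top_neq_bot cliff_lim[OF assms(1)] assms(2)] .

text \<open>Commutation is asked only for generators with nonzero coefficient, so that vectors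
  placed in different slots can be treated separately.\<close>

lemma cliff_commute:
  assumes v: "(\<lambda>s. (v s)\<^sup>2) summable_on UNIV"
    and "\<And>s x. v s \<noteq> 0 \<Longrightarrow> blinfun_apply B (Cv s x) = Cv s (blinfun_apply B x)"
  shows "blinfun_apply B (cliff v x) = cliff v (blinfun_apply B x)"
proof (rule cliff_lim_unique[symmetric, OF v])
  have "((\<lambda>F. B (\<Sum>s\<in>F. v s *\<^sub>R Cv s x)) \<longlongrightarrow> B (cliff v x)) (finite_subsets_at_top UNIV)"
    by (intro blinfun.tendsto tendsto_const cliff_lim v)
  moreover have "v s *\<^sub>R B (Cv s x) = v s *\<^sub>R Cv s (B x)" for s
    using assms(2)[of s] by (cases "v s = 0") auto
  ultimately show "((\<lambda>F. \<Sum>s\<in>F. v s *\<^sub>R Cv s (B x)) \<longlongrightarrow> B (cliff v x)) (finite_subsets_at_top UNIV)"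
    by (simp add: blinfun.sum_right blinfun.scaleR_right)
qed

lemma cliff_anticommute:
  assumes v: "(\<lambda>s. (v s)\<^sup>2) summable_on UNIV"
    and "\<And>s x. v s \<noteq> 0 \<Longrightarrow> blinfun_apply B (Cv s x) = - Cv s (blinfun_apply B x)"
  shows "blinfun_apply B (cliff v x) = - cliff v (blinfun_apply B x)"
proof -
  have "cliff v (B x) = - B (cliff v x)"
  proof (rule cliff_lim_unique[OF v])
    have "((\<lambda>F. - B (\<Sum>s\<in>F. v s *\<^sub>R Cv s x)) \<longlongrightarrow> - B (cliff v x)) (finite_subsets_at_top UNIV)"
      by (intro tendsto_minus blinfun.tendsto tendsto_const cliff_lim v)
    moreover have "- (v s *\<^sub>R B (Cv s x)) = v s *\<^sub>R Cv s (B x)" for s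
      using assms(2)[of s] by (cases "v s = 0") auto
    ultimately show "((\<lambda>F. \<Sum>s\<in>F. v s *\<^sub>R Cv s (B x)) \<longlongrightarrow> - B (cliff v x)) (finite_subsets_at_top UNIV)"
      by (simp add: blinfun.sum_right blinfun.scaleR_right flip: sum_negf)
  qed
  then show ?thesis by simp
qed

lemma clin_cliff:
  assumes v: "(\<lambda>s. (v s)\<^sup>2) summable_on UNIV"
  shows "clin (cliff v)"
  unfolding clin_def
proof (intro allI cliff_lim_unique[OF v])
  fix c x
  have "((\<lambda>F. ell2_scale c (\<Sum>s\<in>F. v s *\<^sub>R Cv s x)) \<longlongrightarrow> ell2_scale c (cliff v x)) (finite_subsets_at_top UNIV)"
    by (intro tendsto_intros cliff_lim v)
  moreover have "ell2_scale c (\<Sum>s\<in>F. v s *\<^sub>R Cv s x) = (\<Sum>s\<in>F. v s *\<^sub>R Cv s (ell2_scale c x))" for F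
    by (rule ell2_pair_eqI) (simp add: sum_distrib_left mult_ac)
  ultimately show "((\<lambda>F. \<Sum>s\<in>F. v s *\<^sub>R Cv s (ell2_scale c x)) \<longlongrightarrow> ell2_scale c (cliff v x)) (finite_subsets_at_top UNIV)"
    by simp
qed

lemma cliff_M: "(\<lambda>s. (v s)\<^sup>2) summable_on UNIV \<Longrightarrow> cliff v \<in> M"
  unfolding M_iff by (auto simp: Bop_iff clin_cliff cliff_commute M_Rm[OF Cm_M])

lemma cinner_cliff:
  assumes v: "(\<lambda>s. (v s)\<^sup>2) summable_on UNIV"
  shows "cinner (cliff v x) y = cinner x (cliff v y)"
proof (rule tendsto_unique[OF finite_subsets_at_top_neq_bot])
  show "((\<lambda>F. cinner (\<Sum>s\<in>F. v s *\<^sub>R Cv s x) y) \<longlongrightarrow> cinner (cliff v x) y) (finite_subsets_at_top UNIV)"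
    by (intro tendsto_intros cliff_lim v)
  have "((\<lambda>F. cinner x (\<Sum>s\<in>F. v s *\<^sub>R Cv s y)) \<longlongrightarrow> cinner x (cliff v y)) (finite_subsets_at_top UNIV)"
    by (intro tendsto_intros cliff_lim v)
  then show "((\<lambda>F. cinner (\<Sum>s\<in>F. v s *\<^sub>R Cv s x) y) \<longlongrightarrow> cinner x (cliff v y)) (finite_subsets_at_top UNIV)"
    by (simp add: cinner_sum_left cinner_sum_right cinner_scaleR_left cinner_scaleR_right cinner_Cv)
qed

lemma cliff_sq:
  assumes v: "((\<lambda>s. (v s)\<^sup>2) has_sum 1) UNIV"
  shows "cliff v (cliff v x) = x"
proof (rule tendsto_unique[OF finite_subsets_at_top_neq_bot])
  have s: "(\<lambda>s. (v s)\<^sup>2) summable_on UNIV" using v by (rule has_sum_imp_summable)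
  have lim: "((\<lambda>F. \<Sum>s\<in>F. v s *\<^sub>R Cv s) \<longlongrightarrow> cliff v) (finite_subsets_at_top UNIV)"
    using has_sum_infsum[OF cliff_summable[OF s]] by (simp add: has_sum_def cliff_def)
  show "((\<lambda>F. (\<Sum>s\<in>F. v s *\<^sub>R Cv s) ((\<Sum>s\<in>F. v s *\<^sub>R Cv s) x)) \<longlongrightarrow> cliff v (cliff v x)) (finite_subsets_at_top UNIV)"
    by (intro blinfun.tendsto lim tendsto_const)
  have "((\<lambda>F. (\<Sum>s\<in>F. (v s)\<^sup>2) *\<^sub>R x) \<longlongrightarrow> 1 *\<^sub>R x) (finite_subsets_at_top UNIV)"
    using v unfolding has_sum_def by (intro tendsto_intros)
  moreover have "eventually (\<lambda>F. (\<Sum>s\<in>F. (v s)\<^sup>2) *\<^sub>R x = (\<Sum>s\<in>F. v s *\<^sub>R Cv s) ((\<Sum>s\<in>F. v s *\<^sub>R Cv s) x))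
      (finite_subsets_at_top UNIV)"
    by (rule eventually_finite_subsets_at_top_weakI) (simp add: Cv_sum_sq)
  ultimately show "((\<lambda>F. (\<Sum>s\<in>F. v s *\<^sub>R Cv s) ((\<Sum>s\<in>F. v s *\<^sub>R Cv s) x)) \<longlongrightarrow> x) (finite_subsets_at_top UNIV)"
    by (simp add: Lim_transform_eventually)
qed

section \<open>Fibrewise Clifford multiplication\<close>

abbreviation Pi :: "'i \<Rightarrow> ('i \<times> 's fset) op" where "Pi i \<equiv> Pr (fst -` {i})"

text \<open>Operators that are block diagonal over the matrix index; on the fibre over
  \<open>i\<close> they see only the part of the vector in that fibre.\<close>

definition fibred :: "('i \<times> 's fset) op \<Rightarrow> bool" where
  "fibred B \<longleftrightarrow> (\<forall>i x. B (Pi i x) = Pi i (B x))"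

lemma fibred_coord:
  assumes "fibred B" "Pi i x = Pi i y"
  shows "coord (B x) (i, F) = coord (B y) (i, F)"
proof -
  have "coord (B z) (i, F) = coord (B (Pi i z)) (i, F)" for z
    using assms(1) by (simp add: fibred_def)
  then show ?thesis using assms(2) by metis
qed

lemma fibred_Cm: "fibred (Cm H)"
  unfolding fibred_def by (auto intro!: ell2_pair_eqI)

lemma fibred_cliff: "(\<lambda>s. (v s)\<^sup>2) summable_on UNIV \<Longrightarrow> fibred (cliff v)"
  using fibred_Cm unfolding fibred_def by (simp add: cliff_commute)

definition unit_field :: "('i \<Rightarrow> 's \<Rightarrow> real) \<Rightarrow> bool" where
  "unit_field u \<longleftrightarrow> (\<forall>i. ((\<lambda>s. (u i s)\<^sup>2) has_sum 1) UNIV)"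

lemma unit_field_summable: "unit_field u \<Longrightarrow> (\<lambda>s. (u i s)\<^sup>2) summable_on UNIV"
  unfolding unit_field_def by (blast intro: has_sum_imp_summable)

text \<open>The diagonal of Clifford vectors from the overview; by \<open>Dm_sq\<close> and
  \<open>op_adj_Dm\<close> it is a self-adjoint unitary.\<close>

definition Dm :: "('i \<Rightarrow> 's \<Rightarrow> real) \<Rightarrow> ('i \<times> 's fset) op" where
  "Dm u = dsum fst (\<lambda>i. cliff (u i))"

lemma norm_cliff_unit:
  assumes u: "unit_field u"
  shows "norm (cliff (u i)) \<le> 1"
proof (rule norm_blinfun_bound)
  fix x
  have "((\<lambda>s. (u i s)\<^sup>2) has_sum 1) UNIV" using u by (simp add: unit_field_def)
  then have "cinner (cliff (u i) x) (cliff (u i) x) = cinner x x"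
    using cinner_cliff[OF unit_field_summable[OF u, of i]] cliff_sq by simp
  then have "(norm (cliff (u i) x))\<^sup>2 = (norm x)\<^sup>2"
    unfolding cinner_same by (simp only: of_real_eq_iff)
  then show "norm (cliff (u i) x) \<le> 1 * norm x" by simp
qed simp

context
  fixes u :: "'i \<Rightarrow> 's \<Rightarrow> real"
  assumes u: "unit_field u"
begin

lemma coord_Dm: "coord (Dm u x) (i, F) = coord (cliff (u i) x) (i, F)"
proof -
  have "coord (Dm u x) (i, F) = coord (cliff (u i) (Pi i x)) (i, F)"
    unfolding Dm_def
    by (subst coord_dsum[where K = 1]) (auto simp: clin_cliff unit_field_summable[OF u] norm_cliff_unit[OF u])
  also have "\<dots> = coord (cliff (u i) x) (i, F)"
    by (rule fibred_coord[OF fibred_cliff[OF unit_field_summable[OF u]]]) (auto intro!: ell2_pair_eqI)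
  finally show ?thesis .
qed

lemma Pi_Dm: "Pi i (Dm u x) = Pi i (cliff (u i) x)"
  by (rule ell2_pair_eqI) (auto simp: coord_Dm)

lemma Dm_Bop: "Dm u \<in> Bop"
  unfolding Dm_def Bop_iff
  by (rule clin_dsum[where K = 1]) (auto simp: clin_cliff unit_field_summable[OF u] norm_cliff_unit[OF u])

lemma fibred_Dm: "fibred (Dm u)"
  unfolding fibred_def
proof (intro allI ell2_pair_eqI)
  fix i j x F
  show "coord (Dm u (Pi i x)) (j, F) = coord (Pi i (Dm u x)) (j, F)"
    using fibred_cliff[OF unit_field_summable[OF u, of j]] by (simp add: coord_Dm fibred_def)
qed

lemma Dm_sq: "Dm u (Dm u x) = x"
proof (rule ell2_pair_eqI)
  fix i F
  have h: "((\<lambda>s. (u i s)\<^sup>2) has_sum 1) UNIV" using u by (simp add: unit_field_def)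
  have "coord (Dm u (Dm u x)) (i, F) = coord (cliff (u i) (Dm u x)) (i, F)" by (rule coord_Dm)
  also have "\<dots> = coord (cliff (u i) (cliff (u i) x)) (i, F)"
    by (rule fibred_coord[OF fibred_cliff[OF unit_field_summable[OF u]] Pi_Dm])
  finally show "coord (Dm u (Dm u x)) (i, F) = coord x (i, F)" unfolding cliff_sq[OF h] .
qed

lemma op_adj_Dm: "op_adj (Dm u) = Dm u"
proof (rule op_entry_eqI)
  fix a b :: "'i \<times> 's fset"
  obtain i F j G where ab: "a = (i, F)" "b = (j, G)" by fastforce
  show "coord (op_adj (Dm u) (ket b)) a = coord (Dm u (ket b)) a"
  proof (cases "i = j")
    case True
    have "coord (cliff (u i) (ket b)) a = cnj (coord (cliff (u i) (ket a)) b)"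
      using cinner_cliff[OF unit_field_summable[OF u, of i], of "ket b" "ket a"]
      by (simp add: cinner_ket_left cinner_ket_right)
    then show ?thesis using True by (simp add: ab coord_op_adj[OF Dm_Bop] coord_Dm)
  next
    case False
    have 0: "coord (Dm u (ket (k, H))) (l, L) = 0" if "k \<noteq> l" for k H l L
    proof -
      have "coord (Dm u (ket (k, H))) (l, L) = coord (Dm u 0) (l, L)"
        by (rule fibred_coord[OF fibred_Dm]) (use that in \<open>auto intro!: ell2_pair_eqI\<close>)
      then show ?thesis by simp
    qed
    show ?thesis using False 0[of i j] 0[of j i] by (simp add: ab coord_op_adj[OF Dm_Bop])
  qed
qed (use Dm_Bop in auto)

lemma Dm_M: "Dm u \<in> M"
  unfolding M_iff
proof (intro conjI Dm_Bop allI ell2_pair_eqI)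
  fix G x i F
  show "coord (Dm u (Rm G x)) (i, F) = coord (Rm G (Dm u x)) (i, F)"
    using M_Rm[OF cliff_M[OF unit_field_summable[OF u, of i]]] by (simp add: coord_Dm)
qed

lemma Dm_anticommute_Cv:
  assumes s: "\<And>i. u i s = 0"
  shows "Cv s (Dm u x) = - Dm u (Cv s x)"
proof (rule ell2_pair_eqI)
  fix i F
  have "coord (Cv s (Dm u x)) (i, F) = coord (Cv s (cliff (u i) x)) (i, F)"
    by (rule fibred_coord[OF fibred_Cm Pi_Dm])
  also have "Cv s (cliff (u i) x) = - cliff (u i) (Cv s x)"
    by (rule cliff_anticommute[OF unit_field_summable[OF u]])
      (metis Cv_anticomm s)
  finally show "coord (Cv s (Dm u x)) (i, F) = coord (- Dm u (Cv s x)) (i, F)"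
    by (simp add: coord_Dm)
qed

lemma Dm_anticommute:
  assumes w: "unit_field w" and disj: "\<And>i j s. u i s = 0 \<or> w j s = 0"
  shows "Dm u (Dm w x) = - Dm w (Dm u x)"
proof (rule ell2_pair_eqI)
  fix i F
  have su: "(\<lambda>s. (u i s)\<^sup>2) summable_on UNIV" by (rule unit_field_summable[OF u])
  have sw: "(\<lambda>s. (w i s)\<^sup>2) summable_on UNIV" by (rule unit_field_summable[OF w])
  \<comment> \<open>Anticommutation passes to sums in two stages: first one generator against
    \<open>cliff (u i)\<close>, then the sum over the generators of \<open>w\<close>.\<close>
  have anti: "cliff (u i) (cliff (w i) x) = - cliff (w i) (cliff (u i) x)"
  proof (rule cliff_anticommute[OF sw])
    fix s x assume "w i s \<noteq> 0"
    then have us: "u i s = 0" using disj[of i s i] by blast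
    have "Cv s (cliff (u i) x) = - cliff (u i) (Cv s x)"
      by (rule cliff_anticommute[OF su]) (metis Cv_anticomm us)
    then show "cliff (u i) (Cv s x) = - Cv s (cliff (u i) x)" by simp
  qed
  have Piw: "Pi i (Dm w x) = Pi i (cliff (w i) x)"
  proof (rule ell2_pair_eqI)
    fix j G
    show "coord (Pi i (Dm w x)) (j, G) = coord (Pi i (cliff (w i) x)) (j, G)"
      by (simp add: clifford.coord_Dm[OF clifford_axioms w])
  qed
  have "coord (Dm u (Dm w x)) (i, F) = coord (cliff (u i) (Dm w x)) (i, F)" by (rule coord_Dm)
  also have "\<dots> = coord (cliff (u i) (cliff (w i) x)) (i, F)"
    by (rule fibred_coord[OF fibred_cliff[OF su] Piw])
  also have "\<dots> = - coord (cliff (w i) (cliff (u i) x)) (i, F)" by (simp add: anti)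
  also have "coord (cliff (w i) (cliff (u i) x)) (i, F) = coord (cliff (w i) (Dm u x)) (i, F)"
    by (rule fibred_coord[OF fibred_cliff[OF sw] Pi_Dm[symmetric]])
  also have "\<dots> = coord (Dm w (Dm u x)) (i, F)"
    by (rule clifford.coord_Dm[OF clifford_axioms w, symmetric])
  finally show "coord (Dm u (Dm w x)) (i, F) = coord (- Dm w (Dm u x)) (i, F)" by simp
qed

lemma Dm_commute:
  assumes B: "fibred B" and c: "\<And>i s x. u i s \<noteq> 0 \<Longrightarrow> blinfun_apply B (Cv s x) = Cv s (blinfun_apply B x)"
  shows "blinfun_apply B (Dm u x) = Dm u (blinfun_apply B x)"
proof (rule ell2_pair_eqI)
  fix i F
  have "coord (B (Dm u x)) (i, F) = coord (B (cliff (u i) x)) (i, F)"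
    by (rule fibred_coord[OF B Pi_Dm])
  also have "B (cliff (u i) x) = cliff (u i) (B x)"
    by (rule cliff_commute[OF unit_field_summable[OF u]]) (rule c)
  finally show "coord (B (Dm u x)) (i, F) = coord (Dm u (B x)) (i, F)" by (simp add: coord_Dm)
qed

lemma Dm_ket: "Dm u (ket (j, F)) = cliff (u j) (ket (j, F))"
proof (rule ell2_pair_eqI)
  fix i G
  have "coord (B (ket (j, F))) (i, G) = 0" if "fibred B" "i \<noteq> j" for B
  proof -
    have "coord (B (ket (j, F))) (i, G) = coord (B 0) (i, G)"
      by (rule fibred_coord[OF that(1)]) (use that in \<open>auto intro!: ell2_pair_eqI\<close>)
    then show ?thesis by simp
  qed
  then show "coord (Dm u (ket (j, F))) (i, G) = coord (cliff (u j) (ket (j, F))) (i, G)"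
    using fibred_Dm fibred_cliff[OF unit_field_summable[OF u]] by (cases "i = j") (auto simp: coord_Dm)
qed

end


section \<open>Permutations of the generators\<close>

text \<open>The second quantisation of a permutation of the generators. The inverse appears because
  \<open>mon\<close> reads inputs; basis sets are moved by \<open>g\<close> itself.\<close>

definition Wm :: "('s \<Rightarrow> 's) \<Rightarrow> ('i \<times> 's fset) op" where
  "Wm g = mon (\<lambda>(i, F). (i, inv g |`| F)) (\<lambda>_. 1)"

text \<open>Preserving \<open>lt\<close> leaves \<open>sg\<close> invariant, so \<open>Wm g\<close>
  carries generators to generators without signs.\<close>

definition order_aut :: "('s \<Rightarrow> 's) \<Rightarrow> bool" where
  "order_aut g \<longleftrightarrow> bij g \<and> (\<forall>a b. lt (g a) (g b) \<longleftrightarrow> lt a b)"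

lemma order_aut_inv:
  assumes "order_aut g"
  shows "order_aut (inv g)"
proof -
  have "lt (inv g a) (inv g b) \<longleftrightarrow> lt (g (inv g a)) (g (inv g b))" for a b
    using assms by (simp add: order_aut_def)
  moreover have "g (inv g a) = a" for a
    using assms unfolding order_aut_def by (metis bij_inv_eq_iff)
  ultimately show ?thesis using assms by (simp add: order_aut_def bij_imp_bij_inv)
qed

context
  fixes g :: "'s \<Rightarrow> 's"
  assumes g: "order_aut g"
begin

lemma aut_inj: "inj g" "inj (inv g)"
  using g bij_imp_bij_inv[of g] by (auto simp: order_aut_def bij_is_inj)

lemma aut_cancel [simp]: "g (inv g a) = a" "inv g (g a) = a"
  using g by (auto simp: order_aut_def bij_is_inj bij_is_surj surj_f_inv_f inv_f_f)

lemma aut_comp_cancel [simp]: "g \<circ> inv g = id" "inv g \<circ> g = id"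
  by (simp_all add: fun_eq_iff)

lemma aut_fimage_cancel [simp]: "g |`| inv g |`| F = F" "inv g |`| g |`| F = F"
  by (simp_all add: fset.map_comp)

lemma inv_aut_inv: "inv (inv g) = g"
  using g by (simp add: order_aut_def inv_inv_eq)

lemma coord_Wm: "coord (Wm g x) (i, F) = coord x (i, inv g |`| F)"
  and clin_Wm: "clin (Wm g)"
proof -
  have inj: "inj_on (\<lambda>(i::'i, F). (i, inv g |`| F)) A" for A
  proof (rule inj_onI, clarsimp)
    fix F G assume "inv g |`| F = inv g |`| G"
    then show "F = G" using aut_fimage_cancel(1) by metis
  qed
  show "coord (Wm g x) (i, F) = coord x (i, inv g |`| F)"
    unfolding Wm_def by (subst coord_mon[OF inj]) auto
  show "clin (Wm g)" unfolding Wm_def by (rule clin_mon[OF inj]) auto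
qed

lemma Wm_Bop: "Wm g \<in> Bop"
  by (simp add: Bop_iff clin_Wm)

lemma Wm_ket: "Wm g (ket (j, F)) = ket (j, g |`| F)"
proof (rule ell2_pair_eqI)
  fix i G
  have "inv g |`| G = F \<longleftrightarrow> G = g |`| F" using aut_fimage_cancel by metis
  then show "coord (Wm g (ket (j, F))) (i, G) = coord (ket (j, g |`| F)) (i, G)"
    by (simp add: coord_Wm)
qed

lemma fibred_Wm: "fibred (Wm g)"
  unfolding fibred_def by (auto intro!: ell2_pair_eqI simp: coord_Wm)

lemma Wm_Rm: "Wm g (Rm G x) = Rm (g |`| G) (Wm g x)"
proof (rule ell2_pair_eqI)
  fix i F
  have 1: "inv g |`| sd F (g |`| G) = sd (inv g |`| F) G"
    using sd_fimage[OF aut_inj(2), of F "g |`| G"] by simp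
  have "sg (sd F (g |`| G)) (g |`| G) = sg (g |`| sd (inv g |`| F) G) (g |`| G)"
    by (simp flip: sd_fimage[OF aut_inj(1)])
  also have "\<dots> = sg (sd (inv g |`| F) G) G"
    using g by (intro sg_fimage aut_inj) (auto simp: order_aut_def)
  finally show "coord (Wm g (Rm G x)) (i, F) = coord (Rm (g |`| G) (Wm g x)) (i, F)"
    by (simp add: coord_Wm 1)
qed

lemma Wm_Cv: "Wm g (Cv s x) = Cv (g s) (Wm g x)"
proof (rule ell2_pair_eqI)
  fix i F
  have 1: "inv g |`| sd {|g s|} F = sd {|s|} (inv g |`| F)"
    using sd_fimage[OF aut_inj(2), of "{|g s|}" F] by simp
  have "sg {|g s|} (sd {|g s|} F) = sg (g |`| {|s|}) (g |`| sd {|s|} (inv g |`| F))"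
    using sd_fimage[OF aut_inj(1), of "{|s|}" "inv g |`| F"] by simp
  also have "\<dots> = sg {|s|} (sd {|s|} (inv g |`| F))"
    using g by (intro sg_fimage aut_inj) (auto simp: order_aut_def)
  finally show "coord (Wm g (Cv s x)) (i, F) = coord (Cv (g s) (Wm g x)) (i, F)"
    by (simp add: coord_Wm 1)
qed

end

lemma Wm_inverse:
  assumes g: "order_aut g"
  shows "Wm g (Wm (inv g) x) = x" "Wm (inv g) (Wm g x) = x"
  by (rule ell2_pair_eqI, simp add: coord_Wm[OF g] coord_Wm[OF order_aut_inv[OF g]] inv_aut_inv[OF g]
      fset.map_comp aut_comp_cancel[OF g])+

lemma op_adj_Wm:
  assumes g: "order_aut g"
  shows "op_adj (Wm g) = Wm (inv g)"
proof (rule op_entry_eqI)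
  fix a b :: "'i \<times> 's fset"
  obtain i F j G where ab: "a = (i, F)" "b = (j, G)" by fastforce
  have "inv g |`| G = F \<longleftrightarrow> g |`| F = G" using aut_fimage_cancel[OF g] by metis
  then show "coord (op_adj (Wm g) (ket b)) a = coord (Wm (inv g) (ket b)) a"
    by (auto simp: ab coord_op_adj[OF Wm_Bop[OF g]] coord_Wm[OF g] coord_Wm[OF order_aut_inv[OF g]] inv_aut_inv[OF g])
qed (use Wm_Bop[OF g] Wm_Bop[OF order_aut_inv[OF g]] in auto)

lemma Wm_comp:
  assumes "order_aut g" "order_aut h" "\<And>a. g (h a) = h (g a)"
  shows "Wm g (Wm h x) = Wm h (Wm g x)"
proof -
  have "Wm g o\<^sub>L Wm h = Wm h o\<^sub>L Wm g"
  proof (rule op_ket_eqI)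
    fix k :: "'i \<times> 's fset"
    obtain j F where k: "k = (j, F)" by fastforce
    show "(Wm g o\<^sub>L Wm h) (ket k) = (Wm h o\<^sub>L Wm g) (ket k)"
      by (simp add: k Wm_ket assms fset.map_comp o_def)
  qed (auto intro!: clin_comp clin_Wm assms)
  then show ?thesis by (metis blinfun_apply_blinfun_compose)
qed


section \<open>The dilating automorphisms\<close>

definition Um :: "('s \<Rightarrow> 's) \<Rightarrow> ('i \<Rightarrow> 's \<Rightarrow> real) \<Rightarrow> ('i \<times> 's fset) op \<Rightarrow> ('i \<times> 's fset) op" where
  "Um g u T = (Wm g o\<^sub>L Dm u) o\<^sub>L T o\<^sub>L (Dm u o\<^sub>L Wm (inv g))"

lemma Um_apply: "Um g u T x = Wm g (Dm u (T (Dm u (Wm (inv g) x))))"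
  by (simp add: Um_def)

lemma Wm_conj_M:
  assumes g: "order_aut g" and T: "T \<in> M"
  shows "Wm g o\<^sub>L T o\<^sub>L Wm (inv g) \<in> M"
  unfolding M_iff
proof (intro conjI allI)
  show "Wm g o\<^sub>L T o\<^sub>L Wm (inv g) \<in> Bop"
    using Wm_Bop[OF g] Wm_Bop[OF order_aut_inv[OF g]] M_Bop[OF T] by simp
  fix G x
  have "Wm (inv g) (Rm G x) = Rm (inv g |`| G) (Wm (inv g) x)" by (rule Wm_Rm[OF order_aut_inv[OF g]])
  then show "(Wm g o\<^sub>L T o\<^sub>L Wm (inv g)) (Rm G x) = Rm G ((Wm g o\<^sub>L T o\<^sub>L Wm (inv g)) x)"
    by (simp add: M_Rm[OF T] Wm_Rm[OF g] fset.map_comp aut_comp_cancel[OF g])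
qed

lemma star_automorphism_conj:
  assumes B: "B \<in> Bop" "\<And>x. blinfun_apply B (op_adj B x) = x" "\<And>x. op_adj B (blinfun_apply B x) = x"
    and M: "\<And>T. T \<in> M \<Longrightarrow> B o\<^sub>L T o\<^sub>L op_adj B \<in> M" "\<And>T. T \<in> M \<Longrightarrow> op_adj B o\<^sub>L T o\<^sub>L B \<in> M"
  shows "star_automorphism M (\<lambda>T. B o\<^sub>L T o\<^sub>L op_adj B)"
proof -
  have lin: "B (ell2_scale c x) = ell2_scale c (B x)" for c x using B(1) by (simp add: Bop_iff clinD)
  have "star_hom M M (\<lambda>T. B o\<^sub>L T o\<^sub>L op_adj B)"
    unfolding star_hom_def op_linear_on_def using M B
    by (auto intro!: blinfun_eqI simp: blinfun.add_left blinfun.add_right lin op_adj_comp M_Bop)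
  moreover have "bij_betw (\<lambda>T. B o\<^sub>L T o\<^sub>L op_adj B) M M"
    by (rule bij_betw_byWitness[where f' = "\<lambda>T. op_adj B o\<^sub>L T o\<^sub>L B"])
      (use M B in \<open>auto intro!: blinfun_eqI\<close>)
  ultimately show ?thesis by (simp add: star_automorphism_def)
qed

context
  fixes g u
  assumes g: "order_aut g" and u: "unit_field u"
begin

lemma op_adj_WD: "op_adj (Wm g o\<^sub>L Dm u) = Dm u o\<^sub>L Wm (inv g)"
  by (simp add: op_adj_comp Wm_Bop[OF g] Dm_Bop[OF u] op_adj_Wm[OF g] op_adj_Dm[OF u])

lemma Um_M:
  assumes T: "T \<in> M"
  shows "Um g u T \<in> M"
proof -
  have "Wm g o\<^sub>L (Dm u o\<^sub>L T o\<^sub>L Dm u) o\<^sub>L Wm (inv g) \<in> M"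
    by (intro Wm_conj_M g M_closed Dm_M u T)
  also have "Wm g o\<^sub>L (Dm u o\<^sub>L T o\<^sub>L Dm u) o\<^sub>L Wm (inv g) = Um g u T"
    by (simp add: Um_def blinfun_compose_assoc)
  finally show ?thesis .
qed

lemma Um_automorphism: "star_automorphism M (Um g u)"
proof -
  have "star_automorphism M (\<lambda>T. (Wm g o\<^sub>L Dm u) o\<^sub>L T o\<^sub>L op_adj (Wm g o\<^sub>L Dm u))"
  proof (rule star_automorphism_conj)
    show "Wm g o\<^sub>L Dm u \<in> Bop" using Wm_Bop[OF g] Dm_Bop[OF u] by simp
    show "(Wm g o\<^sub>L Dm u) (op_adj (Wm g o\<^sub>L Dm u) x) = x" "op_adj (Wm g o\<^sub>L Dm u) ((Wm g o\<^sub>L Dm u) x) = x" for x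
      by (simp_all add: op_adj_WD Dm_sq[OF u] Wm_inverse[OF g])
    fix T assume T: "T \<in> M"
    show "(Wm g o\<^sub>L Dm u) o\<^sub>L T o\<^sub>L op_adj (Wm g o\<^sub>L Dm u) \<in> M"
      using Um_M[OF T] by (simp add: Um_def op_adj_WD)
    have "Wm (inv g) o\<^sub>L T o\<^sub>L Wm (inv (inv g)) \<in> M"
      by (rule Wm_conj_M[OF order_aut_inv[OF g] T])
    then have "Dm u o\<^sub>L (Wm (inv g) o\<^sub>L T o\<^sub>L Wm g) o\<^sub>L Dm u \<in> M"
      unfolding inv_aut_inv[OF g] using M_closed(5)[OF M_closed(5)] Dm_M[OF u] by blast
    then show "op_adj (Wm g o\<^sub>L Dm u) o\<^sub>L T o\<^sub>L (Wm g o\<^sub>L Dm u) \<in> M"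
      by (simp add: op_adj_WD blinfun_compose_assoc)
  qed
  then show ?thesis by (simp add: op_adj_WD Um_def[abs_def])
qed

lemma Um_unital: "unital (Um g u)"
  unfolding unital_def by (rule blinfun_eqI) (simp add: Um_apply Dm_sq[OF u] Wm_inverse[OF g])

lemma Wm_inv_ket_empty: "Wm (inv g) (ket (i, {||})) = ket (i, {||})"
  by (simp add: Wm_ket[OF order_aut_inv[OF g]])

text \<open>Permutations fix the vacuum vectors, so a vacuum entry sees the diagonal but not the
  shift.\<close>

lemma Um_vacuum_entry:
  "cinner (Um g u T (ket (j, {||}))) (ket (i, {||})) = cinner (T (Dm u (ket (j, {||})))) (Dm u (ket (i, {||})))"
  using cinner_op_adj[OF Wm_Bop[OF g]] cinner_op_adj[OF Dm_Bop[OF u]]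
  by (simp add: Um_apply op_adj_Wm[OF g] op_adj_Dm[OF u] Wm_inv_ket_empty)

text \<open>Writing \<open>T\<close> as the square of \<open>h\<close>, the conjugate by
  \<open>Dm u\<close> and \<open>T\<close> itself are the two orders of a product of
  \<open>Dm u o\<^sub>L h\<close> with its adjoint, so the trace property applies.\<close>

lemma Um_trace: "trace_preserving M \<tau> \<tau> (Um g u)"
  unfolding trace_preserving_def
proof
  fix T assume "T \<in> pos_part M"
  then have T: "T \<in> M" "op_positive T" by (auto simp: pos_part_def)
  obtain h where h: "h \<in> M" "op_positive h" "h o\<^sub>L h = T" using M_sqrt[OF T] by blast
  have ha: "op_adj h = h" by (rule op_positive_adj[OF h(2)])
  let ?w = "Dm u o\<^sub>L h"
  have w: "?w \<in> M" by (intro M_closed Dm_M u h)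
  have wa: "op_adj ?w = h o\<^sub>L Dm u"
    by (simp add: op_adj_comp Dm_Bop[OF u] M_Bop[OF h(1)] ha op_adj_Dm[OF u])
  have hh: "h (h x) = T x" for x using h(3) by (metis blinfun_apply_blinfun_compose)
  have "\<tau> (Um g u T) = \<tau> (?w o\<^sub>L op_adj ?w)"
    unfolding diag_tr_def infsum_Y0 Um_vacuum_entry wa
    using cinner_op_adj[OF Dm_Bop[OF u]] by (simp add: op_adj_Dm[OF u] hh)
  also have "\<dots> = \<tau> (op_adj ?w o\<^sub>L ?w)" by (rule tr_comm[OF w, symmetric])
  also have "op_adj ?w o\<^sub>L ?w = T"
    unfolding wa by (rule blinfun_eqI) (simp add: Dm_sq[OF u] hh)
  finally show "\<tau> (Um g u T) = \<tau> T" .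
qed

text \<open>The hypothesis \<open>comm\<close> is freshness: \<open>T\<close> commutes with every
  generator that occurs in \<open>u\<close>. It makes the terms with two different generators vanish
  and reduces those with equal generators to the entry of \<open>T\<close> itself.\<close>

lemma Um_vacuum:
  assumes T: "T \<in> M" and comm: "\<And>i s x. u i s \<noteq> 0 \<Longrightarrow> T (Cv s x) = Cv s (T x)"
    and gram: "((\<lambda>s. u i s * u j s) has_sum a) UNIV"
  shows "coord (Um g u T (ket (j, {||}))) (i, {||}) = of_real a * coord (T (ket (j, {||}))) (i, {||})"
proof -
  let ?f = "coord (T (ket (j, {||}))) (i, {||})"
  let ?S = "\<lambda>k F. \<Sum>s\<in>F. u k s *\<^sub>R Cv s (ket (k, {||}))"
  have key: "cinner (T (u j s *\<^sub>R Cv s (ket (j, {||})))) (u i t *\<^sub>R Cv t (ket (i, {||})))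
      = (if s = t then of_real (u i s * u j s) * ?f else 0)" for s t
  proof (cases "u j s = 0 \<or> u i t = 0")
    case True
    then show ?thesis by (auto simp: blinfun.zero_right)
  next
    case False
    then have cs: "T (Cv s x) = Cv s (T x)" for x using comm[of j s] by blast
    have "cinner (T (Cv s (ket (j, {||})))) (Cv t (ket (i, {||}))) = (if s = t then ?f else 0)"
    proof (cases "s = t")
      case True
      then show ?thesis by (simp add: cs[unfolded True] cinner_Cv Cv_sq cinner_ket_right)
    next
      case st: False
      let ?a = "cinner (T (Cv s (ket (j, {||})))) (Cv t (ket (i, {||})))"
      have RC: "Cv s (ket (k, {||})) = Rm {|s|} (ket (k, {||}))" for s k
        by (simp add: Cm_ket_empty Rm_ket_empty)
      have MC: "Cv s (Rm G x) = Rm G (Cv s x)" for s G x by (rule M_Rm[OF Cm_M])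
      have R_adj: "cinner (Rm {|s|} x) y = cinner x (Rm {|s|} y)" for s x y
        using cinner_op_adj[of "Rm {|s|}" x y] by (simp add: Bop_iff op_adj_Rm sg_single(1))
      have RR1: "Rm {|s|} (Rm {|s|} x) = x" for s x
        by (rule ell2_pair_eqI) (simp add: sg_sd_left sg_single(1))
      text \<open>Conjugating by \<open>Cv s\<close>, which commutes with \<open>T\<close> and acts on the vacuum like
        \<open>Rm {|s|}\<close>, changes the sign.\<close>
      have "?a = cinner (Cv t (T (Cv s (ket (j, {||}))))) (ket (i, {||}))" by (simp add: cinner_Cv)
      also have "\<dots> = cinner (T (Cv t (Cv s (ket (j, {||}))))) (ket (i, {||}))"
        using comm[of i t] False by simp
      finally have a1: "?a = cinner (T (Cv t (Cv s (ket (j, {||}))))) (ket (i, {||}))" .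
      have "\<dots> = cinner (Cv s (T (Cv t (Cv s (ket (j, {||})))))) (Cv s (ket (i, {||})))"
        by (simp add: cinner_Cv Cv_sq)
      also have "\<dots> = cinner (T (Cv s (Cv t (Cv s (ket (j, {||})))))) (Cv s (ket (i, {||})))"
        by (simp add: cs)
      also have "Cv s (Cv t (Cv s (ket (j, {||})))) = - Cv t (Cv s (Cv s (ket (j, {||}))))"
        by (rule Cv_anticomm[OF st])
      also have "Cv t (Cv s (Cv s (ket (j, {||})))) = Rm {|s|} (Cv t (Cv s (ket (j, {||}))))"
        by (simp add: RC MC)
      also have "cinner (T (- Rm {|s|} (Cv t (Cv s (ket (j, {||})))))) (Cv s (ket (i, {||})))
          = - cinner (T (Cv t (Cv s (ket (j, {||}))))) (ket (i, {||}))"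
        unfolding RC[of s i] by (simp add: blinfun.minus_right cinner_minus_left M_Rm[OF T] R_adj RR1)
      finally have "?a = - ?a" unfolding a1 .
      then show ?thesis using st by simp
    qed
    then show ?thesis
      by (simp add: blinfun.scaleR_right cinner_scaleR_left cinner_scaleR_right scaleR_conv_of_real mult_ac)
  qed
  have Sf: "cinner (T (?S j F)) (?S i F) = of_real (\<Sum>s\<in>F. u i s * u j s) * ?f" if F: "finite F" for F
  proof -
    have "cinner (T (?S j F)) (?S i F) = (\<Sum>s\<in>F. \<Sum>t\<in>F. if s = t then of_real (u i s * u j s) * ?f else 0)"
      unfolding blinfun.sum_right cinner_sum_left cinner_sum_right key by (rule sum.swap)
    also have "\<dots> = (\<Sum>s\<in>F. of_real (u i s * u j s) * ?f)"
      using F by (intro sum.cong refl) simp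
    finally show ?thesis by (simp add: sum_distrib_right)
  qed
  have lim: "((\<lambda>F. cinner (T (?S j F)) (?S i F)) \<longlongrightarrow>
      cinner (T (cliff (u j) (ket (j, {||})))) (cliff (u i) (ket (i, {||})))) (finite_subsets_at_top UNIV)"
    by (intro tendsto_intros blinfun.tendsto tendsto_const cliff_lim unit_field_summable[OF u])
  have lim': "((\<lambda>F. of_real (\<Sum>s\<in>F. u i s * u j s) * ?f) \<longlongrightarrow> of_real a * ?f) (finite_subsets_at_top UNIV)"
    using gram unfolding has_sum_def by (intro tendsto_intros)
  have "eventually (\<lambda>F. of_real (\<Sum>s\<in>F. u i s * u j s) * ?f = cinner (T (?S j F)) (?S i F))
      (finite_subsets_at_top UNIV)"
    by (rule eventually_finite_subsets_at_top_weakI) (simp add: Sf)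
  then have "cinner (T (cliff (u j) (ket (j, {||})))) (cliff (u i) (ket (i, {||}))) = of_real a * ?f"
    by (rule tendsto_unique[OF finite_subsets_at_top_neq_bot lim Lim_transform_eventually[OF lim']])
  then show ?thesis
    using Um_vacuum_entry[of T j i] by (simp add: Dm_ket[OF u] cinner_ket_right)
qed

text \<open>Moving \<open>Cv (inv g s)\<close> past the two factors \<open>Dm u\<close> produces two signs, which cancel.\<close>

lemma Um_commute_Cv:
  assumes comm: "\<And>x. blinfun_apply T (Cv (inv g s) x) = Cv (inv g s) (blinfun_apply T x)" and us: "\<And>i. u i (inv g s) = 0"
  shows "Um g u T (Cv s x) = Cv s (Um g u T x)"
proof -
  let ?s = "inv g s"
  have D: "Dm u (Cv ?s y) = - Cv ?s (Dm u y)" for y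
    using Dm_anticommute_Cv[OF u, of ?s y] us by simp
  have W: "Wm (inv g) (Cv s x) = Cv ?s (Wm (inv g) x)"
    by (rule Wm_Cv[OF order_aut_inv[OF g]])
  have W': "Wm g (Cv ?s y) = Cv s (Wm g y)" for y
    using Wm_Cv[OF g, of ?s y] by (simp add: aut_cancel[OF g])
  show ?thesis unfolding Um_apply W D by (simp add: blinfun.minus_right comm D W')
qed

end

text \<open>Each permutation fixes the generators used by the other diagonal, so only the two
  diagonals fail to commute. They anticommute once to the left and once to the right of
  \<open>T\<close>, and the signs cancel.\<close>

lemma Um_commute:
  assumes g: "order_aut g" and u: "unit_field u" and h: "order_aut h" and w: "unit_field w"
    and gh: "\<And>a. g (h a) = h (g a)" and disj: "\<And>i j s. u i s = 0 \<or> w j s = 0"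
    and gw: "\<And>i s. w i s \<noteq> 0 \<Longrightarrow> g s = s" and hu: "\<And>i s. u i s \<noteq> 0 \<Longrightarrow> h s = s"
  shows "Um g u (Um h w T) = Um h w (Um g u T)"
proof (rule blinfun_eqI)
  fix x
  have gi: "inv g (inv h a) = inv h (inv g a)" for a
    by (metis gh aut_cancel[OF g] aut_cancel[OF h])
  have fx: "inv g s = s" if "g s = s" for s using that aut_cancel[OF g] by metis
  have hx: "inv h s = s" if "h s = s" for s using that aut_cancel[OF h] by metis
  have c1: "Wm g (Dm w y) = Dm w (Wm g y)" for y
    by (rule Dm_commute[OF w fibred_Wm[OF g]]) (metis Wm_Cv[OF g] gw)
  have c2: "Wm h (Dm u y) = Dm u (Wm h y)" for y
    by (rule Dm_commute[OF u fibred_Wm[OF h]]) (metis Wm_Cv[OF h] hu)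
  have c3: "Wm (inv g) (Dm w y) = Dm w (Wm (inv g) y)" for y
    by (rule Dm_commute[OF w fibred_Wm[OF order_aut_inv[OF g]]]) (metis Wm_Cv[OF order_aut_inv[OF g]] gw fx)
  have c4: "Wm (inv h) (Dm u y) = Dm u (Wm (inv h) y)" for y
    by (rule Dm_commute[OF u fibred_Wm[OF order_aut_inv[OF h]]]) (metis Wm_Cv[OF order_aut_inv[OF h]] hu hx)
  have WW: "Wm g (Wm h y) = Wm h (Wm g y)" for y by (rule Wm_comp[OF g h gh])
  have WW': "Wm (inv g) (Wm (inv h) y) = Wm (inv h) (Wm (inv g) y)" for y
    by (rule Wm_comp[OF order_aut_inv[OF g] order_aut_inv[OF h] gi])
  have DD: "Dm u (Dm w y) = - Dm w (Dm u y)" for y by (rule Dm_anticommute[OF u w disj])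
  let ?y = "Wm (inv h) (Wm (inv g) x)"
  have "Um g u (Um h w T) x = Wm g (Wm h (Dm u (Dm w (T (Dm w (Dm u ?y))))))"
    unfolding Um_apply c4 c2[symmetric] ..
  also have "\<dots> = Wm h (Wm g (Dm w (Dm u (T (Dm u (Dm w ?y))))))"
    unfolding WW DD by (simp add: blinfun.minus_right)
  also have "\<dots> = Um h w (Um g u T) x"
    unfolding Um_apply c3 WW' c1 ..
  finally show "Um g u (Um h w T) x = Um h w (Um g u T) x" .
qed

end


section \<open>Normality of positive maps\<close>

lemma commutant_empty [simp]: "commutant {} = Bop"
  by (auto simp: commutant_def)

lemma adjoint_pair:
  fixes S :: "'a ell2 \<Rightarrow>\<^sub>L 'b ell2" and T :: "'b ell2 \<Rightarrow>\<^sub>L 'a ell2"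
  assumes S: "clin S" and T: "clin T" and adj: "\<And>i k. coord (S (ket k)) i = cnj (coord (T (ket i)) k)"
  shows "cinner (S x) y = cinner x (T y)"
proof -
  have "\<exists>T'. clin T' \<and> norm T' \<le> norm S \<and> (\<forall>y x. cinner (blinfun_apply T' y) x = cinner y (S x))"
  proof (rule form_op_exists)
    fix y x
    show "cmod (cinner y (S x)) \<le> norm S * norm y * norm x"
      using order_trans[OF cmod_cinner_le mult_left_mono[OF norm_blinfun[of S x] norm_ge_zero[of y]]]
      by (simp add: mult_ac)
  qed (use S in \<open>auto simp: cinner_add_left cinner_add_right cinner_scale_left
      cinner_scale_right blinfun.add_right clinD\<close>)
  then obtain T' where T': "clin T'" "\<And>y x. cinner (blinfun_apply T' y) x = cinner y (S x)" by blast
  have "T' = T"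
  proof (rule op_ket_eqI[OF T'(1) T], rule ell2_eqI)
    fix i k
    show "coord (T' (ket i)) k = coord (T (ket i)) k"
      using T'(2)[of "ket i" "ket k"] adj[of k i] by (simp add: cinner_ket_right cinner_ket_left)
  qed
  then show ?thesis using T'(2) cinner_eq_flip by metis
qed

text \<open>Convergence of single entries suffices: by \<open>Vigier\<close> the image of
  \<open>D\<close> has some weak limit, and the entries identify it as
  \<open>\<phi> S\<close>.\<close>

lemma normal_mapI:
  assumes R: "R1 \<subseteq> Bop" "R2 \<subseteq> Bop"
    and maps: "\<And>T. T \<in> commutant R1 \<Longrightarrow> \<phi> T \<in> commutant R2"
    and pos: "\<And>T. T \<in> pos_part (commutant R1) \<Longrightarrow> op_positive (\<phi> T)"
    and mono: "\<And>S T. S \<in> pos_part (commutant R1) \<Longrightarrow> T \<in> pos_part (commutant R1) \<Longrightarrow> op_le S T \<Longrightarrow>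
      op_le (\<phi> S) (\<phi> T)"
    and lim: "\<And>D S j i. is_directed D \<Longrightarrow> D \<subseteq> pos_part (commutant R1) \<Longrightarrow> S \<in> commutant R1 \<Longrightarrow> wlim D S \<Longrightarrow>
      ((\<lambda>T. coord (\<phi> T (ket j)) i) \<longlongrightarrow> coord (\<phi> S (ket j)) i) (dnet D)"
  shows "normal_map (commutant R1) (commutant R2) \<phi>"
  unfolding normal_map_def
proof (intro allI impI, elim conjE)
  fix D S
  assume D: "D \<subseteq> pos_part (commutant R1)" "is_directed D" and S: "is_sup_in (commutant R1) D S"
  have SN: "S \<in> pos_part (commutant R1)" using S by (simp add: is_sup_in_def)
  have w: "wlim D S" by (rule sup_is_wlim[OF D(2,1) R(1) S])
  have D': "is_directed (\<phi> ` D)" unfolding is_directed_def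
  proof (intro conjI ballI)
    show "\<phi> ` D \<noteq> {}" using D by (simp add: is_directed_def)
    fix s t assume "s \<in> \<phi> ` D" "t \<in> \<phi> ` D"
    then obtain a b where ab: "a \<in> D" "s = \<phi> a" "b \<in> D" "t = \<phi> b" by blast
    then obtain c where c: "c \<in> D" "op_le a c" "op_le b c" using D(2) unfolding is_directed_def by blast
    have "op_le (\<phi> a) (\<phi> c)" "op_le (\<phi> b) (\<phi> c)" using mono D(1) ab c by blast+
    then show "\<exists>r\<in>\<phi> ` D. op_le s r \<and> op_le t r" using ab c by blast
  qed
  have D'M: "\<phi> ` D \<subseteq> pos_part (commutant R2)"
    using D maps pos by (auto simp: pos_part_def)
  have SM: "\<phi> S \<in> commutant R2" "op_positive (\<phi> S)" using SN maps pos by (auto simp: pos_part_def)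
  have SB: "\<phi> S \<in> Bop" using SM(2) by (rule op_positive_Bop)
  have "\<exists>S'\<in>Bop. wlim (\<phi> ` D) S'"
  proof (rule Vigier[OF D' _ SB])
    fix t assume "t \<in> \<phi> ` D"
    then obtain T where T: "T \<in> D" "t = \<phi> T" by blast
    then show "op_positive t" using D pos by blast
    show "op_le t (\<phi> S)"
      using T S D SN unfolding T(2) by (intro mono) (auto simp: is_sup_in_def)
  qed
  then obtain S' where S': "S' \<in> Bop" "wlim (\<phi> ` D) S'" by blast
  \<comment> \<open>By monotonicity \<open>\<phi>\<close> carries final sections of \<open>D\<close>
    into final sections of its image.\<close>
  have fl: "filterlim \<phi> (dnet (\<phi> ` D)) (dnet D)"
    unfolding filterlim_iff
  proof (intro allI impI)
    fix P assume "eventually P (dnet (\<phi> ` D))"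
    then obtain T where T: "T \<in> D" "\<And>r. r \<in> \<phi> ` D \<Longrightarrow> op_le (\<phi> T) r \<Longrightarrow> P r"
      unfolding eventually_dnet[OF D'] by blast
    show "eventually (\<lambda>T. P (\<phi> T)) (dnet D)"
      unfolding eventually_dnet[OF D(2)]
      by (intro bexI[OF _ T(1)] ballI impI T(2)) (use mono D T in blast)+
  qed
  have "S' = \<phi> S"
  proof (rule op_entry_eqI[OF S'(1) SB])
    fix i j
    have "((\<lambda>t. coord (blinfun_apply t (ket j)) i) \<longlongrightarrow> coord (S' (ket j)) i) (dnet (\<phi> ` D))"
      using wlimD[OF S'(2), of "ket j" "ket i"] by (simp add: cinner_ket_right)
    then have "((\<lambda>T. coord (\<phi> T (ket j)) i) \<longlongrightarrow> coord (S' (ket j)) i) (dnet D)"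
      by (rule filterlim_compose[OF _ fl])
    moreover have "((\<lambda>T. coord (\<phi> T (ket j)) i) \<longlongrightarrow> coord (\<phi> S (ket j)) i) (dnet D)"
      using SN by (intro lim[OF D(2,1) _ w]) (simp add: pos_part_def)
    ultimately show "coord (S' (ket j)) i = coord (\<phi> S (ket j)) i"
      by (rule tendsto_unique[OF dnet_neq_bot[OF D(2)]])
  qed
  then have "wlim (\<phi> ` D) (\<phi> S)" using S'(2) by simp
  then show "is_sup_in (commutant R2) (\<phi> ` D) (\<phi> S)"
    by (rule wlim_is_sup[OF D' D'M SM(1) SB])
qed

lemma Tr_eq_diag_tr: "Tr = diag_tr UNIV"
  by (simp add: fun_eq_iff Tr_def diag_tr_def mat_entry_def)

text \<open>\<open>Bop\<close> is the commutant of the empty set, so the general facts on the trace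
  ideal apply to \<open>Tr\<close>.\<close>

lemma Bop_diag_trace: "diag_trace ({} :: 'i op set) UNIV"
proof unfold_locales
  fix T :: "'i op" assume "T \<in> commutant {}"
  then have T: "T \<in> Bop" by simp
  have "(\<Sum>\<^sub>\<infinity>y. ennreal ((norm (T (ket y)))\<^sup>2)) = (\<Sum>\<^sub>\<infinity>y. \<Sum>\<^sub>\<infinity>k. ennreal ((cmod (coord (T (ket y)) k))\<^sup>2))"
    by (simp add: norm_sq_infsum_ennreal)
  also have "\<dots> = (\<Sum>\<^sub>\<infinity>k. \<Sum>\<^sub>\<infinity>y. ennreal ((cmod (coord (T (ket y)) k))\<^sup>2))" by (rule infsum_swap_ennreal)
  also have "\<dots> = (\<Sum>\<^sub>\<infinity>y. ennreal ((norm (op_adj T (ket y)))\<^sup>2))"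
    by (simp add: norm_sq_infsum_ennreal coord_op_adj[OF T])
  finally show "(\<Sum>\<^sub>\<infinity>y. ennreal ((norm (T (ket y)))\<^sup>2)) = (\<Sum>\<^sub>\<infinity>y. ennreal ((norm (op_adj T (ket y)))\<^sup>2))" .
qed auto

context clifford
begin

section \<open>The embedding and the conditional expectation\<close>

definition Vm :: "'s fset \<Rightarrow> 'i ell2 \<Rightarrow>\<^sub>L ('i \<times> 's fset) ell2" where
  "Vm F = mon fst (\<lambda>(i, G). if G = F then 1 else 0)"

definition Qm :: "'s fset \<Rightarrow> ('i \<times> 's fset) ell2 \<Rightarrow>\<^sub>L 'i ell2" where
  "Qm F = mon (\<lambda>i. (i, F)) (\<lambda>_. 1)"

lemma coord_Vm [simp]: "coord (Vm F x) (i, G) = (if G = F then coord x i else 0)"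
  and clin_Vm [simp]: "clin (Vm F)" and norm_Vm: "norm (Vm F) \<le> 1"
proof -
  have inj: "inj_on fst {k :: 'i \<times> 's fset. (\<lambda>(i, G). if G = F then 1 else (0 :: complex)) k \<noteq> 0}"
    by (rule inj_onI) (auto split: if_splits)
  show "coord (Vm F x) (i, G) = (if G = F then coord x i else 0)"
    unfolding Vm_def by (subst coord_mon[OF inj]) auto
  show "clin (Vm F)" unfolding Vm_def by (rule clin_mon[OF inj]) auto
  show "norm (Vm F) \<le> 1" unfolding Vm_def by (rule norm_mon[OF inj]) auto
qed

lemma coord_Qm [simp]: "coord (Qm F x) i = coord x (i, F)"
  and clin_Qm [simp]: "clin (Qm F)" and norm_Qm: "norm (Qm F) \<le> 1"
proof -
  have inj: "inj_on (\<lambda>i. (i, F)) A" for A by (rule inj_onI) auto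
  show "coord (Qm F x) i = coord x (i, F)" unfolding Qm_def by (subst coord_mon[OF inj]) auto
  show "clin (Qm F)" unfolding Qm_def by (rule clin_mon[OF inj]) auto
  show "norm (Qm F) \<le> 1" unfolding Qm_def by (rule norm_mon[OF inj]) auto
qed

lemma Vm_ket: "Vm F (ket j) = ket (j, F)"
  by (rule ell2_pair_eqI) auto

lemma cinner_Vm: "cinner (Vm F x) y = cinner x (Qm F y)"
proof (rule adjoint_pair)
  fix k and a :: "'i \<times> 's fset"
  show "coord (Vm F (ket k)) a = cnj (coord (Qm F (ket a)) k)" by (cases a) auto
qed auto

text \<open>Compression to the vacuum copy of the small space.\<close>

definition Em :: "('i \<times> 's fset) op \<Rightarrow> 'i op" where
  "Em y = Qm {||} o\<^sub>L y o\<^sub>L Vm {||}"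

text \<open>The operator \<open>x\<close> tensored with the identity, assembled as a direct sum of
  copies of \<open>x\<close> over the sets \<open>F\<close>.\<close>

definition Jm :: "'i op \<Rightarrow> ('i \<times> 's fset) op" where
  "Jm x = dsum snd (\<lambda>F. Vm F o\<^sub>L x o\<^sub>L Qm F)"

lemma Em_Bop: "y \<in> Bop \<Longrightarrow> Em y \<in> Bop"
  unfolding Em_def Bop_iff by (intro clin_comp) auto

lemma cinner_Em: "cinner (Em y x) z = cinner (y (Vm {||} x)) (Vm {||} z)"
  using cinner_eq_flip[of "Vm {||} z" "y (Vm {||} x)" z "Qm {||} (y (Vm {||} x))"]
  by (simp add: Em_def cinner_Vm)

lemma coord_Em: "coord (Em y (ket j)) i = coord (y (ket (j, {||}))) (i, {||})"
  by (simp add: Em_def Vm_ket)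

context
  fixes x :: "'i op"
  assumes x: "x \<in> Bop"
begin

lemma coord_Jm: "coord (Jm x y) (i, F) = coord (x (Qm F y)) i"
proof -
  have "norm (Vm F o\<^sub>L x o\<^sub>L Qm F) \<le> norm x" for F
  proof -
    have "norm (Vm F o\<^sub>L x o\<^sub>L Qm F) \<le> (norm (Vm F) * norm x) * norm (Qm F)"
      by (intro order_trans[OF norm_blinfun_compose] mult_right_mono norm_blinfun_compose) simp
    also have "\<dots> \<le> (1 * norm x) * 1"
      by (intro mult_mono norm_Vm norm_Qm) auto
    finally show ?thesis by simp
  qed
  then have "coord (Jm x y) (i, F) = coord ((Vm F o\<^sub>L x o\<^sub>L Qm F) (Pr (snd -` {F}) y)) (i, F)"
    unfolding Jm_def using x by (subst coord_dsum[where K = "norm x"]) (auto intro!: clin_comp simp: Bop_iff)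
  also have "Qm F (Pr (snd -` {F}) y) = Qm F y" by (rule ell2_eqI) simp
  then have "coord ((Vm F o\<^sub>L x o\<^sub>L Qm F) (Pr (snd -` {F}) y)) (i, F) = coord (x (Qm F y)) i" by simp
  finally show ?thesis .
qed

lemma Jm_Bop: "Jm x \<in> Bop"
proof -
  have "norm (Vm F o\<^sub>L x o\<^sub>L Qm F) \<le> (norm (Vm F) * norm x) * norm (Qm F)" for F
    by (intro order_trans[OF norm_blinfun_compose] mult_right_mono norm_blinfun_compose) simp
  moreover have "(norm (Vm F) * norm x) * norm (Qm F) \<le> (1 * norm x) * 1" for F
    by (intro mult_mono norm_Vm norm_Qm) auto
  ultimately have "norm (Vm F o\<^sub>L x o\<^sub>L Qm F) \<le> norm x" for F
    using order_trans by fastforce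
  then show ?thesis unfolding Jm_def Bop_iff using x
    by (intro clin_dsum) (auto intro!: clin_comp simp: Bop_iff)
qed

lemma Qm_Jm: "Qm F (Jm x y) = x (Qm F y)"
  by (rule ell2_eqI) (simp add: coord_Jm)

lemma Jm_ket: "Jm x (ket (j, F)) = Vm F (x (ket j))"
proof (rule ell2_pair_eqI)
  fix i G
  have "Qm G (ket (j, F)) = (if G = F then ket j else 0)" by (rule ell2_eqI) auto
  then show "coord (Jm x (ket (j, F))) (i, G) = coord (Vm F (x (ket j))) (i, G)"
    by (simp add: coord_Jm)
qed

lemma Jm_M: "Jm x \<in> M"
  unfolding M_iff
proof (intro conjI Jm_Bop allI ell2_pair_eqI)
  fix G y i F
  have "Qm F (Rm G y) = ell2_scale (sg (sd F G) G) (Qm (sd F G) y)" by (rule ell2_eqI) simp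
  then show "coord (Jm x (Rm G y)) (i, F) = coord (Rm G (Jm x y)) (i, F)"
    using x by (simp add: coord_Jm Bop_iff clinD)
qed

lemma Jm_Cm: "Jm x (Cm H y) = Cm H (Jm x y)"
proof (rule ell2_pair_eqI)
  fix i F
  have "Qm F (Cm H y) = ell2_scale (sg H (sd H F)) (Qm (sd H F) y)" by (rule ell2_eqI) simp
  then show "coord (Jm x (Cm H y)) (i, F) = coord (Cm H (Jm x y)) (i, F)"
    using x by (simp add: coord_Jm Bop_iff clinD)
qed

lemma Em_Jm: "Em (Jm x) = x"
  by (rule op_entry_eqI[OF Em_Bop[OF Jm_Bop] x]) (simp add: coord_Em Jm_ket)

end

lemma Jm_add: "x \<in> Bop \<Longrightarrow> y \<in> Bop \<Longrightarrow> Jm (x + y) = Jm x + Jm y"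
  by (intro blinfun_eqI ell2_pair_eqI) (simp add: coord_Jm blinfun.add_left)

lemma Jm_diff: "x \<in> Bop \<Longrightarrow> y \<in> Bop \<Longrightarrow> Jm (x - y) = Jm x - Jm y"
  by (intro blinfun_eqI ell2_pair_eqI) (simp add: coord_Jm blinfun.diff_left)

lemma Jm_scale: "x \<in> Bop \<Longrightarrow> Jm (op_scale c x) = op_scale c (Jm x)"
  by (intro blinfun_eqI ell2_pair_eqI) (simp add: coord_Jm)

lemma Jm_comp: "x \<in> Bop \<Longrightarrow> y \<in> Bop \<Longrightarrow> Jm (x o\<^sub>L y) = Jm x o\<^sub>L Jm y"
  by (intro blinfun_eqI ell2_pair_eqI) (simp add: coord_Jm Qm_Jm)

lemma Jm_adj:
  assumes x: "x \<in> Bop"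
  shows "Jm (op_adj x) = op_adj (Jm x)"
proof (rule op_entry_eqI)
  fix a b :: "'i \<times> 's fset"
  obtain i F j G where "a = (i, F)" "b = (j, G)" by fastforce
  then show "coord (Jm (op_adj x) (ket b)) a = coord (op_adj (Jm x) (ket b)) a"
    by (simp add: Jm_ket x coord_op_adj[OF Jm_Bop[OF x]] coord_op_adj[OF x])
qed (auto simp: Jm_Bop x)

lemma Jm_star_hom: "star_hom Bop M Jm"
  unfolding star_hom_def op_linear_on_def
  by (auto simp: Jm_M Jm_add Jm_scale Jm_comp Jm_adj)

lemma Jm_unital: "unital Jm"
  unfolding unital_def by (intro blinfun_eqI ell2_pair_eqI) (simp add: coord_Jm)

lemma Jm_inj: "inj_on Jm Bop"
  by (rule inj_on_inverseI[where g = Em]) (rule Em_Jm)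

lemma Jm_positive:
  assumes "op_positive x"
  shows "op_positive (Jm x)"
proof -
  obtain h where h: "op_positive h" "h o\<^sub>L h = x" using op_sqrt_exists[OF assms] by blast
  have hB: "h \<in> Bop" using h(1) by (rule op_positive_Bop)
  have "Jm x = op_adj (Jm h) o\<^sub>L Jm h"
    using hB by (simp add: h(2)[symmetric] Jm_comp op_positive_adj[OF h(1)] flip: Jm_adj)
  then show ?thesis using op_positive_adj_self[OF Jm_Bop[OF hB]] by simp
qed

lemma Jm_trace: "x \<in> Bop \<Longrightarrow> \<tau> (Jm x) = Tr x"
  by (simp add: diag_tr_def infsum_Y0 Tr_eq_diag_tr cinner_ket_right Jm_ket)

lemma Jm_trace_preserving: "trace_preserving Bop Tr \<tau> Jm"
  unfolding trace_preserving_def by (simp add: pos_part_def Jm_trace)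

lemma Jm_normal: "normal_map Bop M Jm"
proof -
  have "normal_map (commutant {}) M Jm"
  proof (rule normal_mapI)
    fix S T :: "'i op" assume ST: "S \<in> pos_part (commutant {})" "T \<in> pos_part (commutant {})" "op_le S T"
    then show "op_le (Jm S) (Jm T)"
      using Jm_positive[of "T - S"] by (simp add: op_le_def Jm_diff pos_part_def)
  next
    fix D :: "'i op set" and S :: "'i op" and a b :: "'i \<times> 's fset"
    assume D: "is_directed D" "D \<subseteq> pos_part (commutant {})" and S: "S \<in> commutant {}" "wlim D S"
    obtain i F j G where ab: "a = (i, F)" "b = (j, G)" by fastforce
    have "((\<lambda>T. if F = G then cinner (blinfun_apply T (ket j)) (ket i) else 0) \<longlongrightarrow>
        (if F = G then cinner (S (ket j)) (ket i) else 0)) (dnet D)"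
      using wlimD[OF S(2)] by auto
    moreover have "eventually (\<lambda>T. (if F = G then cinner (blinfun_apply T (ket j)) (ket i) else 0)
        = coord (Jm T (ket b)) a) (dnet D)"
      using eventually_in_dnet[OF D(1)]
    proof eventually_elim
      case (elim T)
      then have "T \<in> Bop" using D(2) by (auto simp: pos_part_def)
      then show ?case by (simp add: ab Jm_ket cinner_ket_right)
    qed
    ultimately have "((\<lambda>T. coord (Jm T (ket b)) a) \<longlongrightarrow> (if F = G then cinner (S (ket j)) (ket i) else 0)) (dnet D)"
      by (rule Lim_transform_eventually)
    then show "((\<lambda>T. coord (Jm T (ket b)) a) \<longlongrightarrow> coord (Jm S (ket b)) a) (dnet D)"
      using S(1) by (simp add: ab Jm_ket cinner_ket_right cong: if_cong split: if_splits)
  qed (use R_Bop in \<open>auto simp: Jm_M Jm_positive pos_part_def\<close>)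
  then show ?thesis by simp
qed

lemma Em_linear: "op_linear_on A Em"
  unfolding op_linear_on_def Em_def
  by (auto intro!: blinfun_eqI ell2_eqI simp: blinfun.add_left)

lemma Em_positive: "op_positive y \<Longrightarrow> op_positive (Em y)"
  unfolding op_positive_iff by (simp add: Em_Bop cinner_Em)

lemma Em_positive_map: "positive_map M Bop Em"
  unfolding positive_map_def using Em_linear by (auto simp: M_Bop Em_Bop pos_part_def Em_positive)

lemma Em_normal: "normal_map M Bop Em"
proof -
  have "normal_map M (commutant {}) Em"
  proof (rule normal_mapI)
    fix S T :: "('i \<times> 's fset) op" assume "op_le S T"
    then have "op_positive (Em (T - S))" by (simp add: op_le_def Em_positive)
    moreover have "Em (T - S) = Em T - Em S"
      unfolding Em_def by (intro blinfun_eqI ell2_eqI) (simp add: blinfun.diff_left)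
    ultimately show "op_le (Em S) (Em T)" by (simp add: op_le_def)
  next
    fix D and S :: "('i \<times> 's fset) op" and j i assume "wlim D S"
    from wlimD[OF this, of "ket (j, {||})" "ket (i, {||})"]
    show "((\<lambda>T. coord (Em T (ket j)) i) \<longlongrightarrow> coord (Em S (ket j)) i) (dnet D)"
      by (simp add: coord_Em cinner_ket_right)
  qed (use R_Bop in \<open>auto simp: M_Bop Em_Bop Em_positive pos_part_def\<close>)
  then show ?thesis by simp
qed

lemma Em_trace_preserving: "trace_preserving M \<tau> Tr Em"
  unfolding trace_preserving_def
  by (simp add: diag_tr_def infsum_Y0 Tr_eq_diag_tr cinner_ket_right coord_Em)

lemma Jm_L1:
  assumes "x \<in> L1_part Bop Tr"
  shows "Jm x \<in> L1_part M \<tau>"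
proof -
  obtain a b c d where *: "a \<in> fin_pos Bop Tr" "b \<in> fin_pos Bop Tr" "c \<in> fin_pos Bop Tr" "d \<in> fin_pos Bop Tr"
    and x: "x = (a - b) + op_scale \<i> (c - d)"
    using assms unfolding L1_part_def trace_decomp_def by blast
  have J: "Jm a \<in> fin_pos M \<tau>" if "a \<in> fin_pos Bop Tr" for a
    using that by (auto simp: fin_pos_def pos_part_def Jm_M Jm_positive Jm_trace)
  have B: "a \<in> Bop" "b \<in> Bop" "c \<in> Bop" "d \<in> Bop" using * by (auto simp: fin_pos_def pos_part_def)
  have "Jm x = (Jm a - Jm b) + op_scale \<i> (Jm c - Jm d)"
    using B by (simp add: x Jm_add Jm_diff Jm_scale)
  then show ?thesis using L1_I J * by blast
qed

text \<open>For the trace identity, ideal membership turns both sides into diagonal sums, and these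
  agree term by term. Faithfulness holds because the diagonal of \<open>Em y\<close> consists of the
  vacuum diagonal entries of \<open>y\<close>.\<close>

lemma Em_cond_exp: "canonical_cond_exp Bop Tr M \<tau> Jm Em"
  unfolding canonical_cond_exp_def
proof (intro conjI ballI impI)
  fix y assume y: "y \<in> pos_part M" "Em y = 0"
  show "y = 0"
  proof (rule tr_faithful_vector)
    fix z assume "z \<in> Y0"
    then obtain i where z: "z = (i, {||})" by (auto simp: Y0_def)
    show "cinner (y (ket z)) (ket z) = 0"
      using coord_Em[of y i i] y(2) by (simp add: z cinner_ket_right)
  qed (use y in \<open>auto simp: pos_part_def\<close>)
next
  fix y and x :: "'i op" assume y: "y \<in> M" and x: "x \<in> L1_part Bop Tr"
  interpret B: diag_trace "{} :: 'i op set" UNIV by (rule Bop_diag_trace)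
  have xB: "x \<in> Bop" using x by (auto simp: L1_part_def trace_decomp_def fin_pos_def pos_part_def)
  have "Em y o\<^sub>L x \<in> L1_part Bop Tr"
    using B.L1_ideal[of x "Em y"] x M_Bop[OF y] by (simp add: Tr_eq_diag_tr Em_Bop)
  then have "trace_ext Bop Tr (Em y o\<^sub>L x) = (\<Sum>\<^sub>\<infinity>i. cinner ((Em y o\<^sub>L x) (ket i)) (ket i))"
    using B.trace_ext_eq by (simp add: Tr_eq_diag_tr)
  also have "\<dots> = (\<Sum>\<^sub>\<infinity>z\<in>Y0. cinner ((y o\<^sub>L Jm x) (ket z)) (ket z))"
    by (simp add: infsum_Y0 Jm_ket[OF xB] cinner_Em Vm_ket)
  also have "\<dots> = trace_ext M \<tau> (y o\<^sub>L Jm x)"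
    by (rule trace_ext_eq[OF L1_ideal[OF Jm_L1[OF x] y], symmetric])
  finally show "trace_ext Bop Tr (Em y o\<^sub>L x) = trace_ext M \<tau> (y o\<^sub>L Jm x)" .
qed (rule Em_positive_map Em_normal)+

end


section \<open>Hyperfiniteness\<close>

text \<open>The strong operator topology is pulled back from the product topology, that is, from
  pointwise convergence.\<close>

lemma strong_operator_closureI:
  fixes f :: "'c \<Rightarrow> ('a::real_normed_vector \<Rightarrow>\<^sub>L 'b::real_normed_vector)"
  assumes G: "G \<noteq> bot" and lim: "\<And>x. ((\<lambda>c. f c x) \<longlongrightarrow> blinfun_apply T x) G" and S: "eventually (\<lambda>c. f c \<in> S) G"
  shows "T \<in> strong_operator_topology closure_of S"
proof -
  have "limitin (product_topology (\<lambda>i. euclidean) UNIV) (\<lambda>c. blinfun_apply (f c)) (blinfun_apply T) G"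
    by (simp only: limitin_componentwise) (simp add: lim)
  then have fun_lim: "((\<lambda>c. blinfun_apply (f c)) \<longlongrightarrow> blinfun_apply T) G"
    by (simp add: euclidean_product_topology)
  show ?thesis
    unfolding in_closure_of strong_operator_topology_topspace
  proof (intro conjI UNIV_I allI impI, elim conjE)
    fix U assume TU: "T \<in> U" and U: "openin strong_operator_topology U"
    then obtain V where V: "open V" "U = blinfun_apply -` V"
      by (auto simp: strong_operator_topology_def openin_pullback_topology)
    have "eventually (\<lambda>c. blinfun_apply (f c) \<in> V) G"
      by (rule topological_tendstoD[OF fun_lim V(1)]) (use TU V in simp)
    with S have "eventually (\<lambda>c. f c \<in> S \<and> f c \<in> U) G"
      by eventually_elim (simp add: V)
    then show "\<exists>y. y \<in> S \<and> y \<in> U" using eventually_happens'[OF G] by blast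
  qed
qed

lemma norm_Pr: "norm (Pr B) \<le> 1"
  unfolding Pr_def by (rule norm_mon) auto

definition matrix_unit :: "'i \<Rightarrow> 'i \<Rightarrow> 'i op" where
  "matrix_unit i j = mon (\<lambda>_. j) (\<lambda>k. if k = i then 1 else 0)"

lemma coord_matrix_unit: "coord (matrix_unit i j x) k = (if k = i then coord x j else 0)"
  and matrix_unit_Bop: "matrix_unit i j \<in> Bop"
proof -
  have inj: "inj_on (\<lambda>_. j) {k. (if k = i then 1 else (0 :: complex)) \<noteq> 0}"
    by (rule inj_onI) (auto split: if_splits)
  show "coord (matrix_unit i j x) k = (if k = i then coord x j else 0)"
    unfolding matrix_unit_def by (subst coord_mon[OF inj]) auto
  show "matrix_unit i j \<in> Bop"
    unfolding matrix_unit_def Bop_iff by (rule clin_mon[OF inj]) auto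
qed

lemma finite_fsets_below:
  assumes "finite X"
  shows "finite {F. fset F \<subseteq> X}"
proof -
  have "{F. fset F \<subseteq> X} = fset -` Pow X" by auto
  then show ?thesis using assms by (simp add: finite_vimageI inj_def fset_inject)
qed

context clifford
begin

text \<open>Matrices supported on \<open>Y\<close> over the Clifford algebra of the generators in
  \<open>X\<close>. Vacuum columns suffice for the condition because they determine an element of
  \<open>M\<close>.\<close>

definition fd_algebra :: "'s set \<Rightarrow> 'i set \<Rightarrow> ('i \<times> 's fset) op set" where
  "fd_algebra X Y = {T \<in> M. \<forall>i F j. coord (T (ket (j, {||}))) (i, F) \<noteq> 0 \<longrightarrow> i \<in> Y \<and> j \<in> Y \<and> fset F \<subseteq> X}"

lemma fd_algebra_M: "T \<in> fd_algebra X Y \<Longrightarrow> T \<in> M"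
  by (simp add: fd_algebra_def)

lemma fd_algebraD:
  assumes "T \<in> fd_algebra X Y" "coord (T (ket (j, G))) (i, F) \<noteq> 0"
  shows "i \<in> Y \<and> j \<in> Y \<and> fset (sd F G) \<subseteq> X"
  using assms M_ket[OF fd_algebra_M[OF assms(1)], of j G i F]
  by (simp add: fd_algebra_def)

lemma fd_algebraI:
  assumes "T \<in> M" "\<And>i F j. coord (T (ket (j, {||}))) (i, F) \<noteq> 0 \<Longrightarrow> i \<in> Y \<and> j \<in> Y \<and> fset F \<subseteq> X"
  shows "T \<in> fd_algebra X Y"
  using assms by (simp add: fd_algebra_def)

lemma fset_sd: "fset (sd F G) = (fset F - fset G) \<union> (fset G - fset F)"
  by (simp add: sd_def)

lemma fd_algebra_comp:
  assumes X: "finite X" "finite Y" and S: "S \<in> fd_algebra X Y" and T: "T \<in> fd_algebra X Y"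
  shows "S o\<^sub>L T \<in> fd_algebra X Y"
proof (rule fd_algebraI)
  show "S o\<^sub>L T \<in> M" using fd_algebra_M[OF S] fd_algebra_M[OF T] by (rule M_closed)
  fix i F j assume ne: "coord ((S o\<^sub>L T) (ket (j, {||}))) (i, F) \<noteq> 0"
  let ?K = "Y \<times> {F. fset F \<subseteq> X}" and ?x = "T (ket (j, {||}))"
  have K: "finite ?K" using X by (simp add: finite_fsets_below)
  \<comment> \<open>The vacuum column of \<open>T\<close> has finite support, so the entry of the
    product is a finite sum, and one of its terms must be nonzero.\<close>
  have "?x = Pr ?K ?x"
    using fd_algebraD[OF T, of j "{||}"] by (intro ell2_pair_eqI) fastforce
  then have "S ?x = S (Pr ?K ?x)" by simp
  also have "\<dots> = (\<Sum>k\<in>?K. ell2_scale (coord ?x k) (S (ket k)))"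
    using M_Bop[OF fd_algebra_M[OF S]] by (intro clin_apply_Pr K) (simp add: Bop_iff)
  finally have "(\<Sum>k\<in>?K. coord ?x k * coord (S (ket k)) (i, F)) \<noteq> 0" using ne by simp
  then obtain k where k: "k \<in> ?K" "coord ?x k * coord (S (ket k)) (i, F) \<noteq> 0"
    by (meson sum.neutral)
  obtain i' F' where k': "k = (i', F')" by fastforce
  have "coord ?x (i', F') \<noteq> 0" "coord (S (ket (i', F'))) (i, F) \<noteq> 0" using k k' by auto
  from fd_algebraD[OF T this(1)] fd_algebraD[OF S this(2)]
  show "i \<in> Y \<and> j \<in> Y \<and> fset F \<subseteq> X" by (auto simp: fset_sd)
qed

lemma fd_algebra_star_subalgebra:
  assumes X: "finite X" "finite Y"
  shows "star_subalgebra (fd_algebra X Y)"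
  unfolding star_subalgebra_def
proof (intro conjI ballI allI subsetI)
  fix S T assume S: "S \<in> fd_algebra X Y" and T: "T \<in> fd_algebra X Y"
  show "S + T \<in> fd_algebra X Y"
  proof (rule fd_algebraI)
    show "S + T \<in> M" using fd_algebra_M[OF S] fd_algebra_M[OF T] by (rule M_closed)
    fix i F j assume "coord ((S + T) (ket (j, {||}))) (i, F) \<noteq> 0"
    then have "coord (S (ket (j, {||}))) (i, F) \<noteq> 0 \<or> coord (T (ket (j, {||}))) (i, F) \<noteq> 0"
      by (auto simp: blinfun.add_left)
    then show "i \<in> Y \<and> j \<in> Y \<and> fset F \<subseteq> X"
      using fd_algebraD[OF S, of j "{||}" i F] fd_algebraD[OF T, of j "{||}" i F] by auto
  qed
  show "S o\<^sub>L T \<in> fd_algebra X Y" by (rule fd_algebra_comp[OF X S T])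
next
  fix c T assume T: "T \<in> fd_algebra X Y"
  show "op_scale c T \<in> fd_algebra X Y"
    using fd_algebraD[OF T, of _ "{||}"] fd_algebra_M[OF T]
    by (intro fd_algebraI M_closed) auto
next
  fix T assume T: "T \<in> fd_algebra X Y"
  have TM: "T \<in> M" by (rule fd_algebra_M[OF T])
  show "op_adj T \<in> fd_algebra X Y"
  proof (rule fd_algebraI[OF M_adj[OF TM]])
    fix i F j assume "coord (op_adj T (ket (j, {||}))) (i, F) \<noteq> 0"
    then have "coord (T (ket (i, F))) (j, {||}) \<noteq> 0" by (simp add: coord_op_adj[OF M_Bop[OF TM]])
    from fd_algebraD[OF T this] show "i \<in> Y \<and> j \<in> Y \<and> fset F \<subseteq> X" by simp
  qed
  show "T \<in> Bop" by (rule M_Bop[OF TM])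
qed (auto intro: fd_algebraI M_closed)

text \<open>A matrix unit tensored with a Clifford monomial.\<close>

definition elem :: "'i \<Rightarrow> 'i \<Rightarrow> 's fset \<Rightarrow> ('i \<times> 's fset) op" where
  "elem i j F = Jm (matrix_unit i j) o\<^sub>L Cm F"

lemma elem_M: "elem i j F \<in> M"
  unfolding elem_def by (intro M_closed Jm_M matrix_unit_Bop Cm_M)

lemma coord_elem:
  "coord (elem i j F (ket (k, {||}))) (l, G) = (if l = i \<and> j = k \<and> F = G then 1 else 0)"
  by (auto simp: elem_def Cm_ket_empty Jm_ket matrix_unit_Bop coord_matrix_unit)

lemma M_sum: "(\<And>a. a \<in> A \<Longrightarrow> f a \<in> M) \<Longrightarrow> sum f A \<in> M"
  by (induction A rule: infinite_finite_induct) (auto intro: M_closed)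

lemma fd_algebra_finite_span:
  assumes X: "finite X" "finite Y"
  shows "\<exists>B. finite B \<and> fd_algebra X Y \<subseteq> span B"
proof (intro exI conjI subsetI)
  let ?P = "Y \<times> Y \<times> {F. fset F \<subseteq> X}"
  \<comment> \<open>The multiples by the imaginary unit are needed because \<open>span\<close> is
    the real span.\<close>
  let ?B = "(\<lambda>(c, i, j, F). op_scale c (elem i j F)) ` ({1, \<i>} \<times> ?P)"
  have P: "finite ?P" using X by (simp add: finite_fsets_below)
  show "finite ?B" using P by simp
  fix T assume T: "T \<in> fd_algebra X Y"
  let ?t = "\<lambda>(i, j, F). op_scale (coord (T (ket (j, {||}))) (i, F)) (elem i j F)"
  have "T = sum ?t ?P"
  proof (rule M_eqI[OF fd_algebra_M[OF T]])
    show "sum ?t ?P \<in> M" by (rule M_sum) (auto intro: M_closed elem_M)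
    fix k
    show "T (ket (k, {||})) = sum ?t ?P (ket (k, {||}))"
    proof (rule ell2_pair_eqI)
      fix i F
      let ?z = "coord (T (ket (k, {||}))) (i, F)"
      have "coord (sum ?t ?P (ket (k, {||}))) (i, F) = (\<Sum>p\<in>?P. coord (?t p (ket (k, {||}))) (i, F))"
        by (simp add: blinfun.sum_left)
      also have "\<dots> = (\<Sum>p\<in>?P. if p = (i, k, F) then ?z else 0)"
        by (intro sum.cong refl) (auto simp: coord_elem split: if_splits)
      also have "\<dots> = (if (i, k, F) \<in> ?P then ?z else 0)" using P by simp
      also have "\<dots> = ?z" using fd_algebraD[OF T, of k "{||}" i F] by auto
      finally show "?z = coord (sum ?t ?P (ket (k, {||}))) (i, F)" by simp
    qed
  qed
  also have "sum ?t ?P \<in> span ?B"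
  proof (rule span_sum)
    fix p assume p: "p \<in> ?P"
    obtain i j F where ijF: "p = (i, j, F)" by (cases p) auto
    define c where "c = coord (T (ket (j, {||}))) (i, F)"
    have "?t p = Re c *\<^sub>R op_scale 1 (elem i j F) + Im c *\<^sub>R op_scale \<i> (elem i j F)"
    proof (intro blinfun_eqI ell2_eqI)
      fix x k
      have "coord (?t p x) k = (of_real (Re c) + \<i> * of_real (Im c)) * coord (elem i j F x) k"
        by (simp add: ijF c_def[symmetric] flip: complex_eq)
      then show "coord (?t p x) k = coord ((Re c *\<^sub>R op_scale 1 (elem i j F) + Im c *\<^sub>R op_scale \<i> (elem i j F)) x) k"
        by (simp add: blinfun.add_left blinfun.scaleR_left algebra_simps)
    qed
    moreover have "op_scale d (elem i j F) \<in> span ?B" if "d \<in> {1, \<i>}" for d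
      by (rule span_base, rule image_eqI[where x = "(d, i, j, F)"]) (use p that in \<open>auto simp: ijF\<close>)
    ultimately show "?t p \<in> span ?B" by (simp add: span_add span_scale)
  qed
  finally show "T \<in> span ?B" .
qed

text \<open>Compression to \<open>Y\<close> followed by pinching along \<open>F \<mapsto> F - X\<close>. On the commutant \<open>M\<close> the pinching
  is the conditional expectation onto the elements with coefficients in the subsets of \<open>X\<close>, and it
  is visibly contractive.\<close>

definition pinch :: "'s set \<Rightarrow> 'i set \<Rightarrow> ('i \<times> 's fset) op \<Rightarrow> ('i \<times> 's fset) op" where
  "pinch X Y T = dsum (\<lambda>(i, F). fset F - X) (\<lambda>_. Pr (fst -` Y) o\<^sub>L T o\<^sub>L Pr (fst -` Y))"

context
  fixes T :: "('i \<times> 's fset) op"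
  assumes T: "T \<in> M"
begin

lemma compress_bounds:
  "clin (Pr (fst -` Y) o\<^sub>L T o\<^sub>L Pr (fst -` Y))" "norm (Pr (fst -` Y) o\<^sub>L T o\<^sub>L Pr (fst -` Y)) \<le> norm T"
proof -
  show "clin (Pr (fst -` Y) o\<^sub>L T o\<^sub>L Pr (fst -` Y))"
    using M_Bop[OF T] by (auto intro!: clin_comp simp: Bop_iff)
  let ?P = "Pr (fst -` Y) :: ('i \<times> 's fset) op"
  have "norm (?P o\<^sub>L T o\<^sub>L ?P) \<le> (norm ?P * norm T) * norm ?P"
    by (intro order_trans[OF norm_blinfun_compose] mult_right_mono norm_blinfun_compose) simp
  also have "\<dots> \<le> (1 * norm T) * 1"
    by (intro mult_mono norm_Pr) auto
  finally show "norm (?P o\<^sub>L T o\<^sub>L ?P) \<le> norm T" by simp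
qed

lemma clin_pinch: "clin (pinch X Y T)"
  unfolding pinch_def by (rule clin_dsum[where K = "norm T"]) (rule compress_bounds)+

lemma norm_pinch: "norm (pinch X Y T) \<le> norm T"
  unfolding pinch_def by (rule norm_dsum) (rule compress_bounds)+

lemma coord_pinch:
  "coord (pinch X Y T (ket (j, G))) (i, F) =
    (if fset F - X = fset G - X \<and> i \<in> Y \<and> j \<in> Y then coord (T (ket (j, G))) (i, F) else 0)"
proof -
  let ?\<pi> = "\<lambda>(i, F). fset F - X"
  have "coord (pinch X Y T (ket (j, G))) (i, F)
      = coord ((Pr (fst -` Y) o\<^sub>L T o\<^sub>L Pr (fst -` Y)) (Pr (?\<pi> -` {?\<pi> (i, F)}) (ket (j, G)))) (i, F)"
    unfolding pinch_def by (rule coord_dsum[where K = "norm T"]) (rule compress_bounds)+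
  also have "Pr (?\<pi> -` {?\<pi> (i, F)}) (ket (j, G)) = (if fset F - X = fset G - X then ket (j, G) else 0)"
    by (rule ell2_pair_eqI) auto
  also have "(Pr (fst -` Y) o\<^sub>L T o\<^sub>L Pr (fst -` Y)) (if fset F - X = fset G - X then ket (j, G) else 0)
      = (if fset F - X = fset G - X \<and> j \<in> Y then Pr (fst -` Y) (T (ket (j, G))) else 0)"
  proof -
    have "Pr (fst -` Y) (ket (j, G)) = (if j \<in> Y then ket (j, G) else 0)"
      by (rule ell2_pair_eqI) auto
    then show ?thesis by simp
  qed
  finally show ?thesis by simp
qed

lemma pinch_M: "pinch X Y T \<in> M"
proof (rule M_ketI)
  show "pinch X Y T \<in> Bop" using clin_pinch by (simp add: Bop_iff)
  fix i F j G
  \<comment> \<open>Lying in the same block means that the symmetric difference lies in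
    \<open>X\<close>. This condition is invariant under translation, which is why pinching stays in
    \<open>M\<close>.\<close>
  have "fset F - X = fset G - X \<longleftrightarrow> fset (sd F G) - X = fset {||} - X" by (auto simp: fset_sd)
  then show "coord (pinch X Y T (ket (j, G))) (i, F)
      = sg (sd F G) G * coord (pinch X Y T (ket (j, {||}))) (i, sd F G)"
    unfolding coord_pinch using M_ket[OF T, of j G i F] by simp
qed

lemma pinch_fd_algebra: "pinch X Y T \<in> fd_algebra X Y"
  by (rule fd_algebraI[OF pinch_M]) (auto simp: coord_pinch split: if_splits)

text \<open>The two projections of one finite set of pairs exhaust the matrix indices and the
  generators at the same time, so a single filter suffices.\<close>

lemma pinch_tendsto:
  "((\<lambda>Z. pinch (snd ` Z) (fst ` Z) T x) \<longlongrightarrow> T x) (finite_subsets_at_top (UNIV :: ('i \<times> 's) set))"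
proof (rule tendsto_of_ket[OF clin_pinch _ norm_pinch])
  show "clin T" using M_Bop[OF T] by (simp add: Bop_iff)
  fix k :: "'i \<times> 's fset"
  obtain j G where k: "k = (j, G)" by fastforce
  let ?B = "\<lambda>Z :: ('i \<times> 's) set. {(i, F). fset F - snd ` Z = fset G - snd ` Z \<and> i \<in> fst ` Z}"
  have fst_ev: "eventually (\<lambda>Z. i \<in> fst ` Z) (finite_subsets_at_top (UNIV :: ('i \<times> 's) set))" for i
    unfolding eventually_finite_subsets_at_top
    \<comment> \<open>Any second component will do, since only the first projection matters
      here.\<close>
    by (intro exI[of _ "{(i, undefined)}"]) (auto intro: rev_image_eqI)
  have "((\<lambda>Z. Pr (?B Z) (T (ket k))) \<longlongrightarrow> T (ket k)) (finite_subsets_at_top UNIV)"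
  proof (rule tendsto_Pr)
    fix l :: "'i \<times> 's fset"
    obtain i F where l: "l = (i, F)" by fastforce
    have "eventually (\<lambda>Z. fset F \<union> fset G \<subseteq> snd ` Z) (finite_subsets_at_top (UNIV :: ('i \<times> 's) set))"
      unfolding eventually_finite_subsets_at_top
      by (intro exI[of _ "{i} \<times> (fset F \<union> fset G)"]) force
    then show "eventually (\<lambda>Z. l \<in> ?B Z) (finite_subsets_at_top UNIV)"
      using fst_ev[of i] by eventually_elim (auto simp: l)
  qed
  moreover have "eventually (\<lambda>Z. Pr (?B Z) (T (ket k)) = pinch (snd ` Z) (fst ` Z) T (ket k)) (finite_subsets_at_top UNIV)"
    using fst_ev[of j] by eventually_elim (simp add: k coord_pinch, rule ell2_pair_eqI, simp add: coord_pinch)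
  ultimately show "((\<lambda>Z. pinch (snd ` Z) (fst ` Z) T (ket k)) \<longlongrightarrow> T (ket k)) (finite_subsets_at_top UNIV)"
    by (rule Lim_transform_eventually)
qed

end

lemma M_hyperfinite: "hyperfinite M"
  unfolding hyperfinite_def
proof (intro exI[of _ "{fd_algebra X Y | X Y. finite X \<and> finite Y}"] conjI ballI subsetI)
  let ?A = "{fd_algebra X Y | X Y. finite X \<and> finite Y}"
  show "?A \<noteq> {}" by blast
  fix A assume "A \<in> ?A"
  then obtain X Y where A: "A = fd_algebra X Y" "finite X" "finite Y" by blast
  show "star_subalgebra A" unfolding A(1) by (rule fd_algebra_star_subalgebra[OF A(2,3)])
  show "\<exists>B. finite B \<and> A \<subseteq> span B" unfolding A(1) by (rule fd_algebra_finite_span[OF A(2,3)])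
  show "T \<in> M" if "T \<in> A" for T using that fd_algebra_M by (simp add: A)
  fix A' assume "A' \<in> ?A"
  then obtain X' Y' where A': "A' = fd_algebra X' Y'" "finite X'" "finite Y'" by blast
  show "\<exists>C\<in>?A. A \<subseteq> C \<and> A' \<subseteq> C"
  proof (intro bexI[of _ "fd_algebra (X \<union> X') (Y \<union> Y')"] conjI)
    show "fd_algebra (X \<union> X') (Y \<union> Y') \<in> ?A" using A A' by auto
    show "A \<subseteq> fd_algebra (X \<union> X') (Y \<union> Y')" "A' \<subseteq> fd_algebra (X \<union> X') (Y \<union> Y')"
      unfolding A A' fd_algebra_def by blast+
  qed
next
  fix T assume T: "T \<in> M"
  show "T \<in> strong_operator_topology closure_of (\<Union>{fd_algebra X Y | X Y. finite X \<and> finite Y})"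
  proof (rule strong_operator_closureI[OF finite_subsets_at_top_neq_bot pinch_tendsto[OF T]])
    show "eventually (\<lambda>Z. pinch (snd ` Z) (fst ` Z) T \<in> \<Union>{fd_algebra X Y | X Y. finite X \<and> finite Y})
        (finite_subsets_at_top (UNIV :: ('i \<times> 's) set))"
      by (rule eventually_finite_subsets_at_top_weakI) (use pinch_fd_algebra[OF T] in blast)
  qed
qed

end


section \<open>Schur multipliers\<close>

lemma schur_map_entry:
  assumes A: "schur_multiplier A" and T: "T \<in> Bop"
  shows "schur_map A T \<in> Bop" "coord (schur_map A T (ket j)) i = A i j * coord (T (ket j)) i"
proof -
  obtain S where S: "S \<in> Bop" "\<And>i j. mat_entry S i j = A i j * mat_entry T i j"
    using A T unfolding schur_multiplier_def by blast
  have "schur_map A T = S"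
    unfolding schur_map_def
    by (rule the_equality) (use S in \<open>auto intro!: op_entry_eqI simp flip: mat_entry_coord\<close>)
  with S show "schur_map A T \<in> Bop" "coord (schur_map A T (ket j)) i = A i j * coord (T (ket j)) i"
    by (simp_all flip: mat_entry_coord)
qed

text \<open>The all-ones matrix on a finite set of indices is positive, and its Schur product with \<open>A\<close> is
  a finite section of \<open>A\<close>.\<close>

lemma ones_block_exists:
  assumes F: "finite F"
  shows "\<exists>T. op_positive T \<and> (\<forall>i j. coord (blinfun_apply T (ket j)) i = (if i \<in> F \<and> j \<in> F then 1 else 0))"
proof -
  let ?T = "\<Sum>i\<in>F. \<Sum>j\<in>F. matrix_unit i j"
  have Tx: "?T x = (\<Sum>i\<in>F. ell2_scale (\<Sum>j\<in>F. coord x j) (ket i))" for x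
    unfolding blinfun.sum_left
    by (intro sum.cong refl ell2_eqI) (simp add: coord_matrix_unit)
  have TB: "?T \<in> Bop" unfolding Bop_iff
    using matrix_unit_Bop by (intro clin_sum) (simp add: Bop_iff)
  have "cinner (?T x) x = of_real ((cmod (\<Sum>j\<in>F. coord x j))\<^sup>2)" for x
    unfolding Tx cinner_sum_left
    unfolding complex_norm_square cinner_scale_left cinner_ket_left
    by (simp flip: sum_distrib_left)
  then have "op_positive ?T" using TB by (simp add: op_positive_iff)
  moreover have "coord (?T (ket j)) i = (if i \<in> F \<and> j \<in> F then 1 else 0)" for i j
  proof -
    have s: "(\<Sum>k\<in>F. if k = j then 1 else 0) = (if j \<in> F then 1 else (0 :: complex))"
      using F by simp
    have "coord (?T (ket j)) i = (\<Sum>k\<in>F. if k = i then (if j \<in> F then 1 else 0) else 0)"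
      unfolding Tx coord_sum by (intro sum.cong refl) (auto simp: s)
    then show ?thesis using F by simp
  qed
  ultimately show ?thesis by blast
qed

lemma schur_kernel:
  assumes A: "schur_multiplier A" and re: "\<And>i j. A i j \<in> \<real>"
    and un: "unital (schur_map A)" and cp: "completely_positive Bop Bop (schur_map A)"
  shows "Re (A i i) = 1" "Re (A i j) = Re (A j i)"
    "finite F \<Longrightarrow> (\<Sum>i\<in>F. \<Sum>j\<in>F. t i * t j * Re (A i j)) \<ge> 0"
proof -
  have "coord (schur_map A id_blinfun (ket i)) i = A i i * coord (id_blinfun (ket i)) i"
    by (rule schur_map_entry[OF A]) simp
  then show "Re (A i i) = 1" using un by (simp add: unital_def)
  have block: "\<exists>S. op_positive S \<and> (\<forall>i\<in>F. \<forall>j\<in>F. coord (blinfun_apply S (ket j)) i = A i j)" if F: "finite F" for F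
  proof -
    obtain T where T: "op_positive T"
      "\<And>i j. coord (blinfun_apply T (ket j)) i = (if i \<in> F \<and> j \<in> F then 1 else 0)"
      using ones_block_exists[OF F] by blast
    have TB: "T \<in> Bop" using T(1) by (rule op_positive_Bop)
    \<comment> \<open>A positive operator is a positive matrix of size one, the form in which
      complete positivity can be applied.\<close>
    have "op_matrix_positive 1 (\<lambda>p q. T)"
      using T(1) by (simp add: op_matrix_positive_def op_positive_def)
    then have "op_matrix_positive 1 (\<lambda>p q. schur_map A T)"
      using cp TB unfolding completely_positive_def by fastforce
    then have pos: "cinner (schur_map A T x) x \<in> \<real>\<^sub>\<ge>\<^sub>0" for x
      unfolding op_matrix_positive_def by (auto dest: spec[of _ "\<lambda>_. x"])
    show ?thesis
      using pos schur_map_entry[OF A TB]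
      by (intro exI[of _ "schur_map A T"]) (simp add: op_positive_def T(2))
  qed
  obtain S where S: "op_positive S" "\<And>k l. k \<in> {i, j} \<Longrightarrow> l \<in> {i, j} \<Longrightarrow> coord (blinfun_apply S (ket l)) k = A k l"
    using block[of "{i, j}"] by blast
  have "A i j = cnj (A j i)"
    using coord_op_adj[OF op_positive_Bop[OF S(1)], of j i] by (simp add: op_positive_adj[OF S(1)] S(2))
  then show "Re (A i j) = Re (A j i)" by simp
  assume F: "finite F"
  obtain S where S: "op_positive S" "\<And>k l. k \<in> F \<Longrightarrow> l \<in> F \<Longrightarrow> coord (blinfun_apply S (ket l)) k = A k l"
    using block[OF F] by blast
  have AR: "A k l = of_real (Re (A k l))" for k l using re[of k l] by (simp add: complex_is_Real_iff complex_eq_iff)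
  let ?x = "\<Sum>j\<in>F. t j *\<^sub>R ket j"
  have "cinner (S ?x) ?x = (\<Sum>i\<in>F. \<Sum>j\<in>F. of_real (t i * t j) * coord (S (ket j)) i)"
    by (simp add: blinfun.sum_right blinfun.scaleR_right cinner_sum_left cinner_sum_right cinner_scaleR_left
        cinner_scaleR_right cinner_ket_right scaleR_conv_of_real sum_distrib_left mult_ac)
  also have "\<dots> = (\<Sum>i\<in>F. \<Sum>j\<in>F. of_real (t i * t j * Re (A i j)))"
    using S(2) AR by (intro sum.cong refl) (metis of_real_mult)
  also have "\<dots> = of_real (\<Sum>i\<in>F. \<Sum>j\<in>F. t i * t j * Re (A i j))" by simp
  finally have eq: "cinner (S ?x) ?x = of_real (\<Sum>i\<in>F. \<Sum>j\<in>F. t i * t j * Re (A i j))" .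
  have "Re (cinner (S ?x) ?x) \<ge> 0" using S(1) unfolding op_positive_iff by blast
  then show "(\<Sum>i\<in>F. \<Sum>j\<in>F. t i * t j * Re (A i j)) \<ge> 0" unfolding eq by simp
qed


section \<open>Slots and shifts\<close>

text \<open>Generators are indexed by \<open>'i \<times> nat\<close>, where the number encodes a slot \<open>(l, m)\<close> in \<open>nat \<times> int\<close>.
  The automorphism belonging to \<open>l\<close> shifts the slots \<open>(l, m)\<close> to \<open>(l, m + 1)\<close>. As generators are
  ordered by slots first, this preserves the order and no signs arise.\<close>

definition slot :: "nat \<Rightarrow> nat \<times> int" where
  "slot c = (fst (prod_decode c), int_decode (snd (prod_decode c)))"

definition unslot :: "nat \<times> int \<Rightarrow> nat" where
  "unslot p = prod_encode (fst p, int_encode (snd p))"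

lemma slot_unslot [simp]: "slot (unslot p) = p" and unslot_slot [simp]: "unslot (slot c) = c"
  by (simp_all add: slot_def unslot_def)

lemma slot_eq_iff: "slot c = p \<longleftrightarrow> c = unslot p"
  by auto

text \<open>The amount \<open>d\<close> is general so that the inverse of a shift is again a
  shift.\<close>

definition shift :: "nat \<Rightarrow> int \<Rightarrow> 'i \<times> nat \<Rightarrow> 'i \<times> nat" where
  "shift l d s = (fst s, if fst (slot (snd s)) = l then unslot (l, snd (slot (snd s)) + d) else snd s)"

lemma slot_shift:
  "slot (snd (shift l d s)) =
    (fst (slot (snd s)), if fst (slot (snd s)) = l then snd (slot (snd s)) + d else snd (slot (snd s)))"
  by (simp add: shift_def)

lemma fst_shift [simp]: "fst (shift l d s) = fst s"
  by (simp add: shift_def)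

lemma generator_eqI: "fst s = fst t \<Longrightarrow> slot (snd s) = slot (snd t) \<Longrightarrow> s = t"
  by (metis prod_eqI unslot_slot)

lemma shift_shift: "shift l d (shift l (- d) s) = s" "shift l (- d) (shift l d s) = s"
  by (rule generator_eqI, simp, simp add: slot_shift prod_eq_iff)+

lemma bij_shift: "bij (shift l d)"
  by (rule o_bij[of "shift l (- d)"]) (auto simp: fun_eq_iff shift_shift)

lemma inv_shift: "inv (shift l d) = shift l (- d)"
  by (rule inv_unique_comp) (auto simp: fun_eq_iff shift_shift)

lemma shift_commute: "shift l d (shift l' d' s) = shift l' d' (shift l d s)"
  by (rule generator_eqI) (auto simp: slot_shift)

text \<open>Lexicographic in the two components of the slot; the given order of \<open>'i\<close>
  breaks ties inside a slot.\<close>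

definition slot_less :: "'i rel \<Rightarrow> 'i \<times> nat \<Rightarrow> 'i \<times> nat \<Rightarrow> bool" where
  "slot_less r s t \<longleftrightarrow> fst (slot (snd s)) < fst (slot (snd t)) \<or>
    fst (slot (snd s)) = fst (slot (snd t)) \<and> (snd (slot (snd s)) < snd (slot (snd t)) \<or>
      snd (slot (snd s)) = snd (slot (snd t)) \<and> (fst s, fst t) \<in> r - Id)"

lemma slot_less_shift: "slot_less r (shift l d s) (shift l d t) \<longleftrightarrow> slot_less r s t"
  by (auto simp: slot_less_def slot_shift)

lemma clifford_slot_less:
  assumes "well_order_on UNIV r"
  shows "clifford (slot_less r)"
proof
  show "\<not> slot_less r s s" for s by (simp add: slot_less_def)
  fix s t :: "'a \<times> nat" assume st: "s \<noteq> t"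
  have r: "x \<noteq> y \<Longrightarrow> (x, y) \<in> r \<longleftrightarrow> (y, x) \<notin> r" for x y
    using assms unfolding well_order_on_def linear_order_on_def partial_order_on_def total_on_def antisym_def
    by blast
  show "slot_less r s t \<longleftrightarrow> \<not> slot_less r t s"
  proof (cases "slot (snd s) = slot (snd t)")
    case True
    then have "fst s \<noteq> fst t" using st generator_eqI by blast
    then have "(fst s, fst t) \<in> r - Id \<longleftrightarrow> (fst t, fst s) \<notin> r - Id" using r[of "fst s" "fst t"] by simp
    then show ?thesis by (simp add: slot_less_def True)
  next
    case False
    then have "fst (slot (snd s)) \<noteq> fst (slot (snd t)) \<or> snd (slot (snd s)) \<noteq> snd (slot (snd t))"
      by (simp add: prod_eq_iff)
    then show ?thesis unfolding slot_less_def by linarith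
  qed
qed

definition slot_field :: "nat \<Rightarrow> ('i \<Rightarrow> 'i \<Rightarrow> real) \<Rightarrow> 'i \<Rightarrow> 'i \<times> nat \<Rightarrow> real" where
  "slot_field l v i s = (if slot (snd s) = (l, 0) then v i (fst s) else 0)"

lemma slot_field_gram:
  assumes "((\<lambda>k. v i k * v j k) has_sum a) UNIV"
  shows "((\<lambda>s. slot_field l v i s * slot_field l v j s) has_sum a) UNIV"
proof -
  let ?h = "\<lambda>k. (k, unslot (l, 0))"
  have "((\<lambda>s. slot_field l v i s * slot_field l v j s) has_sum a) (range ?h)"
    by (subst has_sum_reindex) (use assms in \<open>auto simp: inj_on_def o_def slot_field_def\<close>)
  then show ?thesis
    by (rule has_sum_cong_neutral[THEN iffD1, rotated -1])
      (auto simp: slot_field_def slot_eq_iff image_iff)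
qed

theorem theorem1p9:
  fixes n :: nat and A :: "nat \<Rightarrow> 'i \<Rightarrow> 'i \<Rightarrow> complex"
  assumes "n \<ge> 1"
    and "\<And>l i j. l \<in> {1..n} \<Longrightarrow> A l i j \<in> \<real>"
    and "\<And>l. l \<in> {1..n} \<Longrightarrow> schur_multiplier (A l)"
    and "\<And>l. l \<in> {1..n} \<Longrightarrow> unital (schur_map (A l))"
    and "\<And>l. l \<in> {1..n} \<Longrightarrow> completely_positive Bop Bop (schur_map (A l))"
  shows "\<exists>(M :: 'i dilation_index op set) \<tau> U (J :: 'i op \<Rightarrow> _) E.
    von_neumann_algebra M \<and> hyperfinite M \<and> nsf_trace M \<tau> \<and>
    (\<forall>l\<in>{1..n}. star_automorphism M (U l) \<and> unital (U l) \<and> trace_preserving M \<tau> \<tau> (U l)) \<and>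
    (\<forall>l\<in>{1..n}. \<forall>m\<in>{1..n}. \<forall>x\<in>M. U l (U m x) = U m (U l x)) \<and>
    star_hom Bop M J \<and> unital J \<and> trace_preserving Bop Tr \<tau> J \<and> inj_on J Bop \<and> normal_map Bop M J \<and>
    canonical_cond_exp Bop Tr M \<tau> J E \<and> trace_preserving M \<tau> Tr E \<and>
    (\<forall>k. \<forall>x\<in>Bop.
       power_product n (\<lambda>l. schur_map (A l)) k x = E (power_product n U k (J x)))"
proof -
  have "\<exists>v :: 'i \<Rightarrow> 'i \<Rightarrow> real. \<forall>i j. ((\<lambda>k. v i k * v j k) has_sum Re (A l i j)) UNIV"
    if l: "l \<in> {1..n}" for l
  proof (rule gram_ell2)
    note K = schur_kernel[OF assms(3)[OF l] assms(2)[OF l] assms(4)[OF l] assms(5)[OF l]]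
    show "Re (A l i j) = Re (A l j i)" for i j by (rule K(2))
    show "Re (A l i i) = 1" for i by (rule K(1))
    show "(\<Sum>i\<in>F. \<Sum>j\<in>F. t i * t j * Re (A l i j)) \<ge> 0" if "finite F" for F and t :: "'i \<Rightarrow> real"
      by (rule K(3)[OF that])
  qed
  then obtain v :: "nat \<Rightarrow> 'i \<Rightarrow> 'i \<Rightarrow> real"
    where v: "\<And>l i j. l \<in> {1..n} \<Longrightarrow> ((\<lambda>k. v l i k * v l j k) has_sum Re (A l i j)) UNIV"
    by metis
  define u where "u l = slot_field l (v l)" for l
  have gram: "((\<lambda>s. u l i s * u l j s) has_sum Re (A l i j)) UNIV" if "l \<in> {1..n}" for l i j
    unfolding u_def by (rule slot_field_gram[OF v[OF that]])
  obtain r where r: "well_order_on (UNIV :: 'i set) r" using well_order_on by blast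
  interpret clifford "slot_less r" "TYPE('i)" by (rule clifford_slot_less[OF r])
  have aut: "order_aut (shift l 1)" for l
    unfolding order_aut_def by (simp add: bij_shift slot_less_shift)
  have unit: "unit_field (u l)" if l: "l \<in> {1..n}" for l
    unfolding unit_field_def
  proof
    fix i
    have "Re (A l i i) = 1"
      by (rule schur_kernel(1)[OF assms(3)[OF l] assms(2)[OF l] assms(4)[OF l] assms(5)[OF l]])
    then show "((\<lambda>s. (u l i s)\<^sup>2) has_sum 1) UNIV"
      using gram[OF l, of i i] by (simp add: power2_eq_square)
  qed
  define U where "U l = Um (shift l 1) (u l)" for l
  have commute: "U l (U m x) = U m (U l x)" if lm: "l \<in> {1..n}" "m \<in> {1..n}" for l m x
  proof (cases "l = m")
    case False
    show ?thesis unfolding U_def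
    proof (rule Um_commute[OF aut unit[OF lm(1)] aut unit[OF lm(2)]])
      show "shift l 1 (shift m 1 s) = shift m 1 (shift l 1 s)" for s :: "'i \<times> nat"
        by (rule shift_commute)
      show "u l i s = 0 \<or> u m j s = 0" for i j s using False by (simp add: u_def slot_field_def)
      show "shift l 1 s = s" if "u m i s \<noteq> 0" for i s
        using that False by (auto simp: u_def slot_field_def shift_def split: if_splits)
      show "shift m 1 s = s" if "u l i s \<noteq> 0" for i s
        using that False by (auto simp: u_def slot_field_def shift_def split: if_splits)
    qed
  qed simp
  text \<open>Products of powers of the automorphisms involve only slots \<open>(l, m)\<close> with \<open>m > 0\<close>.\<close>
  define Past where "Past T \<longleftrightarrow> (\<forall>s x. snd (slot (snd s)) \<le> 0 \<longrightarrow> blinfun_apply T (Cv s x) = Cv s (blinfun_apply T x))" for T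
  \<comment> \<open>The entry condition says \<open>Em T = x\<close>; together with
    \<open>Past\<close> it becomes an invariant of applying any \<open>U l\<close>.\<close>
  define dilates where "dilates T x \<longleftrightarrow> T \<in> M \<and> Past T \<and> x \<in> Bop \<and>
    (\<forall>i j. coord (blinfun_apply T (ket (j, {||}))) (i, {||}) = coord (blinfun_apply x (ket j)) i)" for T x
  have start: "dilates (Jm x) x" if "x \<in> Bop" for x
    unfolding dilates_def Past_def using that by (simp add: Jm_M Jm_Cm Jm_ket)
  have step: "dilates (U l T) (schur_map (A l) x)" if l: "l \<in> {1..n}" and d: "dilates T x" for l T x
    unfolding dilates_def
  proof (intro conjI allI)
    have T: "T \<in> M" "Past T" and x: "x \<in> Bop"
      and Tx: "\<And>i j. coord (T (ket (j, {||}))) (i, {||}) = coord (blinfun_apply x (ket j)) i"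
      using d by (auto simp: dilates_def)
    show "U l T \<in> M" unfolding U_def by (rule Um_M[OF aut unit[OF l] T(1)])
    show "schur_map (A l) x \<in> Bop" by (rule schur_map_entry(1)[OF assms(3)[OF l] x])
    show "Past (U l T)"
      unfolding Past_def U_def
    proof (intro allI impI Um_commute_Cv[OF aut unit[OF l]])
      fix s :: "'i \<times> nat" and y i
      assume s: "snd (slot (snd s)) \<le> 0"
      then have "snd (slot (snd (inv (shift l 1) s))) \<le> 0" by (simp add: inv_shift slot_shift)
      then show "T (Cv (inv (shift l 1) s) y) = Cv (inv (shift l 1) s) (T y)"
        using T(2) unfolding Past_def by blast
      \<comment> \<open>The backward shift takes a slot \<open>(l, m)\<close> with m \<le> 0 to a
        negative position and leaves slots with another first component in place, so it never
        arrives at \<open>(l, 0)\<close>, where \<open>u l\<close> lives.\<close>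
      show "u l i (inv (shift l 1) s) = 0"
        using s by (auto simp: u_def slot_field_def inv_shift slot_shift)
    qed
    fix i j
    have "coord (U l T (ket (j, {||}))) (i, {||}) = of_real (Re (A l i j)) * coord (T (ket (j, {||}))) (i, {||})"
      unfolding U_def
    proof (rule Um_vacuum[OF aut unit[OF l] T(1) _ gram[OF l]])
      fix k s y assume "u l k s \<noteq> 0"
      then have "snd (slot (snd s)) \<le> 0" by (simp add: u_def slot_field_def split: if_splits)
      then show "T (Cv s y) = Cv s (T y)" using T(2) unfolding Past_def by blast
    qed
    also have "of_real (Re (A l i j)) = A l i j" using assms(2)[OF l, of i j] by simp
    finally show "coord (U l T (ket (j, {||}))) (i, {||}) = coord (schur_map (A l) x (ket j)) i"
      by (simp add: Tx schur_map_entry(2)[OF assms(3)[OF l] x])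
  qed
  have powers: "dilates ((U l ^^ p) T) ((schur_map (A l) ^^ p) x)"
    if l: "l \<in> {1..n}" and d: "dilates T x" for l T x p
    by (induction p) (use d step[OF l] in auto)
  \<comment> \<open>An arbitrary list of indices is used because \<open>power_product\<close> is a
    fold over a list, and the induction removes its head.\<close>
  have products: "dilates (foldr (\<lambda>l g. (U l ^^ k l) \<circ> g) ls id (Jm x)) (foldr (\<lambda>l g. (schur_map (A l) ^^ k l) \<circ> g) ls id x)"
    if "set ls \<subseteq> {1..n}" "x \<in> Bop" for ls k x
    using that(1) by (induction ls) (use start[OF that(2)] powers in auto)
  have dilation: "power_product n (\<lambda>l. schur_map (A l)) k x = Em (power_product n U k (Jm x))" if x: "x \<in> Bop" for k x
  proof -
    have d: "dilates (power_product n U k (Jm x)) (power_product n (\<lambda>l. schur_map (A l)) k x)"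
      unfolding power_product_def by (rule products[OF _ x]) auto
    show ?thesis
      by (rule op_entry_eqI) (use d in \<open>auto simp: dilates_def coord_Em M_Bop Em_Bop\<close>)
  qed
  show ?thesis
    by (intro exI[of _ M] exI[of _ \<tau>] exI[of _ U] exI[of _ Jm] exI[of _ Em] conjI ballI allI
        M_vn M_hyperfinite tr_nsf commute Jm_star_hom Jm_unital Jm_trace_preserving Jm_inj Jm_normal
        Em_cond_exp Em_trace_preserving dilation)
      (auto simp: U_def intro!: Um_automorphism Um_unital Um_trace aut unit)
qed

end
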